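(* Let $K_1$ and $K_2$ be finite simplicial complexes equipped with tame Morse tilings (resp. tame Morse shellings) $\tau_1$ and $\tau_2$. Then $K_1\times K_2$ carries primitive triangulations equipped with tame Morse tilings (resp. tame Morse shellings). Moreover, if $\tau_1$ and $\tau_2$ are pure dimensional, these Morse tilings have palindromic $h$-vectors provided $h(\tau_1)$ and $h(\tau_2)$ are palindromic.
   Context: A facet of a simplex is a codimension one face (the empty set is regarded as the unique facet of a $0$-simplex). A Morse tile of dimension $n$ and order $k\in\{0,\dots,n+1\}$ is a closed $n$-simplex $\sigma$ (its underlying simplex) deprived of $k$ of its facets together with, if $k\ge 1$, a possibly empty face $\mu$ of codimension at least two (the Morse face); when $\mu$ is non-empty it is understood not to be contained in the removed facets, so that $k-1\le\dim\mu\le n-2$. Let $K$ be a finite simplicial complex. A Morse tiling of a subset $S\subset|K|$ is a partition of $S$ by Morse tiles, each obtained from a simplex of $K$, such that for every $j\ge 0$ the union of the tiles of dimension $\ge j$ is closed in $S$. A Morse tiled subset of $S$ is a union of tiles closed in $S$. A Morse shelling of $S$ is a Morse tiling together with a filtration $\emptyset\subset S_1\subset\dots\subset S_N=S$ by Morse tiled subsets such that $S_1$ and each $S_i\setminus S_{i-1}$ ($2\le i\le N$) is a single tile. A tiling or shelling of $K$ means one of $S=|K|$. It is pure dimensional if all tiles have the same dimension. The $h$-vector of an $n$-dimensional Morse tiling $\tau$ is $h(\tau)=(h_0(\tau),\dots,h_{n+1}(\tau))$, $h_k(\tau)$ being the number of tiles of order $k$; a vector $(v_0,\dots,v_N)$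 is palindromic if $v_i=v_{N-i}$ for all $i$. A Morse tiling (or shelling) is tame if there is an orientation of all edges of the underlying simplicial complex such that (1) no triangle of the complex has boundary an oriented one-cycle; (2) for every tile with underlying simplex $\sigma$ and non-empty Morse face $\mu$, all edges joining a vertex of $\sigma$ not in $\mu$ to a vertex of $\mu$ are oriented towards $\mu$. $K_1\times K_2$ is a polyhedral complex whose cells are products of simplices. A primitive triangulation of it is a triangulation (each cell being a union of affine simplices) having the same set of vertices as the polyhedral complex. *)

theory Defs
  imports "HOL-Analysis.Analysis"
begin

text \<open>
  Finite simplicial complexes are the geometric ones of \<^const>\<open>simplicial_complex\<close>: finite sets
  of affine simplices in a Euclidean space. They may contain the empty simplex, which has
  affine dimension \<open>-1\<close> and is ignored below.
\<close>

text \<open>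
  Unlike the library's \<^const>\<open>facet_of\<close>, this allows the empty set, as the unique facet of a
  0-simplex.
\<close>

definition simplex_facet :: "'a::euclidean_space set \<Rightarrow> 'a set \<Rightarrow> bool" where
  "simplex_facet F \<sigma> \<longleftrightarrow> F face_of \<sigma> \<and> aff_dim F = aff_dim \<sigma> - 1"

text \<open>
  A tile is recorded as its underlying simplex, the set of its removed facets, and its Morse face
  (the empty set if there is none). The point set alone would not determine the order: the
  0-dimensional tiles of order 0 and of order 1 on a vertex are both that vertex.
\<close>

record 'a morse_tile =
  underlying :: "'a set"
  removed :: "'a set set"
  morse_face :: "'a set"

definition is_morse_tile :: "'a::euclidean_space morse_tile \<Rightarrow> bool" where
  "is_morse_tile t \<longleftrightarrow>
     (\<exists>n::nat. int n simplex underlying t) \<and>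
     (\<forall>F \<in> removed t. simplex_facet F (underlying t)) \<and>
     (morse_face t \<noteq> {} \<longrightarrow>
        removed t \<noteq> {} \<and>
        morse_face t face_of underlying t \<and>
        aff_dim (morse_face t) \<le> aff_dim (underlying t) - 2 \<and>
        (\<forall>F \<in> removed t. \<not> morse_face t \<subseteq> F))"

definition tile_set :: "'a morse_tile \<Rightarrow> 'a set" where
  "tile_set t = underlying t - \<Union>(removed t) - morse_face t"

definition tile_dim :: "'a::euclidean_space morse_tile \<Rightarrow> nat" where
  "tile_dim t = nat (aff_dim (underlying t))"

definition tile_order :: "'a morse_tile \<Rightarrow> nat" where
  "tile_order t = card (removed t)"

definition morse_tiling ::
    "'a::euclidean_space set set \<Rightarrow> 'a set \<Rightarrow> 'a morse_tile set \<Rightarrow> bool" where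
  "morse_tiling K S \<tau> \<longleftrightarrow>
     S \<subseteq> \<Union>K \<and>
     (\<forall>t \<in> \<tau>. is_morse_tile t \<and> underlying t \<in> K) \<and>
     (\<Union>t \<in> \<tau>. tile_set t) = S \<and>
     (\<forall>s \<in> \<tau>. \<forall>t \<in> \<tau>. s \<noteq> t \<longrightarrow> tile_set s \<inter> tile_set t = {}) \<and>
     (\<forall>j. closedin (top_of_set S) (\<Union>t \<in> {t \<in> \<tau>. j \<le> tile_dim t}. tile_set t))"

definition morse_tiled_subset ::
    "'a::euclidean_space set \<Rightarrow> 'a morse_tile set \<Rightarrow> 'a set \<Rightarrow> bool" where
  "morse_tiled_subset S \<tau> X \<longleftrightarrow>
     (\<exists>\<upsilon> \<subseteq> \<tau>. X = (\<Union>t \<in> \<upsilon>. tile_set t)) \<and> closedin (top_of_set S) X"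

text \<open>
  The filtration is \<open>\<Phi> 1 \<subset> \<dots> \<subset> \<Phi> N\<close>; the convention \<open>\<Phi> 0 = {}\<close> lets the
  condition on consecutive differences also say that \<open>\<Phi> 1\<close> is a single tile.
\<close>

definition morse_shelling ::
    "'a::euclidean_space set set \<Rightarrow> 'a set \<Rightarrow> 'a morse_tile set \<Rightarrow> nat \<Rightarrow> (nat \<Rightarrow> 'a set) \<Rightarrow> bool" where
  "morse_shelling K S \<tau> N \<Phi> \<longleftrightarrow>
     morse_tiling K S \<tau> \<and> 1 \<le> N \<and> \<Phi> 0 = {} \<and> \<Phi> N = S \<and>
     (\<forall>i \<in> {1..N}. \<Phi> (i - 1) \<subset> \<Phi> i \<and> morse_tiled_subset S \<tau> (\<Phi> i) \<and>
        (\<exists>t \<in> \<tau>. \<Phi> i - \<Phi> (i - 1) = tile_set t))"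

text \<open>\<open>(v, w) \<in> R\<close> means that the edge joining \<open>v\<close> and \<open>w\<close> is oriented from \<open>v\<close> to \<open>w\<close>.\<close>

definition edge_orientation :: "'a::euclidean_space set set \<Rightarrow> ('a \<times> 'a) set \<Rightarrow> bool" where
  "edge_orientation K R \<longleftrightarrow>
     (\<forall>v w. (v, w) \<in> R \<or> (w, v) \<in> R \<longleftrightarrow>
        1 simplex (convex hull {v, w}) \<and> convex hull {v, w} \<in> K) \<and>
     (\<forall>v w. (v, w) \<in> R \<longrightarrow> (w, v) \<notin> R)"

definition tame :: "'a::euclidean_space set set \<Rightarrow> 'a morse_tile set \<Rightarrow> bool" where
  "tame K \<tau> \<longleftrightarrow> (\<exists>R. edge_orientation K R \<and>
     (\<forall>a b c. 2 simplex (convex hull {a, b, c}) \<and> convex hull {a, b, c} \<in> K \<longrightarrow>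
        \<not> ((a, b) \<in> R \<and> (b, c) \<in> R \<and> (c, a) \<in> R)) \<and>
     (\<forall>t \<in> \<tau>. morse_face t \<noteq> {} \<longrightarrow>
        (\<forall>v w. v extreme_point_of underlying t \<and> v \<notin> morse_face t \<and>
           w extreme_point_of morse_face t \<longrightarrow> (v, w) \<in> R)))"

definition tame_morse_tiling :: "'a::euclidean_space set set \<Rightarrow> 'a morse_tile set \<Rightarrow> bool" where
  "tame_morse_tiling K \<tau> \<longleftrightarrow> morse_tiling K (\<Union>K) \<tau> \<and> tame K \<tau>"

definition tame_morse_shelling ::
    "'a::euclidean_space set set \<Rightarrow> 'a morse_tile set \<Rightarrow> nat \<Rightarrow> (nat \<Rightarrow> 'a set) \<Rightarrow> bool" where
  "tame_morse_shelling K \<tau> N \<Phi> \<longleftrightarrow> morse_shelling K (\<Union>K) \<tau> N \<Phi> \<and> tame K \<tau>"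

definition pure_dimensional :: "'a::euclidean_space morse_tile set \<Rightarrow> bool" where
  "pure_dimensional \<tau> \<longleftrightarrow> (\<exists>n. \<forall>t \<in> \<tau>. tile_dim t = n)"

definition tiling_dim :: "'a::euclidean_space morse_tile set \<Rightarrow> nat" where
  "tiling_dim \<tau> = Max (tile_dim ` \<tau>)"

text \<open>The list \<open>[h 0, \<dots>, h (n + 1)]\<close>, where \<open>n\<close> is the dimension of the tiling.\<close>

definition h_vector :: "'a::euclidean_space morse_tile set \<Rightarrow> nat list" where
  "h_vector \<tau> = map (\<lambda>k. card {t \<in> \<tau>. tile_order t = k}) [0..<tiling_dim \<tau> + 2]"

definition palindromic :: "'b list \<Rightarrow> bool" where
  "palindromic v \<longleftrightarrow> (\<forall>i < length v. v ! i = v ! (length v - 1 - i))"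

definition product_complex :: "'a set set \<Rightarrow> 'b set set \<Rightarrow> ('a \<times> 'b) set set" where
  "product_complex K L = {\<sigma> \<times> \<tau> | \<sigma> \<tau>. \<sigma> \<in> K \<and> \<tau> \<in> L}"

definition complex_vertices :: "'a set set \<Rightarrow> 'a set" where
  "complex_vertices P = {v. {v} \<in> P}"

definition primitive_triangulation :: "'a::euclidean_space set set \<Rightarrow> 'a set set \<Rightarrow> bool" where
  "primitive_triangulation P T \<longleftrightarrow>
     simplicial_complex T \<and> \<Union>T = \<Union>P \<and>
     (\<forall>C \<in> P. \<exists>U \<subseteq> T. C = \<Union>U) \<and>
     complex_vertices T = complex_vertices P"

end

theory Submission
  imports Defs
begin

text \<open>
  The idea. Tameness orders the vertices of every simplex, compatibly with faces, so that each
  cell \<open>\<sigma>1 \<times> \<sigma>2\<close> has its staircase triangulation: its simplices are the chains of vertices for the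
  product order, and the maximal ones are the lattice paths from \<open>(0,0)\<close> to \<open>(n,m)\<close>. A point of
  the product lies in exactly one open simplex spanned by a chain (its carrier), because the
  weights on a chain are determined by their row and column sums. This gives the primitive
  triangulation (\<open>staircase_primitive\<close>).

  The products of a tile of \<open>K1\<close> and a tile of \<open>K2\<close> partition the product, and each of them can be
  tiled independently of the others. In terms of carriers, a tile with removed facets opposite to
  the vertices \<open>A\<close> and with Morse face spanned by \<open>M\<close> consists of the \<open>s\<close> with \<open>A \<subseteq> s\<close> and
  \<open>\<not> s \<subseteq> M\<close>; tameness says that \<open>M\<close> is a final segment of the vertices, so that the second
  condition says that \<open>s\<close> meets an initial segment. It remains to partition the chains \<open>s\<close> that
  meet prescribed rows \<open>I\<close>, prescribed columns \<open>J\<close> and two initial segments.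

  For that, choose labels \<open>u 0, \<dots>, u (n+1)\<close> with \<open>u i < u (i+1)\<close> exactly for \<open>i \<in> I\<close>, and likewise
  \<open>v 0, \<dots>, v (m+1)\<close> for \<open>J\<close>, with \<open>u 0 = v 0\<close> and \<open>u (n+1) = v (m+1)\<close>. A lattice path is a shuffle
  of \<open>u 1, \<dots>, u n\<close> with \<open>v 1, \<dots>, v m\<close>. Its vertices are the gaps between consecutive letters of
  the shuffled word, and the required vertices (corners) are the ascents of this word. As in the
  theory of \<open>P\<close>-partitions, a chain \<open>s\<close> hitting \<open>I\<close> and \<open>J\<close> lies between the corners and the
  vertices of exactly one path: sort the rows and columns by the order in which \<open>s\<close> passes them,
  and resolve ties by decreasing label (\<open>chain_in_some_interval\<close>, \<open>shuffle_of_chain_forward\<close>). On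
  a path, the two initial segments are nested, so only the smaller one matters; its complement is
  a final segment, hence a Morse face satisfying the tameness condition, unless the corners
  already meet the smaller segment or the segment is a single vertex, which then is one more
  required vertex.

  Ordering the paths by their number of inversions with respect to the labels shells each product
  of tiles, since the chains in a path are assigned to it or to paths with fewer inversions
  (\<open>inversions_mono\<close>). The shelling of the product runs through the pairs of tiles
  lexicographically (\<open>product_shelling\<close>).

  Apart from the exceptional cases below, the order of a tile of the product is the number of
  corners of its path. How many paths have \<open>j\<close> corners depends only on \<open>|I|\<close> and \<open>|J|\<close>: the
  numbers of chains of each size that hit \<open>I\<close> and \<open>J\<close> determine it, and they depend only on
  cardinalities by inclusion-exclusion (\<open>corner_count_cong\<close>). Changing the sign of all labels
  complements \<open>I\<close>, \<open>J\<close> and the corners. Hence the orders for \<open>(|I|, |J|)\<close> and for the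
  complementary sizes are mirror images (\<open>order_count_symmetric\<close>), and palindromic \<open>h\<close>-vectors
  give palindromic \<open>h\<close>-vectors. Suitable labels exist except when \<open>I\<close> is everything and \<open>J\<close> is
  empty, or conversely; these two cases correspond to each other under the symmetry and are
  treated by hand, replacing the requirement that \<open>s\<close> hits the first row (or column) by an initial
  segment.
\<close>

section \<open>Lattice paths as words\<close>

text \<open>
  A word stands for the lattice path from \<open>(0,0)\<close> that increases the first coordinate (the row) at
  each letter True and the second one (the column) at each letter False.
\<close>

definition ups :: "bool list \<Rightarrow> nat \<Rightarrow> nat" where
  "ups w t = length (filter id (take t w))"

definition rts :: "bool list \<Rightarrow> nat \<Rightarrow> nat" where
  "rts w t = length (filter Not (take t w))"

definition words :: "nat \<Rightarrow> nat \<Rightarrow> bool list set" where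
  "words n m = {w. length (filter id w) = n \<and> length (filter Not w) = m}"

lemma filter_id_Not_length: "length (filter id w) + length (filter Not w) = length w"
  by (induction w) auto

lemma words_length: "w \<in> words n m \<Longrightarrow> length w = n + m"
  using filter_id_Not_length[of w] by (auto simp: words_def)

lemma finite_words [simp]: "finite (words n m)"
proof (rule finite_subset)
  show "words n m \<subseteq> {w. set w \<subseteq> UNIV \<and> length w = n + m}" using words_length by auto
  show "finite {w. set w \<subseteq> (UNIV :: bool set) \<and> length w = n + m}"
    by (rule finite_lists_length_eq) simp
qed

lemma ups_rts: "t \<le> length w \<Longrightarrow> ups w t + rts w t = t"
  using filter_id_Not_length[of "take t w"] by (simp add: ups_def rts_def)

lemma ups_0 [simp]: "ups w 0 = 0" and rts_0 [simp]: "rts w 0 = 0"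
  by (simp_all add: ups_def rts_def)

lemma ups_Suc: "t < length w \<Longrightarrow> ups w (Suc t) = ups w t + (if w ! t then 1 else 0)"
  and rts_Suc: "t < length w \<Longrightarrow> rts w (Suc t) = rts w t + (if w ! t then 0 else 1)"
  by (simp_all add: ups_def rts_def take_Suc_conv_app_nth)

lemma ups_positive: "t < length w \<Longrightarrow> w ! t \<Longrightarrow> 0 < ups w (Suc t)"
  by (simp add: ups_Suc)

lemma ups_full: "w \<in> words n m \<Longrightarrow> ups w (length w) = n"
  and rts_full: "w \<in> words n m \<Longrightarrow> rts w (length w) = m"
  by (simp_all add: ups_def rts_def words_def)

lemma ups_mono: "s \<le> t \<Longrightarrow> ups w s \<le> ups w t"
proof -
  assume "s \<le> t"
  then have "take s w = take s (take t w)" by (simp add: min_def)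
  moreover have "length (filter id (take s x)) \<le> length (filter id x)" for x :: "bool list"
    by (metis append_take_drop_id filter_append le_add1 length_append)
  ultimately show ?thesis unfolding ups_def by metis
qed

lemma filter_id_map_Not: "length (filter id (map Not w)) = length (filter Not w)"
  and filter_Not_map_Not: "length (filter Not (map Not w)) = length (filter id w)"
  by (induction w) auto

lemma ups_map_Not: "ups (map Not w) = rts w" and rts_map_Not: "rts (map Not w) = ups w"
  by (simp_all only: ups_def rts_def take_map filter_id_map_Not filter_Not_map_Not fun_eq_iff simp_thms)

lemma words_map_Not: "map Not w \<in> words m n \<longleftrightarrow> w \<in> words n m"
  by (simp only: words_def mem_Collect_eq filter_id_map_Not filter_Not_map_Not conj_commute)

lemma rts_mono: "s \<le> t \<Longrightarrow> rts w s \<le> rts w t"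
  using ups_mono[of s t "map Not w"] by (simp add: ups_map_Not)

lemma ups_le: "w \<in> words n m \<Longrightarrow> t \<le> length w \<Longrightarrow> ups w t \<le> n"
  and rts_le: "w \<in> words n m \<Longrightarrow> t \<le> length w \<Longrightarrow> rts w t \<le> m"
  using ups_mono[of t "length w" w] rts_mono[of t "length w" w] ups_full rts_full by force+

definition pos :: "bool list \<Rightarrow> nat \<Rightarrow> nat \<times> nat" where
  "pos w t = (ups w t, rts w t)"

definition lattice_path :: "bool list \<Rightarrow> (nat \<times> nat) set" where
  "lattice_path w = pos w ` {..length w}"

lemma pos_inj: "inj_on (pos w) {..length w}"
  by (rule inj_onI) (metis atMost_iff pos_def prod.inject ups_rts)

definition is_chain :: "(nat \<times> nat) set \<Rightarrow> bool" where
  "is_chain s \<longleftrightarrow> (\<forall>c\<in>s. \<forall>c'\<in>s. c \<le> c' \<or> c' \<le> c)"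

lemma path_chain: "is_chain (lattice_path w)"
proof -
  have "pos w s \<le> pos w t \<or> pos w t \<le> pos w s" for s t
    by (cases "s \<le> t") (auto simp: pos_def ups_mono rts_mono)
  then show ?thesis by (auto simp: is_chain_def lattice_path_def)
qed

lemma path_grid: "w \<in> words n m \<Longrightarrow> lattice_path w \<subseteq> {..n} \<times> {..m}"
  by (auto simp: lattice_path_def pos_def ups_le rts_le)

text \<open>
  As a shuffle of the rows \<open>1, \<dots>, n\<close> with the columns \<open>1, \<dots>, m\<close>, a path enters row \<open>i\<close> before it
  enters column \<open>j\<close>. These comparisons determine the path (\<open>word_unique\<close>), and every monotone
  table of comparisons arises (\<open>word_exists\<close>).
\<close>

definition prec :: "bool list \<Rightarrow> nat \<Rightarrow> nat \<Rightarrow> bool" where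
  "prec w i j \<longleftrightarrow> (\<exists>c\<in>lattice_path w. i \<le> fst c \<and> snd c < j)"

lemma pos_append: "t \<le> length w \<Longrightarrow> pos (w @ [b]) t = pos w t"
  by (simp add: pos_def ups_def rts_def)

lemma path_snoc: "lattice_path (w @ [b]) = insert (pos (w @ [b]) (Suc (length w))) (lattice_path w)"
proof -
  have "lattice_path (w @ [b]) = pos (w @ [b]) ` insert (Suc (length w)) {..length w}"
    by (simp add: lattice_path_def atMost_Suc)
  also have "\<dots> = insert (pos (w @ [b]) (Suc (length w))) (pos w ` {..length w})"
    by (simp add: pos_append)
  finally show ?thesis by (simp add: lattice_path_def)
qed

lemma pos_full: "w \<in> words n m \<Longrightarrow> pos w (length w) = (n, m)"
  by (simp add: pos_def ups_full rts_full)

lemma end_in_path: "w \<in> words n m \<Longrightarrow> (n, m) \<in> lattice_path w"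
  unfolding lattice_path_def by (rule image_eqI[of _ _ "length w"]) (simp_all add: pos_full)

lemma prec_snoc: "w @ [b] \<in> words n m \<Longrightarrow> j \<le> m \<Longrightarrow> prec (w @ [b]) i j \<longleftrightarrow> prec w i j"
  using pos_full[of "w @ [b]" n m] by (auto simp: prec_def path_snoc)

lemma words_snoc_True: "w @ [True] \<in> words n m \<longleftrightarrow> n > 0 \<and> w \<in> words (n - 1) m"
  and words_snoc_False: "w @ [False] \<in> words n m \<longleftrightarrow> m > 0 \<and> w \<in> words n (m - 1)"
  by (auto simp: words_def)

lemma prec_last_False:
  assumes "w @ [False] \<in> words n m" "i \<le> n" shows "prec w i m"
proof -
  have "w \<in> words n (m - 1)" "m > 0" using assms by (simp_all add: words_snoc_False)
  then show ?thesis using end_in_path[of w n "m - 1"] assms(2) by (force simp: prec_def)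
qed

lemma prec_last_True:
  assumes "w @ [True] \<in> words n m" shows "\<not> prec w n j"
proof -
  have "w \<in> words (n - 1) m" "n > 0" using assms by (simp_all add: words_snoc_True)
  then show ?thesis using path_grid[of w "n - 1" m] by (force simp: prec_def)
qed

text \<open>
  The last step of the path can be read off from the comparison of the last row with the last
  column: by monotonicity, the larger of the two comes after everything else.
\<close>

lemma word_exists:
  assumes "\<And>i i' j. 1 \<le> i \<Longrightarrow> i \<le> i' \<Longrightarrow> i' \<le> n \<Longrightarrow> 1 \<le> j \<Longrightarrow> j \<le> m \<Longrightarrow> L i' j \<Longrightarrow> L i j"
    and "\<And>i j j'. 1 \<le> i \<Longrightarrow> i \<le> n \<Longrightarrow> 1 \<le> j \<Longrightarrow> j \<le> j' \<Longrightarrow> j' \<le> m \<Longrightarrow> L i j \<Longrightarrow> L i j'"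
  shows "\<exists>w\<in>words n m. \<forall>i\<in>{1..n}. \<forall>j\<in>{1..m}. prec w i j = L i j"
  using assms
proof (induction "n + m" arbitrary: n m)
  case 0
  then show ?case by (auto simp: words_def intro!: exI[of _ "[]"])
next
  case (Suc k)
  show ?case
  proof (cases "m > 0 \<and> (n = 0 \<or> L n m)")
    case True
    have "\<exists>w\<in>words n (m - 1). \<forall>i\<in>{1..n}. \<forall>j\<in>{1..m - 1}. prec w i j = L i j"
    proof (rule Suc.hyps(1))
      show "k = n + (m - 1)" using Suc.hyps(2) True by simp
      show "L i j" if "1 \<le> i" "i \<le> i'" "i' \<le> n" "1 \<le> j" "j \<le> m - 1" "L i' j" for i i' j
        using Suc.prems(1)[of i i' j] that by simp
      show "L i j'" if "1 \<le> i" "i \<le> n" "1 \<le> j" "j \<le> j'" "j' \<le> m - 1" "L i j" for i j j'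
        using Suc.prems(2)[of i j j'] that by simp
    qed
    then obtain w where w: "w \<in> words n (m - 1)" "\<forall>i\<in>{1..n}. \<forall>j\<in>{1..m - 1}. prec w i j = L i j" by blast
    have W: "w @ [False] \<in> words n m" using w True by (simp add: words_snoc_False)
    have "prec (w @ [False]) i j = L i j" if "i \<in> {1..n}" "j \<in> {1..m}" for i j
    proof (cases "j = m")
      case j: True
      have "L i m" using Suc.prems(1)[of i n m] True that by auto
      moreover have "prec w i m" using prec_last_False[OF W, of i] that by auto
      ultimately show ?thesis using prec_snoc[OF W, of j i] that j by auto
    next
      case False
      then have "j \<in> {1..m - 1}" using that by auto
      then show ?thesis using w that prec_snoc[OF W, of j i] by auto
    qed
    then show ?thesis using W by blast
  next
    case False
    then have n: "n > 0" using Suc.hyps(2) by auto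
    have "\<exists>w\<in>words (n - 1) m. \<forall>i\<in>{1..n - 1}. \<forall>j\<in>{1..m}. prec w i j = L i j"
    proof (rule Suc.hyps(1))
      show "k = n - 1 + m" using Suc.hyps(2) n by simp
      show "L i j" if "1 \<le> i" "i \<le> i'" "i' \<le> n - 1" "1 \<le> j" "j \<le> m" "L i' j" for i i' j
        using Suc.prems(1)[of i i' j] that by simp
      show "L i j'" if "1 \<le> i" "i \<le> n - 1" "1 \<le> j" "j \<le> j'" "j' \<le> m" "L i j" for i j j'
        using Suc.prems(2)[of i j j'] that by simp
    qed
    then obtain w where w: "w \<in> words (n - 1) m" "\<forall>i\<in>{1..n - 1}. \<forall>j\<in>{1..m}. prec w i j = L i j" by blast
    have W: "w @ [True] \<in> words n m" using w n by (simp add: words_snoc_True)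
    have "prec (w @ [True]) i j = L i j" if "i \<in> {1..n}" "j \<in> {1..m}" for i j
    proof (cases "i = n")
      case i: True
      have "\<not> L n j" using Suc.prems(2)[of n j m] False that n by auto
      moreover have "\<not> prec w n j" using prec_last_True[OF W] .
      ultimately show ?thesis using prec_snoc[OF W, of j i] that i by auto
    next
      case False
      then have "i \<in> {1..n - 1}" using that by auto
      then show ?thesis using w that prec_snoc[OF W, of j i] by auto
    qed
    then show ?thesis using W by blast
  qed
qed

lemma word_unique:
  assumes "w \<in> words n m" "w' \<in> words n m"
    and "\<And>i j. i \<in> {1..n} \<Longrightarrow> j \<in> {1..m} \<Longrightarrow> prec w i j = prec w' i j"
  shows "w = w'"
  using assms
proof (induction w arbitrary: w' n m rule: rev_induct)
  case Nil
  then show ?case using words_length[of "[]" n m] words_length[of w' n m] by simp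
next
  case (snoc b w)
  have "length w' = Suc (length w)" using words_length snoc.prems(1,2) by fastforce
  then obtain w1 b1 where w': "w' = w1 @ [b1]" by (metis length_Suc_conv_rev)
  have aux: False if W1: "x @ [True] \<in> words n m" and W2: "y @ [False] \<in> words n m"
    and eq: "\<And>i j. i \<in> {1..n} \<Longrightarrow> j \<in> {1..m} \<Longrightarrow> prec (x @ [True]) i j = prec (y @ [False]) i j" for x y
  proof -
    have "n > 0" "m > 0" using W1 W2 by (simp_all add: words_snoc_True words_snoc_False)
    then have "prec (x @ [True]) n m = prec (y @ [False]) n m" using eq[of n m] by auto
    then show False
      using prec_last_False[OF W2, of n] prec_last_True[OF W1, of m] prec_snoc[OF W1, of m n] prec_snoc[OF W2, of m n]
      by simp
  qed
  have b: "b = b1"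
  proof (rule ccontr)
    assume "b \<noteq> b1"
    then consider "b" "\<not> b1" | "\<not> b" "b1" by blast
    then show False
    proof cases
      case 1 then show False using aux[of w w1] snoc.prems w' by simp
    next
      case 2 then show False using aux[of w1 w] snoc.prems w' by simp
    qed
  qed
  have "w = w1"
  proof (cases b)
    case True
    then have "w \<in> words (n - 1) m" "w1 \<in> words (n - 1) m"
      using snoc.prems(1,2) w' b by (simp_all add: words_snoc_True)
    then show ?thesis
    proof (rule snoc.IH)
      fix i j assume ij: "i \<in> {1..n - 1}" "j \<in> {1..m}"
      then have "i \<in> {1..n}" by auto
      with ij show "prec w i j = prec w1 i j"
        using snoc.prems(3)[of i j] prec_snoc[OF snoc.prems(1), of j i] prec_snoc[of w1 b1 n m j i] snoc.prems(2) w' by auto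
    qed
  next
    case False
    then have "w \<in> words n (m - 1)" "w1 \<in> words n (m - 1)"
      using snoc.prems(1,2) w' b by (simp_all add: words_snoc_False)
    then show ?thesis
    proof (rule snoc.IH)
      fix i j assume ij: "i \<in> {1..n}" "j \<in> {1..m - 1}"
      then have "j \<in> {1..m}" by auto
      with ij show "prec w i j = prec w1 i j"
        using snoc.prems(3)[of i j] prec_snoc[OF snoc.prems(1), of j i] prec_snoc[of w1 b1 n m j i] snoc.prems(2) w' by auto
    qed
  qed
  then show ?case using b w' by simp
qed

section \<open>Shuffles of labels and the chains between corners and path\<close>

text \<open>
  Every letter of a word has the label of the row or column that it enters. The common values at
  both ends make the comparison at the first and the last vertex of a path independent of the kind
  of step found there.
\<close>

locale shuffle_labels =
  fixes n m :: nat and u v :: "nat \<Rightarrow> int"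
  assumes start: "u 0 = v 0"
    and final: "u (Suc n) = v (Suc m)"
    and u_step: "i \<le> n \<Longrightarrow> u i \<noteq> u (Suc i)"
    and v_step: "j \<le> m \<Longrightarrow> v j \<noteq> v (Suc j)"
    and u_v: "1 \<le> i \<Longrightarrow> i \<le> n \<Longrightarrow> 1 \<le> j \<Longrightarrow> j \<le> m \<Longrightarrow> u i \<noteq> v j"

definition ascents :: "nat \<Rightarrow> (nat \<Rightarrow> int) \<Rightarrow> nat set" where
  "ascents n u = {i. i \<le> n \<and> u i < u (Suc i)}"

context shuffle_labels
begin

text \<open>
  The shuffled word of labels, with the two common end values at positions 0 and \<open>n+m+1\<close>. Vertex
  \<open>t\<close> of the path lies between the positions \<open>t\<close> and \<open>t+1\<close>.
\<close>

definition label :: "bool list \<Rightarrow> nat \<Rightarrow> int" where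
  "label w t = (if t = 0 then u 0 else if t \<le> length w
     then (if w ! (t - 1) then u (ups w t) else v (rts w t)) else u (Suc n))"

definition corners :: "bool list \<Rightarrow> nat set" where
  "corners w = {t. t \<le> length w \<and> label w t < label w (Suc t)}"

text \<open>
  Exchanging the factors turns rows into columns; this halves the proofs below.
\<close>

lemma swapped: "shuffle_labels m n v u"
  by unfold_locales (use start final u_step v_step u_v in \<open>auto simp: eq_commute\<close>)

lemma label_swap:
  assumes "w \<in> words n m"
  shows "shuffle_labels.label m v u (map Not w) t = label w t"
  using start final words_length[OF assms] shuffle_labels.label_def[OF swapped]
  by (auto simp: label_def ups_map_Not rts_map_Not)

lemma label_in_u: "w \<in> words n m \<Longrightarrow> t \<le> length w \<Longrightarrow> t = 0 \<or> w ! (t - 1) \<Longrightarrow> label w t = u (ups w t)"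
  by (auto simp: label_def)

lemma label_in_v: "w \<in> words n m \<Longrightarrow> t \<le> length w \<Longrightarrow> t = 0 \<or> \<not> w ! (t - 1) \<Longrightarrow> label w t = v (rts w t)"
  using start by (auto simp: label_def)

lemma label_out_u: "w \<in> words n m \<Longrightarrow> t \<le> length w \<Longrightarrow> t = length w \<or> w ! t \<Longrightarrow>
    label w (Suc t) = u (Suc (ups w t))"
  using ups_full[of w n m] by (cases "t = length w") (auto simp: label_def ups_Suc)

lemma label_out_v: "w \<in> words n m \<Longrightarrow> t \<le> length w \<Longrightarrow> t = length w \<or> \<not> w ! t \<Longrightarrow>
    label w (Suc t) = v (Suc (rts w t))"
  using rts_full[of w n m] final by (cases "t = length w") (auto simp: label_def rts_Suc)

lemma label_step:
  assumes w: "w \<in> words n m" and t: "t \<le> length w"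
  shows "label w t \<noteq> label w (Suc t)"
proof -
  note io = label_in_u[OF w t] label_in_v[OF w t] label_out_u[OF w t] label_out_v[OF w t]
  have b: "ups w t \<le> n" "rts w t \<le> m" using ups_le[OF w t] rts_le[OF w t] by auto
  show ?thesis
  proof (cases "(t = 0 \<or> w ! (t - 1)) \<and> (t = length w \<or> w ! t)")
    case True
    then show ?thesis using io u_step b by auto
  next
    case nuu: False
    show ?thesis
    proof (cases "(t = 0 \<or> \<not> w ! (t - 1)) \<and> (t = length w \<or> \<not> w ! t)")
      case True
      then show ?thesis using io v_step b by auto
    next
      case False
      with nuu t have t': "t > 0" "t < length w" "w ! (t - 1) \<noteq> w ! t" by auto
      then obtain r where r: "t = Suc r" by (cases t) auto
      have "ups w (Suc t) \<le> n" "rts w (Suc t) \<le> m" using ups_le[OF w, of "Suc t"] rts_le[OF w, of "Suc t"] t' by auto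
      then show ?thesis
        using t' r b io ups_Suc[of r w] rts_Suc[of r w] ups_Suc[of t w] rts_Suc[of t w] 
          u_v[of "ups w t" "Suc (rts w t)"] u_v[of "Suc (ups w t)" "rts w t"]
        by (cases "w ! t") auto
    qed
  qed
qed

lemma label_descends:
  assumes w: "w \<in> words n m" and "a < b" "b \<le> Suc (length w)"
    and no: "\<And>t. a \<le> t \<Longrightarrow> t < b \<Longrightarrow> t \<notin> corners w"
  shows "label w b < label w a"
  using assms(2,3) no
proof (induction b)
  case (Suc b)
  have "label w (Suc b) < label w b"
    using Suc.prems(3)[of b] Suc.prems(1,2) label_step[OF w, of b] by (auto simp: corners_def)
  moreover have "label w b < label w a" if "a \<noteq> b" using Suc that by auto
  ultimately show ?case by (cases "a = b") auto
qed auto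

lemma enter_u:
  assumes w: "w \<in> words n m" and i: "i \<le> Suc n"
  shows "\<exists>a\<le>Suc (length w). label w a = u i \<and> (\<forall>t\<le>length w. t < a \<longleftrightarrow> ups w t < i)"
proof -
  consider "i = 0" | "i = Suc n" | "1 \<le> i" "i \<le> n" using i by linarith
  then show ?thesis
  proof cases
    case 1
    then show ?thesis by (auto simp: label_def intro: exI[of _ 0])
  next
    case 2
    then show ?thesis using ups_le[OF w] by (auto simp: label_def intro!: exI[of _ "Suc (length w)"] le_imp_less_Suc)
  next
    case 3
    define a where "a = (LEAST t. i \<le> ups w t)"
    have len: "i \<le> ups w (length w)" using 3 ups_full[OF w] by simp
    then have a: "i \<le> ups w a" and al: "a \<le> length w" unfolding a_def by (rule LeastI, rule Least_le)
    have least: "ups w t < i" if "t < a" for t using not_less_Least[of t "\<lambda>t. i \<le> ups w t"] that a_def by auto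
    have "a \<noteq> 0" using a 3 by (metis ups_0 not_one_le_zero le_trans)
    then obtain r where r: "a = Suc r" by (cases a) auto
    have "w ! r" "ups w a = i" using least[of r] r a al ups_Suc[of r w] by (auto split: if_splits)
    then have "label w a = u i" using label_in_u[OF w al] r by simp
    moreover have "t < a \<longleftrightarrow> ups w t < i" if "t \<le> length w" for t
      using least[of t] a ups_mono[of a t w] by linarith
    ultimately show ?thesis using al by (metis le_SucI)
  qed
qed

lemma enter_v:
  assumes w: "w \<in> words n m" and j: "j \<le> Suc m"
  shows "\<exists>b\<le>Suc (length w). label w b = v j \<and> (\<forall>t\<le>length w. t < b \<longleftrightarrow> rts w t < j)"
  using shuffle_labels.enter_u[OF swapped, of "map Not w" j] label_swap[OF w] w j
  by (simp add: words_map_Not ups_map_Not)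

text \<open>
  The vertices of the path in row \<open>i\<close> are those between the letters labelled \<open>u i\<close> and \<open>u (i+1)\<close>;
  a word cannot rise from \<open>u i\<close> to \<open>u (i+1)\<close> without an ascent in between.
\<close>

lemma ascent_row_has_corner:
  assumes w: "w \<in> words n m" and i: "i \<in> ascents n u"
  shows "\<exists>t\<in>corners w. ups w t = i"
proof (rule ccontr)
  assume neg: "\<not> ?thesis"
  have i': "i \<le> n" "u i < u (Suc i)" using i by (auto simp: ascents_def)
  obtain a where a: "a \<le> Suc (length w)" "label w a = u i" "\<forall>t\<le>length w. t < a \<longleftrightarrow> ups w t < i"
    using enter_u[OF w, of i] i' by auto
  obtain b where b: "b \<le> Suc (length w)" "label w b = u (Suc i)" "\<forall>t\<le>length w. t < b \<longleftrightarrow> ups w t < Suc i"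
    using enter_u[OF w, of "Suc i"] i' by auto
  have "a \<noteq> b" using a(2) b(2) i' by auto
  moreover have "\<not> b < a"
    using a b by (metis le_less_trans less_SucI less_Suc_eq_le less_irrefl not_less_eq)
  ultimately have ab: "a < b" by simp
  have "t \<notin> corners w" if "a \<le> t" "t < b" for t
  proof
    assume t: "t \<in> corners w"
    then have "t \<le> length w" by (simp add: corners_def)
    then have "ups w t = i" using a(3) b(3) that by (auto simp: not_less less_Suc_eq_le intro: antisym)
    then show False using neg t by blast
  qed
  from label_descends[OF w ab b(1) this] show False using a(2) b(2) i' by simp
qed

lemma corners_swap: "w \<in> words n m \<Longrightarrow> shuffle_labels.corners m v u (map Not w) = corners w"
  by (simp add: shuffle_labels.corners_def[OF swapped] corners_def label_swap)

lemma ascent_column_has_corner: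
  assumes w: "w \<in> words n m" and i: "j \<in> ascents m v"
  shows "\<exists>t\<in>corners w. rts w t = j"
  using shuffle_labels.ascent_row_has_corner[OF swapped, of "map Not w" j] w i
  by (simp add: words_map_Not ups_map_Not corners_swap)

text \<open>
  Row \<open>i\<close> comes strictly before column \<open>j\<close> if \<open>s\<close> has a vertex that is past the one but not past
  the other. If there is no such vertex on either side, there is a tie, and the larger label comes
  first.
\<close>

definition before :: "(nat \<times> nat) set \<Rightarrow> nat \<Rightarrow> nat \<Rightarrow> bool" where
  "before s i j \<longleftrightarrow> (\<exists>c\<in>s. i \<le> fst c \<and> snd c < j) \<or>
     (\<not> (\<exists>c\<in>s. fst c < i \<and> j \<le> snd c) \<and> v j < u i)"

lemma prec_negative_witness:
  assumes w: "w \<in> words n m" and "i \<in> {1..n}" "j \<in> {1..m}"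
  shows "prec w i j \<longleftrightarrow> \<not> (\<exists>c\<in>lattice_path w. fst c < i \<and> j \<le> snd c)"
proof
  assume "prec w i j"
  then show "\<not> (\<exists>c\<in>lattice_path w. fst c < i \<and> j \<le> snd c)"
    using path_chain[of w] by (force simp: prec_def is_chain_def less_eq_prod_def)
next
  assume neg: "\<not> (\<exists>c\<in>lattice_path w. fst c < i \<and> j \<le> snd c)"
  obtain b where b: "b \<le> Suc (length w)" "label w b = v j" "\<forall>t\<le>length w. t < b \<longleftrightarrow> rts w t < j"
    using enter_v[OF w, of j] assms by auto
  have "\<not> rts w (length w) < j" using rts_full[OF w] assms by auto
  then have bl: "b \<le> length w" using b(3) by (metis le_refl not_less)
  have "b \<noteq> 0" using b(3) assms(3) by (metis atLeastAtMost_iff le0 less_irrefl rts_0 zero_less_one less_le_trans)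
  then obtain r where r: "b = Suc r" by (cases b) auto
  have "rts w r < j" "j \<le> rts w b" using b(3)[rule_format, of r] b(3)[rule_format, of b] bl r by linarith+
  moreover have "pos w b \<in> lattice_path w" "pos w r \<in> lattice_path w" using bl r by (auto simp: lattice_path_def)
  ultimately have "i \<le> ups w b" "ups w b = ups w r" using neg r bl ups_Suc[of r w] rts_Suc[of r w]
    by (force simp: pos_def split: if_splits)+
  then show "prec w i j" using \<open>pos w r \<in> lattice_path w\<close> \<open>rts w r < j\<close> by (force simp: prec_def pos_def)
qed

text \<open>
  In case of a tie, no vertex between the two letters belongs to \<open>s\<close>. So there is no corner
  between them, and the labels decrease from the first letter to the second one: the tie is
  resolved as prescribed. Hence \<open>s\<close> determines the path.
\<close>

lemma shuffle_of_chain_forward: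
  assumes w: "w \<in> words n m"
    and sub: "s \<subseteq> lattice_path w" and A: "pos w ` corners w \<subseteq> s"
    and i: "i \<in> {1..n}" and j: "j \<in> {1..m}"
  shows "prec w i j = before s i j"
proof -
  obtain a where a: "a \<le> Suc (length w)" "label w a = u i" "\<forall>t\<le>length w. t < a \<longleftrightarrow> ups w t < i"
    using enter_u[OF w, of i] i by auto
  obtain b where b: "b \<le> Suc (length w)" "label w b = v j" "\<forall>t\<le>length w. t < b \<longleftrightarrow> rts w t < j"
    using enter_v[OF w, of j] j by auto
  have "u i \<noteq> v j" using u_v i j by auto
  then have ne: "a \<noteq> b" using a b by auto
  have neg: "prec w i j \<longleftrightarrow> \<not> (\<exists>c\<in>lattice_path w. fst c < i \<and> j \<le> snd c)"
    using prec_negative_witness[OF w i j] .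
  show ?thesis
  proof (cases "(\<exists>c\<in>s. i \<le> fst c \<and> snd c < j) \<or> (\<exists>c\<in>s. fst c < i \<and> j \<le> snd c)")
    case True
    then show ?thesis using sub neg by (auto simp: before_def prec_def)
  next
    case False
    then have tie: "before s i j \<longleftrightarrow> v j < u i" by (auto simp: before_def)
    have nc: "t \<notin> corners w" if "t \<le> length w" "(i \<le> ups w t \<and> rts w t < j) \<or> (ups w t < i \<and> j \<le> rts w t)" for t
      using False that A by (force simp: pos_def)
    show ?thesis
    proof (cases "a < b")
      case True
      then have al: "a \<le> length w" using b(1) by linarith
      have "label w b < label w a"
      proof (rule label_descends[OF w True b(1)])
        fix t assume "a \<le> t" "t < b"
        then have "t \<le> length w" using b(1) by linarith
        then show "t \<notin> corners w"
          using a(3)[rule_format, of t] b(3)[rule_format, of t] nc[of t] \<open>a \<le> t\<close> \<open>t < b\<close> by linarith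
      qed
      moreover have "prec w i j" using a(3) b(3) al True
        unfolding prec_def lattice_path_def by (intro bexI[of _ "pos w a"]) (auto simp: pos_def)
      ultimately show ?thesis using tie a b by simp
    next
      case False
      with ne have ba: "b < a" by simp
      then have bl: "b \<le> length w" using a(1) by linarith
      have "label w a < label w b"
      proof (rule label_descends[OF w ba a(1)])
        fix t assume "b \<le> t" "t < a"
        then have "t \<le> length w" using a(1) by linarith
        then show "t \<notin> corners w"
          using a(3)[rule_format, of t] b(3)[rule_format, of t] nc[of t] \<open>b \<le> t\<close> \<open>t < a\<close> by linarith
      qed
      moreover have "\<not> prec w i j" using a(3) b(3) bl ba
        unfolding neg lattice_path_def by (auto simp: pos_def intro!: bexI[of _ b])
      ultimately show ?thesis using tie a b by simp
    qed
  qed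
qed

text \<open>
  Conversely, the comparisons prevent the path from passing beside a vertex of \<open>s\<close>: compare that
  vertex with the one of the path on the same antidiagonal.
\<close>

lemma shuffle_of_chain_backward:
  assumes w: "w \<in> words n m" and ch: "is_chain s" and grid: "s \<subseteq> {..n} \<times> {..m}"
    and eq: "\<And>i j. i \<in> {1..n} \<Longrightarrow> j \<in> {1..m} \<Longrightarrow> prec w i j = before s i j"
  shows "s \<subseteq> lattice_path w"
proof
  fix c assume c: "c \<in> s"
  obtain a b where ab: "c = (a, b)" by (cases c)
  have len: "length w = n + m" using words_length[OF w] .
  have abn: "a \<le> n" "b \<le> m" using grid c ab by auto
  define t where "t = a + b"
  have t: "t \<le> length w" using abn len t_def by simp
  have in_path: "pos w t \<in> lattice_path w" using t by (auto simp: lattice_path_def)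
  have sum: "ups w t + rts w t = a + b" using ups_rts[OF t] t_def by simp
  have "\<not> a < ups w t"
  proof
    assume less: "a < ups w t"
    then have "rts w t < b" using sum by simp
    then have i: "Suc a \<in> {1..n}" "b \<in> {1..m}" using less ups_le[OF w t] abn by auto
    have "prec w (Suc a) b" using in_path less \<open>rts w t < b\<close> unfolding prec_def by (intro bexI[of _ "pos w t"]) (auto simp: pos_def)
    then have "before s (Suc a) b" using eq i by simp
    then obtain c' where c': "c' \<in> s" "Suc a \<le> fst c'" "snd c' < b" using c ab by (auto simp: before_def)
    then have "c' \<le> c \<or> c \<le> c'" using ch c by (auto simp: is_chain_def)
    then show False using c' ab by (auto simp: less_eq_prod_def)
  qed
  moreover have "\<not> ups w t < a"
  proof
    assume less: "ups w t < a"
    then have r: "b < rts w t" using sum by simp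
    then have i: "a \<in> {1..n}" "Suc b \<in> {1..m}" using less rts_le[OF w t] abn by auto
    have "\<not> prec w a (Suc b)" using in_path less r
      unfolding prec_negative_witness[OF w i] by (auto intro!: bexI[of _ "pos w t"] simp: pos_def)
    then have "\<not> before s a (Suc b)" using eq i by simp
    then show False using c ab by (auto simp: before_def)
  qed
  ultimately have "pos w t = c" using sum ab by (auto simp: pos_def)
  then show "c \<in> lattice_path w" using in_path by simp
qed

text \<open>
  At an ascent between two rows \<open>i\<close> and \<open>i+1\<close> the path has a single vertex in row \<open>i\<close>, and \<open>s\<close>
  hits this row. At an ascent where the path turns, the two letters compared are not in the order
  prescribed for ties, so \<open>s\<close> has a vertex separating them, and the corner is the only such vertex
  of the path.
\<close>

lemma corners_in_chain:
  assumes w: "w \<in> words n m" and sub: "s \<subseteq> lattice_path w"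
    and eq: "\<And>i j. i \<in> {1..n} \<Longrightarrow> j \<in> {1..m} \<Longrightarrow> prec w i j = before s i j"
    and u: "ascents n u \<subseteq> fst ` s" and v: "ascents m v \<subseteq> snd ` s"
    and t: "t \<in> corners w"
  shows "pos w t \<in> s"
proof -
  have tl: "t \<le> length w" and less: "label w t < label w (Suc t)" using t by (auto simp: corners_def)
  note io = label_in_u[OF w tl] label_in_v[OF w tl] label_out_u[OF w tl] label_out_v[OF w tl]
  have b: "ups w t \<le> n" "rts w t \<le> m" using ups_le[OF w tl] rts_le[OF w tl] by auto
  have at: "\<exists>t'\<le>length w. c = pos w t' \<and> fst c = ups w t' \<and> snd c = rts w t'" if "c \<in> s" for c
  proof -
    have "c \<in> lattice_path w" using that sub by blast
    then show ?thesis by (auto simp: lattice_path_def pos_def)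
  qed
  have in_u: "t' \<ge> t" if "t = 0 \<or> w ! (t - 1)" "ups w t \<le> ups w t'" for t'
  proof (rule ccontr)
    assume "\<not> t' \<ge> t"
    then obtain r where r: "t = Suc r" "t' \<le> r" by (cases t) auto
    then have "ups w t = Suc (ups w r)" using that(1) ups_Suc[of r w] tl by auto
    then show False using that(2) ups_mono[OF r(2), of w] by simp
  qed
  have in_v: "t' \<ge> t" if "t = 0 \<or> \<not> w ! (t - 1)" "rts w t \<le> rts w t'" for t'
  proof (rule ccontr)
    assume "\<not> t' \<ge> t"
    then obtain r where r: "t = Suc r" "t' \<le> r" by (cases t) auto
    then have "rts w t = Suc (rts w r)" using that(1) rts_Suc[of r w] tl by auto
    then show False using that(2) rts_mono[OF r(2), of w] by simp
  qed
  have out_u: "t' \<le> t" if "t = length w \<or> w ! t" "ups w t' \<le> ups w t" "t' \<le> length w" for t'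
  proof (rule ccontr)
    assume "\<not> t' \<le> t"
    then have "Suc t \<le> t'" "t < length w" using that by auto
    then show False using that ups_Suc[of t w] ups_mono[of "Suc t" t' w] by auto
  qed
  have out_v: "t' \<le> t" if "t = length w \<or> \<not> w ! t" "rts w t' \<le> rts w t" "t' \<le> length w" for t'
  proof (rule ccontr)
    assume "\<not> t' \<le> t"
    then have "Suc t \<le> t'" "t < length w" using that by auto
    then show False using that rts_Suc[of t w] rts_mono[of "Suc t" t' w] by auto
  qed
  consider (uu) "t = 0 \<or> w ! (t - 1)" "t = length w \<or> w ! t"
    | (vv) "t = 0 \<or> \<not> w ! (t - 1)" "t = length w \<or> \<not> w ! t"
    | (uv) "0 < t" "w ! (t - 1)" "t < length w" "\<not> w ! t"
    | (vu) "0 < t" "\<not> w ! (t - 1)" "t < length w" "w ! t"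
    using tl by (cases "t = 0"; cases "t = length w") auto
  then show ?thesis
  proof cases
    case uu
    then have "ups w t \<in> ascents n u" using less io b by (auto simp: ascents_def)
    then obtain c where c: "c \<in> s" "fst c = ups w t" using u by (metis (no_types, lifting) imageE subsetD)
    obtain t' where t': "t' \<le> length w" "c = pos w t'" "fst c = ups w t'" "snd c = rts w t'" using at[OF c(1)] by blast
    have "t \<le> t'" by (rule in_u) (use uu c t' in simp_all)
    moreover have "t' \<le> t" by (rule out_u) (use uu c t' in simp_all)
    ultimately show ?thesis using c t' by simp
  next
    case vv
    then have "rts w t \<in> ascents m v" using less io b by (auto simp: ascents_def)
    then obtain c where c: "c \<in> s" "snd c = rts w t" using v by (metis (no_types, lifting) imageE subsetD)
    obtain t' where t': "t' \<le> length w" "c = pos w t'" "fst c = ups w t'" "snd c = rts w t'" using at[OF c(1)] by blast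
    have "t \<le> t'" by (rule in_v) (use vv c t' in simp_all)
    moreover have "t' \<le> t" by (rule out_v) (use vv c t' in simp_all)
    ultimately show ?thesis using c t' by simp
  next
    case uv
    then obtain r where r: "t = Suc r" by (cases t) auto
    have i: "ups w t \<in> {1..n}" "Suc (rts w t) \<in> {1..m}"
      using uv r ups_Suc[of r w] rts_Suc[of t w] rts_le[OF w, of "Suc t"] b by auto
    have "prec w (ups w t) (Suc (rts w t))" using tl
      unfolding prec_def lattice_path_def by (auto simp: pos_def)
    then have "before s (ups w t) (Suc (rts w t))" using eq i by simp
    moreover have "\<not> v (Suc (rts w t)) < u (ups w t)" using less io uv by auto
    ultimately obtain c where c: "c \<in> s" "ups w t \<le> fst c" "snd c \<le> rts w t" by (auto simp: before_def)
    obtain t' where t': "t' \<le> length w" "c = pos w t'" "fst c = ups w t'" "snd c = rts w t'" using at[OF c(1)] by blast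
    have "t \<le> t'" by (rule in_u) (use uv c t' in simp_all)
    moreover have "t' \<le> t" by (rule out_v) (use uv c t' in simp_all)
    ultimately show ?thesis using c t' by simp
  next
    case vu
    then obtain r where r: "t = Suc r" by (cases t) auto
    have i: "Suc (ups w t) \<in> {1..n}" "rts w t \<in> {1..m}"
      using vu r rts_Suc[of r w] ups_Suc[of t w] ups_le[OF w, of "Suc t"] b by auto
    have "\<not> prec w (Suc (ups w t)) (rts w t)" using tl
      unfolding prec_negative_witness[OF w i] lattice_path_def by (auto simp: pos_def)
    then have "\<not> before s (Suc (ups w t)) (rts w t)" using eq i by simp
    moreover have "v (rts w t) < u (Suc (ups w t))" using less io vu by auto
    ultimately obtain c where c: "c \<in> s" "fst c \<le> ups w t" "rts w t \<le> snd c" by (auto simp: before_def)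
    obtain t' where t': "t' \<le> length w" "c = pos w t'" "fst c = ups w t'" "snd c = rts w t'" using at[OF c(1)] by blast
    have "t \<le> t'" by (rule in_v) (use vu c t' in simp_all)
    moreover have "t' \<le> t" by (rule out_u) (use vu c t' in simp_all)
    ultimately show ?thesis using c t' by simp
  qed
qed

text \<open>
  If the comparison were not monotone in the rows, then \<open>s\<close> would hit none of the rows in between,
  so that the labels would decrease there.
\<close>

lemma before_mono_left:
  assumes "ascents n u \<subseteq> fst ` s" "1 \<le> i" "i \<le> i'" "i' \<le> n" "before s i' j"
  shows "before s i j"
proof (rule ccontr)
  assume neg: "\<not> before s i j"
  then have nw: "\<not> (\<exists>c\<in>s. i \<le> fst c \<and> snd c < j)" by (auto simp: before_def)
  then have "\<not> (\<exists>c\<in>s. i' \<le> fst c \<and> snd c < j)" using assms(3) by force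
  then have i': "\<not> (\<exists>c\<in>s. fst c < i' \<and> j \<le> snd c)" "v j < u i'" using assms(5) by (auto simp: before_def)
  then have "\<not> (\<exists>c\<in>s. fst c < i \<and> j \<le> snd c)" using assms(3) by force
  then have le: "u i \<le> v j" using neg by (auto simp: before_def)
  have none: "k \<notin> ascents n u" if "i \<le> k" "k < i'" for k
    using nw i'(1) that assms(1) by (force simp: not_less)
  have "u k \<le> u i" if "i \<le> k" "k \<le> i'" for k
    using that
  proof (induction k rule: dec_induct)
    case (step k)
    then have "u (Suc k) \<le> u k" using none[of k] assms(4) by (auto simp: ascents_def)
    then show ?case using step by auto
  qed simp
  then have "u i' \<le> u i" using assms(3) by blast
  then show False using le i'(2) by linarith
qed

lemma before_mono_right:
  assumes "ascents m v \<subseteq> snd ` s" "1 \<le> j" "j \<le> j'" "j' \<le> m" "before s i j"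
  shows "before s i j'"
proof (rule ccontr)
  assume neg: "\<not> before s i j'"
  then have nw: "\<not> (\<exists>c\<in>s. i \<le> fst c \<and> snd c < j')" by (auto simp: before_def)
  then have nj: "\<not> (\<exists>c\<in>s. i \<le> fst c \<and> snd c < j)" using assms(3) by force
  then have j: "\<not> (\<exists>c\<in>s. fst c < i \<and> j \<le> snd c)" "v j < u i" using assms(5) by (auto simp: before_def)
  then have "\<not> (\<exists>c\<in>s. fst c < i \<and> j' \<le> snd c)" using assms(3) by force
  then have le: "u i \<le> v j'" using neg by (auto simp: before_def)
  have none: "k \<notin> ascents m v" if "j \<le> k" "k < j'" for k
    using nw j(1) that assms(1) by (force simp: not_less)
  have "v k \<le> v j" if "j \<le> k" "k \<le> j'" for k
    using that
  proof (induction k rule: dec_induct)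
    case (step k)
    then have "v (Suc k) \<le> v k" using none[of k] assms(4) by (auto simp: ascents_def)
    then show ?case using step by auto
  qed simp
  then have "v j' \<le> v j" using assms(3) by blast
  then show False using le j(2) by linarith
qed

lemma chain_in_some_interval:
  assumes ch: "is_chain s" and grid: "s \<subseteq> {..n} \<times> {..m}"
    and u: "ascents n u \<subseteq> fst ` s" and v: "ascents m v \<subseteq> snd ` s"
  shows "\<exists>w\<in>words n m. s \<subseteq> lattice_path w \<and> pos w ` corners w \<subseteq> s"
proof -
  have "\<exists>w\<in>words n m. \<forall>i\<in>{1..n}. \<forall>j\<in>{1..m}. prec w i j = before s i j"
    by (rule word_exists; rule before_mono_left[OF u] before_mono_right[OF v]; assumption)
  then obtain w where w: "w \<in> words n m" "\<forall>i\<in>{1..n}. \<forall>j\<in>{1..m}. prec w i j = before s i j"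
    by blast
  have "s \<subseteq> lattice_path w" using shuffle_of_chain_backward[OF w(1) ch grid] w(2) by blast
  then show ?thesis using corners_in_chain[OF w(1) _ _ u v] w by blast
qed

end

section \<open>The number of paths with a given number of corners\<close>

definition hitting_chains :: "nat set \<Rightarrow> nat set \<Rightarrow> nat set \<Rightarrow> nat set \<Rightarrow> nat \<Rightarrow> (nat \<times> nat) set set" where
  "hitting_chains R I C J r =
     {s. s \<subseteq> R \<times> C \<and> is_chain s \<and> card s = r \<and> I \<subseteq> fst ` s \<and> J \<subseteq> snd ` s}"

lemma finite_hitting_chains [simp]: "finite R \<Longrightarrow> finite C \<Longrightarrow> finite (hitting_chains R I C J r)"
  by (rule finite_subset[of _ "Pow (R \<times> C)"]) (auto simp: hitting_chains_def)

text \<open>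
  Inclusion-exclusion: a chain misses a row if and only if it lies in the grid without this row.
\<close>

lemma hitting_chains_insert_row:
  "hitting_chains R (insert i I) C J r =
    hitting_chains R I C J r - hitting_chains (R - {i}) I C J r"
proof -
  have "s \<subseteq> (R - {i}) \<times> C \<longleftrightarrow> s \<subseteq> R \<times> C \<and> i \<notin> fst ` s" for s
    by (auto simp: subset_eq image_iff)
  then show ?thesis unfolding hitting_chains_def by blast
qed

lemma card_hitting_chains_insert_row:
  assumes "finite R" "finite C" "i \<notin> I"
  shows "card (hitting_chains R (insert i I) C J r) =
    card (hitting_chains R I C J r) - card (hitting_chains (R - {i}) I C J r)"
  unfolding hitting_chains_insert_row
  by (rule card_Diff_subset) (use assms in \<open>auto simp: hitting_chains_def\<close>)

lemma is_chain_swap: "is_chain (prod.swap ` s) \<longleftrightarrow> is_chain s"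
  by (auto simp: is_chain_def less_eq_prod_def)

lemma hitting_chains_swap:
  "card (hitting_chains C J R I r) = card (hitting_chains R I C J r)"
proof (rule bij_betw_same_card)
  have sw: "fst ` prod.swap ` s = snd ` s" "snd ` prod.swap ` s = fst ` s" for s :: "(nat \<times> nat) set"
    by (force simp: image_image)+
  have cd: "card (prod.swap ` s) = card s" for s :: "(nat \<times> nat) set"
    by (rule card_image) (auto simp: inj_on_def)
  show "bij_betw ((`) prod.swap) (hitting_chains C J R I r) (hitting_chains R I C J r)"
    by (rule bij_betw_byWitness[where f' = "(`) prod.swap"])
      (auto simp: hitting_chains_def is_chain_swap sw cd image_image)
qed

lemma card_chains_mono_image:
  assumes "finite R" "finite R'" "card R = card R'" "finite C" "finite C'" "card C = card C'"
  shows "card (hitting_chains R {} C {} r) = card (hitting_chains R' {} C' {} r)"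
proof -
  have le: "card (hitting_chains R {} C {} r) \<le> card (hitting_chains R' {} C' {} r)"
    if fin: "finite R" "finite R'" "card R = card R'" "finite C" "finite C'" "card C = card C'" for R R' C C'
  proof -
    have iso: "\<exists>f. bij_betw f A B \<and> mono_on A f" if AB: "finite A" "finite B" "card A = card B" for A B :: "nat set"
    proof -
      obtain a where a: "bij_betw a {..<card A} A" "strict_mono_on {..<card A} a"
        using ex_bij_betw_strict_mono_card[OF AB(1)] by blast
      obtain b where b: "bij_betw b {..<card B} B" "strict_mono_on {..<card B} b"
        using ex_bij_betw_strict_mono_card[OF AB(2)] by blast
      define a' where "a' = inv_into {..<card A} a"
      have a': "bij_betw a' A {..<card A}" unfolding a'_def by (rule bij_betw_inv_into[OF a(1)])
      have aa: "a (a' x) = x" "a' x < card A" if "x \<in> A" for x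
        using that a(1) a' unfolding a'_def bij_betw_def by (auto simp: f_inv_into_f)
      have "a' x \<le> a' y" if "x \<in> A" "y \<in> A" "x \<le> y" for x y
      proof (rule ccontr)
        assume "\<not> a' x \<le> a' y"
        then have "a (a' y) < a (a' x)" using strict_mono_onD[OF a(2), of "a' y" "a' x"] aa that by auto
        then show False using aa that by simp
      qed
      moreover have "b x \<le> b y" if "x < card B" "y < card B" "x \<le> y" for x y
        using strict_mono_onD[OF b(2), of x y] that by (cases "x = y") auto
      ultimately have "mono_on A (b \<circ> a')" using aa AB(3) by (auto simp: mono_on_def)
      moreover have "bij_betw (b \<circ> a') A B" using bij_betw_trans[OF a'] b(1) AB(3) by simp
      ultimately show ?thesis by blast
    qed
    obtain f where f: "bij_betw f R R'" "mono_on R f" using iso fin by blast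
    obtain g where g: "bij_betw g C C'" "mono_on C g" using iso fin by blast
    have inj: "inj_on (map_prod f g) (R \<times> C)" using f g by (auto simp: bij_betw_def intro: map_prod_inj_on)
    show ?thesis
    proof (rule card_inj_on_le)
      show "inj_on ((`) (map_prod f g)) (hitting_chains R {} C {} r)"
        by (rule inj_on_subset[OF inj_on_image_Pow[OF inj]]) (auto simp: hitting_chains_def)
      show "(`) (map_prod f g) ` hitting_chains R {} C {} r \<subseteq> hitting_chains R' {} C' {} r"
      proof (rule image_subsetI)
        fix s assume "s \<in> hitting_chains R {} C {} r"
        then have s: "s \<subseteq> R \<times> C" "is_chain s" "card s = r" by (auto simp: hitting_chains_def)
        have "map_prod f g ` s \<subseteq> R' \<times> C'" using s(1) f g by (auto simp: bij_betw_def)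
        moreover have "is_chain (map_prod f g ` s)" unfolding is_chain_def
        proof (intro ballI)
          fix x y assume "x \<in> map_prod f g ` s" "y \<in> map_prod f g ` s"
          then obtain c c' where c: "c \<in> s" "c' \<in> s" "x = map_prod f g c" "y = map_prod f g c'" by auto
          then have "c \<le> c' \<or> c' \<le> c" using s(2) by (auto simp: is_chain_def)
          moreover have "c \<in> R \<times> C" "c' \<in> R \<times> C" using c s(1) by auto
          ultimately show "x \<le> y \<or> y \<le> x" using c f(2) g(2)
            by (auto simp: less_eq_prod_def mono_on_def mem_Times_iff)
        qed
        moreover have "card (map_prod f g ` s) = r" using card_image[OF inj_on_subset[OF inj s(1)]] s(3) by simp
        ultimately show "map_prod f g ` s \<in> hitting_chains R' {} C' {} r" by (simp add: hitting_chains_def)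
      qed
      show "finite (hitting_chains R' {} C' {} r)" using fin by simp
    qed
  qed
  show ?thesis by (rule antisym; rule le) (use assms in simp_all)
qed

lemma card_hitting_chains_rows:
  assumes base: "\<And>R R'. finite R \<Longrightarrow> finite R' \<Longrightarrow> card R = card R' \<Longrightarrow>
      card (hitting_chains R {} C J r) = card (hitting_chains R' {} C' J' r)"
    and "finite C" "finite C'"
    and "finite I" "finite R" "finite R'" "card R = card R'" "I \<subseteq> R" "I' \<subseteq> R'" "card I = card I'"
  shows "card (hitting_chains R I C J r) = card (hitting_chains R' I' C' J' r)"
  using assms(4-)
proof (induction I arbitrary: R R' I' rule: finite_induct)
  case empty
  then have "I' = {}" using finite_subset[of I' R'] by auto
  show ?case unfolding \<open>I' = {}\<close> by (rule base) (use empty in auto)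
next
  case (insert i I)
  have "finite I'" using insert.prems(2,5) finite_subset by blast
  moreover have "I' \<noteq> {}" using insert by force
  ultimately obtain i' K where I': "I' = insert i' K" "i' \<notin> K" "finite K"
    by (metis finite.cases finite_insert insertE mk_disjoint_insert all_not_in_conv)
  have c: "card I = card K" using insert I' by simp
  have "card (hitting_chains R I C J r) = card (hitting_chains R' K C' J' r)"
    by (rule insert.IH) (use insert.prems I' c in auto)
  moreover have "card (hitting_chains (R - {i}) I C J r) = card (hitting_chains (R' - {i'}) K C' J' r)"
    by (rule insert.IH) (use insert.prems insert.hyps I' c in auto)
  ultimately show ?case
    using card_hitting_chains_insert_row[of R C i I J r] card_hitting_chains_insert_row[of R' C' i' K J' r]
      assms(2,3) insert I' by simp
qed

text \<open>
  Removing the required rows and columns one by one leads to the number of all chains of given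
  size in a grid, which depends only on the format of the grid.
\<close>

lemma card_hitting_chains_cong:
  assumes "finite R" "finite R'" "finite C" "finite C'" "card R = card R'" "card C = card C'"
    and "I \<subseteq> R" "I' \<subseteq> R'" "card I = card I'" "J \<subseteq> C" "J' \<subseteq> C'" "card J = card J'"
  shows "card (hitting_chains R I C J r) = card (hitting_chains R' I' C' J' r)"
proof (rule card_hitting_chains_rows)
  fix R R' :: "nat set" assume R: "finite R" "finite R'" "card R = card R'"
  show "card (hitting_chains R {} C J r) = card (hitting_chains R' {} C' J' r)"
    unfolding hitting_chains_swap[of R "{}"] hitting_chains_swap[of R' "{}"]
  proof (rule card_hitting_chains_rows)
    fix Q Q' :: "nat set" assume "finite Q" "finite Q'" "card Q = card Q'"
    then show "card (hitting_chains Q {} R {} r) = card (hitting_chains Q' {} R' {} r)"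
      using R by (intro card_chains_mono_image) auto
  qed (use assms R finite_subset in auto)
qed (use assms finite_subset in auto)

lemma card_between:
  assumes P: "finite P" and "A \<subseteq> P"
  shows "card {s. A \<subseteq> s \<and> s \<subseteq> P \<and> card s = r} =
    (if card A \<le> r then (card P - card A) choose (r - card A) else 0)"
proof (cases "card A \<le> r")
  case True
  have fA: "finite A" using assms finite_subset by blast
  have "bij_betw (\<lambda>s. s - A) {s. A \<subseteq> s \<and> s \<subseteq> P \<and> card s = r} {s. s \<subseteq> P - A \<and> card s = r - card A}"
  proof (rule bij_betw_byWitness[where f' = "\<lambda>s. s \<union> A"])
    show "(\<lambda>s. s - A) ` {s. A \<subseteq> s \<and> s \<subseteq> P \<and> card s = r} \<subseteq> {s. s \<subseteq> P - A \<and> card s = r - card A}"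
      using fA by (auto simp: card_Diff_subset)
    show "(\<lambda>s. s \<union> A) ` {s. s \<subseteq> P - A \<and> card s = r - card A} \<subseteq> {s. A \<subseteq> s \<and> s \<subseteq> P \<and> card s = r}"
    proof (rule image_subsetI)
      fix s assume "s \<in> {s. s \<subseteq> P - A \<and> card s = r - card A}"
      then have s: "s \<subseteq> P - A" "card s = r - card A" by auto
      then have "finite s" "s \<inter> A = {}" using P finite_subset[of s P] by auto
      then have "card (s \<union> A) = r" using s fA True by (simp add: card_Un_disjoint)
      then show "s \<union> A \<in> {s. A \<subseteq> s \<and> s \<subseteq> P \<and> card s = r}" using s assms by auto
    qed
  qed auto
  then have "card {s. A \<subseteq> s \<and> s \<subseteq> P \<and> card s = r} = card {s. s \<subseteq> P - A \<and> card s = r - card A}"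
    by (rule bij_betw_same_card)
  also have "\<dots> = (card P - card A) choose (r - card A)"
    using n_subsets[of "P - A"] P assms(2) fA by (simp add: card_Diff_subset)
  finally show ?thesis using True by simp
next
  case False
  have "card A \<le> card s" if "A \<subseteq> s" "s \<subseteq> P" for s
    using card_mono[OF finite_subset[OF that(2) P] that(1)] .
  then have empty: "{s. A \<subseteq> s \<and> s \<subseteq> P \<and> card s = r} = {}" using False by blast
  show ?thesis unfolding empty using False by simp
qed

lemma card_lattice_path: "card (lattice_path w) = Suc (length w)"
  unfolding lattice_path_def by (subst card_image[OF pos_inj]) simp

context shuffle_labels begin

lemma corners_bounded: "corners w \<subseteq> {..length w}"
  by (auto simp: corners_def)

lemma card_pos_corners: "card (pos w ` corners w) = card (corners w)"
  by (rule card_image) (rule inj_on_subset[OF pos_inj corners_bounded])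

lemma pos_corners_path: "pos w ` corners w \<subseteq> lattice_path w"
  using corners_bounded by (auto simp: lattice_path_def)

lemma interval_hits:
  assumes w: "w \<in> words n m" and A: "pos w ` corners w \<subseteq> s"
  shows "ascents n u \<subseteq> fst ` s \<and> ascents m v \<subseteq> snd ` s"
proof -
  have "i \<in> fst ` s" if i: "i \<in> ascents n u" for i
  proof -
    obtain t where "t \<in> corners w" "ups w t = i" using ascent_row_has_corner[OF w i] by blast
    then have "pos w t \<in> s" "fst (pos w t) = i" using A by (auto simp: pos_def)
    then show ?thesis by force
  qed
  moreover have "i \<in> snd ` s" if i: "i \<in> ascents m v" for i
  proof -
    obtain t where "t \<in> corners w" "rts w t = i" using ascent_column_has_corner[OF w i] by blast
    then have "pos w t \<in> s" "snd (pos w t) = i" using A by (auto simp: pos_def)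
    then show ?thesis by force
  qed
  ultimately show ?thesis by blast
qed

lemma word_of_chain_unique:
  assumes "w \<in> words n m" "s \<subseteq> lattice_path w" "pos w ` corners w \<subseteq> s"
    and "w' \<in> words n m" "s \<subseteq> lattice_path w'" "pos w' ` corners w' \<subseteq> s"
  shows "w = w'"
  using word_unique[OF assms(1,4)] shuffle_of_chain_forward[OF assms(1-3)]
    shuffle_of_chain_forward[OF assms(4-6)] by simp

lemma chain_subset: "s \<subseteq> lattice_path w \<Longrightarrow> is_chain s"
  using path_chain[of w] by (auto simp: is_chain_def)

text \<open>
  Both sides count the chains of size \<open>r\<close> that hit the rows and columns of ascents: the left side
  sorts them by the path whose interval contains them.
\<close>

lemma sum_over_words:
  "(\<Sum>w\<in>words n m. if card (corners w) \<le> r then (Suc (n + m) - card (corners w)) choose (r - card (corners w)) else 0) =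
    card (hitting_chains {..n} (ascents n u) {..m} (ascents m v) r)"
proof -
  define D where "D w = {s. pos w ` corners w \<subseteq> s \<and> s \<subseteq> lattice_path w \<and> card s = r}" for w
  have fp: "finite (lattice_path w)" for w by (simp add: lattice_path_def)
  have h1: "hitting_chains {..n} (ascents n u) {..m} (ascents m v) r = (\<Union>w\<in>words n m. D w)"
  proof (intro equalityI subsetI)
    fix s assume "s \<in> hitting_chains {..n} (ascents n u) {..m} (ascents m v) r"
    then show "s \<in> (\<Union>w\<in>words n m. D w)"
      using chain_in_some_interval[of s] by (auto simp: hitting_chains_def D_def)
  next
    fix s assume "s \<in> (\<Union>w\<in>words n m. D w)"
    then obtain w where w: "w \<in> words n m" "pos w ` corners w \<subseteq> s" "s \<subseteq> lattice_path w" "card s = r"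
      by (auto simp: D_def)
    then show "s \<in> hitting_chains {..n} (ascents n u) {..m} (ascents m v) r"
      using interval_hits[OF w(1,2)] chain_subset[OF w(3)] path_grid[OF w(1)] by (auto simp: hitting_chains_def)
  qed
  have h2: "card (\<Union>w\<in>words n m. D w) = (\<Sum>w\<in>words n m. card (D w))"
  proof (rule card_UN_disjoint)
    show "\<forall>w\<in>words n m. finite (D w)"
      unfolding D_def using fp by (auto intro: finite_subset[of _ "Pow (lattice_path _)"])
    show "\<forall>w\<in>words n m. \<forall>w'\<in>words n m. w \<noteq> w' \<longrightarrow> D w \<inter> D w' = {}"
    proof (intro ballI impI equals0I)
      fix w w' s assume "w \<in> words n m" "w' \<in> words n m" "w \<noteq> w'" "s \<in> D w \<inter> D w'"
      then show False using word_of_chain_unique[of w s w'] unfolding D_def by auto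
    qed
  qed simp
  have card_D: "card (D w) = (if card (corners w) \<le> r then (Suc (n + m) - card (corners w)) choose (r - card (corners w)) else 0)"
    if "w \<in> words n m" for w
    unfolding D_def using card_between[OF fp pos_corners_path] that
    by (simp add: card_pos_corners card_lattice_path words_length)
  then have h3: "(\<Sum>w\<in>words n m. card (D w)) =
      (\<Sum>w\<in>words n m. if card (corners w) \<le> r then (Suc (n + m) - card (corners w)) choose (r - card (corners w)) else 0)"
    by (rule sum.cong[OF refl])
  show ?thesis by (simp only: h1 h2 h3)
qed

end

text \<open>
  The system is unitriangular: a word of weight \<open>r\<close> contributes 1 to the sum for \<open>r\<close> and nothing
  to the earlier sums.
\<close>

lemma count_determined:
  fixes f g :: "'a \<Rightarrow> nat"
  assumes "finite W"
    and "\<And>r. (\<Sum>w\<in>W. if f w \<le> r then (N - f w) choose (r - f w) else 0) =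
             (\<Sum>w\<in>W. if g w \<le> r then (N - g w) choose (r - g w) else 0)"
  shows "card {w \<in> W. f w = j} = card {w \<in> W. g w = j}"
proof (induction j rule: less_induct)
  case (less r)
  have split: "(\<Sum>w\<in>W. if f w \<le> r then (N - f w) choose (r - f w) else 0) =
     (\<Sum>a<r. card {w\<in>W. f w = a} * ((N - a) choose (r - a))) + card {w\<in>W. f w = r}" for f :: "'a \<Rightarrow> nat"
  proof -
    have "(\<Sum>w\<in>W. if f w \<le> r then (N - f w) choose (r - f w) else 0) =
      (\<Sum>w\<in>W. \<Sum>a\<le>r. if f w = a then (N - a) choose (r - a) else 0)"
      by (rule sum.cong) auto
    also have "\<dots> = (\<Sum>a\<le>r. \<Sum>w\<in>W. if f w = a then (N - a) choose (r - a) else 0)"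
      by (rule sum.swap)
    also have "\<dots> = (\<Sum>a\<le>r. card {w\<in>W. f w = a} * ((N - a) choose (r - a)))"
      using assms(1) by (intro sum.cong refl) (simp add: sum.If_cases Int_def)
    also have "\<dots> = (\<Sum>a<r. card {w\<in>W. f w = a} * ((N - a) choose (r - a))) + card {w\<in>W. f w = r}"
      by (simp add: lessThan_Suc_atMost[symmetric])
    finally show ?thesis .
  qed
  have "(\<Sum>a<r. card {w\<in>W. f w = a} * ((N - a) choose (r - a))) =
    (\<Sum>a<r. card {w\<in>W. g w = a} * ((N - a) choose (r - a)))"
    using less by (intro sum.cong) auto
  then show ?case using assms(2)[of r] split[of f] split[of g] by simp
qed

lemma corner_count_cong:
  assumes "shuffle_labels n m u v" "shuffle_labels n m u' v'"
    and "card (ascents n u) = card (ascents n u')" "card (ascents m v) = card (ascents m v')"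
  shows "card {w \<in> words n m. card (shuffle_labels.corners n u v w) = j} =
         card {w \<in> words n m. card (shuffle_labels.corners n u' v' w) = j}"
proof (rule count_determined[where N = "Suc (n + m)"])
  fix r
  have sub: "ascents k x \<subseteq> {..k}" for k x by (auto simp: ascents_def)
  show "(\<Sum>w\<in>words n m. if card (shuffle_labels.corners n u v w) \<le> r then Suc (n + m) - card (shuffle_labels.corners n u v w) choose (r - card (shuffle_labels.corners n u v w)) else 0) =
    (\<Sum>w\<in>words n m. if card (shuffle_labels.corners n u' v' w) \<le> r then Suc (n + m) - card (shuffle_labels.corners n u' v' w) choose (r - card (shuffle_labels.corners n u' v' w)) else 0)"
    unfolding shuffle_labels.sum_over_words[OF assms(1)] shuffle_labels.sum_over_words[OF assms(2)]
    by (rule card_hitting_chains_cong[OF finite_atMost finite_atMost finite_atMost finite_atMost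
          refl refl sub sub assms(3) sub sub assms(4)])
qed (rule finite_words)

lemma negated_labels:
  assumes "shuffle_labels n m u v"
  shows "shuffle_labels n m (\<lambda>i. - u i) (\<lambda>j. - v j)"
    and "ascents n (\<lambda>i. - u i) = {..n} - ascents n u"
    and "ascents m (\<lambda>i. - v i) = {..m} - ascents m v"
    and "w \<in> words n m \<Longrightarrow> shuffle_labels.corners n (\<lambda>i. - u i) (\<lambda>j. - v j) w =
      {..n + m} - shuffle_labels.corners n u v w"
proof -
  interpret shuffle_labels n m u v by fact
  show neg: "shuffle_labels n m (\<lambda>i. - u i) (\<lambda>j. - v j)"
    by unfold_locales (use start final u_step v_step u_v in auto)
  show "ascents n (\<lambda>i. - u i) = {..n} - ascents n u" "ascents m (\<lambda>i. - v i) = {..m} - ascents m v"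
    using u_step v_step by (force simp: ascents_def)+
  have lab: "shuffle_labels.label n (\<lambda>i. - u i) (\<lambda>j. - v j) w t = - label w t" for w t
    by (simp add: shuffle_labels.label_def[OF neg] label_def)
  show "shuffle_labels.corners n (\<lambda>i. - u i) (\<lambda>j. - v j) w = {..n + m} - corners w" if w: "w \<in> words n m"
    using label_step[OF w] words_length[OF w]
    by (force simp: shuffle_labels.corners_def[OF neg] corners_def lab)
qed

section \<open>Initial segments and Morse faces on a path\<close>

text \<open>
  The vertices of the path that are in the first \<open>p\<close> rows and in the first \<open>q\<close> columns. This is
  the smaller one of two initial segments of the path, so a set of vertices meets it if and only
  if it meets both of them.
\<close>

definition front :: "bool list \<Rightarrow> nat \<Rightarrow> nat \<Rightarrow> nat set" where
  "front w p q = {t. t \<le> length w \<and> ups w t < p \<and> rts w t < q}"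

text \<open>
  If the condition to meet the initial segment is neither implied by the corners nor void, it
  removes the final segment that is complementary to it. This is a facet if the initial segment is
  a single vertex, and a Morse face otherwise.
\<close>

definition required :: "nat set \<Rightarrow> bool list \<Rightarrow> nat \<Rightarrow> nat \<Rightarrow> nat set" where
  "required C w p q =
     (if card (front w p q) = 1 \<and> 0 < length w \<and> C \<inter> front w p q = {} then insert 0 C else C)"

definition critical :: "nat set \<Rightarrow> bool list \<Rightarrow> nat \<Rightarrow> nat \<Rightarrow> nat set" where
  "critical C w p q =
     (if C \<inter> front w p q \<noteq> {} \<or> card (front w p q) = 1 then {} else {..length w} - front w p q)"

text \<open>
  The value \<open>n+1\<close> of \<open>p\<close> says that there is no initial segment to be met. Otherwise the required
  vertices lie beyond the segment, and there are some: the facets opposite to the other vertices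
  contain the Morse face, and only tiles with removed facets may have one.
\<close>

definition clause_ok :: "nat \<Rightarrow> nat set \<Rightarrow> nat \<Rightarrow> bool" where
  "clause_ok n I p \<longleftrightarrow> p = Suc n \<or> (1 \<le> p \<and> p \<le> n \<and> I \<subseteq> {p..n} \<and> I \<noteq> {})"

lemma finite_front [simp]: "finite (front w p q)"
  by (rule finite_subset[of _ "{..length w}"]) (auto simp: front_def)

lemma front_downward: "t \<in> front w p q \<Longrightarrow> t' \<le> t \<Longrightarrow> t' \<in> front w p q"
  using ups_mono[of t' t w] rts_mono[of t' t w] by (simp add: front_def)

lemma zero_in_front: "0 < p \<Longrightarrow> 0 < q \<Longrightarrow> 0 \<in> front w p q"
  by (simp add: front_def)

lemma card_front_1: "0 < p \<Longrightarrow> 0 < q \<Longrightarrow> card (front w p q) = 1 \<longleftrightarrow> front w p q = {0}"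
  using zero_in_front[of p q w] by (auto simp: card_Suc_eq)

lemma critical_upward:
  "t \<in> critical C w p q \<Longrightarrow> t \<le> t' \<Longrightarrow> t' \<le> length w \<Longrightarrow> t' \<in> critical C w p q"
  using front_downward[of t' w p q t] by (auto simp: critical_def split: if_splits)

lemma meets_front:
  assumes "S \<subseteq> {..length w}"
  shows "(\<exists>t\<in>S. ups w t < p) \<and> (\<exists>t\<in>S. rts w t < q) \<longleftrightarrow> S \<inter> front w p q \<noteq> {}"
proof
  assume "(\<exists>t\<in>S. ups w t < p) \<and> (\<exists>t\<in>S. rts w t < q)"
  then obtain s t where st: "s \<in> S" "t \<in> S" "ups w s < p" "rts w t < q" by blast
  have "min s t \<in> S" using st by (simp add: min_def)
  moreover have "ups w (min s t) < p" "rts w (min s t) < q"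
    using st ups_mono[of "min s t" s w] rts_mono[of "min s t" t w] by linarith+
  ultimately show "S \<inter> front w p q \<noteq> {}" using assms by (auto simp: front_def)
qed (auto simp: front_def)

lemma tile_condition:
  assumes C: "C \<subseteq> {..length w}" and S: "S \<subseteq> {..length w}" "S \<noteq> {}" and pq: "0 < p" "0 < q"
  shows "C \<subseteq> S \<and> (\<exists>t\<in>S. ups w t < p) \<and> (\<exists>t\<in>S. rts w t < q) \<longleftrightarrow>
    required C w p q \<subseteq> S \<and> \<not> S \<subseteq> critical C w p q"
proof (cases "C \<inter> front w p q = {}")
  case False
  then show ?thesis unfolding meets_front[OF S(1)] using S(2) by (auto simp: required_def critical_def)
next
  case C0: True
  show ?thesis
  proof (cases "card (front w p q) = 1")
    case True
    then have f: "front w p q = {0}" using card_front_1[OF pq] by simp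
    show ?thesis
    proof (cases "length w = 0")
      case True
      then have "S = {0}" using S by auto
      then show ?thesis unfolding meets_front[OF S(1)] using f True by (auto simp: required_def critical_def)
    next
      case False
      then show ?thesis unfolding meets_front[OF S(1)] using f C0 S(2) by (auto simp: required_def critical_def)
    qed
  next
    case False
    then show ?thesis unfolding meets_front[OF S(1)] using C0 S by (auto simp: required_def critical_def)
  qed
qed

lemma required_bounded: "C \<subseteq> {..length w} \<Longrightarrow> required C w p q \<subseteq> {..length w}"
  by (simp add: required_def)

context shuffle_labels begin

lemma critical_face:
  assumes w: "w \<in> words n m" and p: "clause_ok n (ascents n u) p" and q: "clause_ok m (ascents m v) q"
    and ne: "critical (corners w) w p q \<noteq> {}"
  shows "required (corners w) w p q \<noteq> {}" "required (corners w) w p q \<subseteq> critical (corners w) w p q"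
    "critical (corners w) w p q \<subseteq> {..length w}" "card (critical (corners w) w p q) + 2 \<le> Suc (length w)"
proof -
  have pq: "0 < p" "0 < q" using p q by (auto simp: clause_ok_def)
  have f: "corners w \<inter> front w p q = {}" "card (front w p q) \<noteq> 1"
    and crit: "critical (corners w) w p q = {..length w} - front w p q"
    using ne by (auto simp: critical_def split: if_splits)
  have req: "required (corners w) w p q = corners w" using f by (simp add: required_def)
  obtain t where t: "t \<le> length w" "t \<notin> front w p q" using ne crit by auto
  then have "p \<le> ups w t \<or> q \<le> rts w t" by (auto simp: front_def)
  then have "p \<le> n \<or> q \<le> m" using ups_le[OF w t(1)] rts_le[OF w t(1)] by linarith
  then have "ascents n u \<noteq> {} \<or> ascents m v \<noteq> {}" using p q by (auto simp: clause_ok_def)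
  then have "corners w \<noteq> {}" using ascent_row_has_corner[OF w] ascent_column_has_corner[OF w] by fastforce
  then show "required (corners w) w p q \<noteq> {}" using req by simp
  show "required (corners w) w p q \<subseteq> critical (corners w) w p q"
    using req crit f corners_bounded[of w] by blast
  show "critical (corners w) w p q \<subseteq> {..length w}" using crit by blast
  have sub: "front w p q \<subseteq> {..length w}" by (auto simp: front_def)
  have "card (front w p q) \<noteq> 0" using zero_in_front[OF pq, of w] by auto
  then have "2 \<le> card (front w p q)" using f by linarith
  moreover have "card (critical (corners w) w p q) = Suc (length w) - card (front w p q)"
    unfolding crit by (simp add: card_Diff_subset sub)
  moreover have "card (front w p q) \<le> Suc (length w)" using card_mono[OF _ sub] by simp
  ultimately show "card (critical (corners w) w p q) + 2 \<le> Suc (length w)" by linarith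
qed

end

section \<open>Existence of labels\<close>

text \<open>
  Rise by \<open>a\<close> at the elements of \<open>I\<close> and fall by \<open>d\<close> elsewhere. The total change is prescribed by
  the choice of \<open>a\<close> and \<open>d\<close>.
\<close>

definition zigzag :: "nat set \<Rightarrow> nat \<Rightarrow> nat \<Rightarrow> nat \<Rightarrow> int" where
  "zigzag I a d i = int a * int (card (I \<inter> {..<i})) - int d * int (card ({..<i} - I))"

lemma zigzag_0 [simp]: "zigzag I a d 0 = 0"
  by (simp add: zigzag_def)

lemma zigzag_Suc: "zigzag I a d (Suc i) = zigzag I a d i + (if i \<in> I then int a else - int d)"
proof -
  have "card (I \<inter> {..<Suc i}) = card (I \<inter> {..<i}) + (if i \<in> I then 1 else 0)"
    by (simp add: lessThan_Suc)
  moreover have "card ({..<Suc i} - I) = card ({..<i} - I) + (if i \<in> I then 0 else 1)"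
    by (simp add: lessThan_Suc insert_Diff_if)
  ultimately show ?thesis by (simp add: zigzag_def algebra_simps)
qed

lemma zigzag_full:
  assumes "I \<subseteq> {..n}"
  shows "zigzag I a d (Suc n) = int a * int (card I) - int d * (int (Suc n) - int (card I))"
proof -
  have "I \<inter> {..<Suc n} = I" using assms by auto
  moreover have "card ({..<Suc n} - I) = Suc n - card I" using assms
    by (simp add: card_Diff_subset finite_subset lessThan_Suc_atMost)
  moreover have "card I \<le> Suc n" using card_mono[OF _ assms] by simp
  ultimately show ?thesis by (simp add: zigzag_def of_nat_diff)
qed

text \<open>
  With step sizes adapted to the cardinalities, both sequences fall by the same total amount from
  0. Doubling the values and adding 1 to the inner labels of the first sequence makes them odd,
  hence different from all labels of the second one.
\<close>

lemma labels_exist_descending: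
  assumes I: "I \<subseteq> {..n}" "I \<noteq> {..n}" and J: "J \<subseteq> {..m}" "J \<noteq> {..m}"
  shows "\<exists>u v. shuffle_labels n m u v \<and> ascents n u = I \<and> ascents m v = J"
proof -
  define k l where "k = card I" "l = card J"
  define k' l' where "k' = Suc n - k" "l' = Suc m - l"
  have kk: "0 < k'" "k + k' = Suc n"
    using psubset_card_mono[OF finite_atMost psubsetI[OF I]] unfolding k_l_def k'_l'_def card_atMost by linarith+
  have ll: "0 < l'" "l + l' = Suc m"
    using psubset_card_mono[OF finite_atMost psubsetI[OF J]] unfolding k_l_def k'_l'_def card_atMost by linarith+
  define x where "x = zigzag I k' (k + l')"
  define y where "y = zigzag J l' (l + k')"
  have x_end: "x (Suc n) = - int (k' * l')"
  proof -
    have h: "x (Suc n) = int k' * int k - int (k + l') * (int (Suc n) - int k)"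
      unfolding x_def zigzag_full[OF I(1)] k_l_def ..
    have d: "int (Suc n) - int k = int k'" using kk by linarith
    show ?thesis unfolding h d by (simp add: algebra_simps)
  qed
  have y_end: "y (Suc m) = - int (k' * l')"
  proof -
    have h: "y (Suc m) = int l' * int l - int (l + k') * (int (Suc m) - int l)"
      unfolding y_def zigzag_full[OF J(1)] k_l_def ..
    have d: "int (Suc m) - int l = int l'" using ll by linarith
    show ?thesis unfolding h d by (simp add: algebra_simps)
  qed
  define u where "u i = 2 * x i + (if 1 \<le> i \<and> i \<le> n then 1 else 0)" for i
  define v where "v j = 2 * y j" for j
  have ux: "u i < u (Suc i) \<longleftrightarrow> i \<in> I" "u i \<noteq> u (Suc i)" for i
    using kk(1) ll(1) by (auto simp: u_def x_def zigzag_Suc)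
  have vy: "v j < v (Suc j) \<longleftrightarrow> j \<in> J" "v j \<noteq> v (Suc j)" for j
    using kk(1) ll(1) by (auto simp: v_def y_def zigzag_Suc)
  have "shuffle_labels n m u v"
  proof
    show "u 0 = v 0" by (simp add: u_def v_def x_def y_def)
    show "u (Suc n) = v (Suc m)" using x_end y_end by (simp add: u_def v_def)
    show "u i \<noteq> v j" if "1 \<le> i" "i \<le> n" "1 \<le> j" "j \<le> m" for i j
      unfolding u_def v_def using that by presburger
  qed (use ux vy in auto)
  moreover have "ascents n u = I" "ascents m v = J" using ux vy I J by (auto simp: ascents_def)
  ultimately show ?thesis by blast
qed

text \<open>
  If one of the sets is everything, then the sequences have to end above their common start; the
  negatives of falling sequences for the complements do.
\<close>

lemma labels_exist:
  assumes I: "I \<subseteq> {..n}" and J: "J \<subseteq> {..m}"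
    and "\<not> (I = {..n} \<and> J = {})" "\<not> (I = {} \<and> J = {..m})"
  shows "\<exists>u v. shuffle_labels n m u v \<and> ascents n u = I \<and> ascents m v = J"
proof (cases "I \<noteq> {..n} \<and> J \<noteq> {..m}")
  case True
  then show ?thesis using labels_exist_descending[OF I _ J] by blast
next
  case False
  then have "{..n} - I \<noteq> {..n}" "{..m} - J \<noteq> {..m}" using assms by blast+
  then obtain u v where uv: "shuffle_labels n m u v" "ascents n u = {..n} - I" "ascents m v = {..m} - J"
    using labels_exist_descending[of "{..n} - I" n "{..m} - J" m] by blast
  have "ascents n (\<lambda>i. - u i) = I" "ascents m (\<lambda>j. - v j) = J"
    using negated_labels(2,3)[OF uv(1)] uv(2,3) I J by auto
  then show ?thesis using negated_labels(1)[OF uv(1)] by blast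
qed

text \<open>
  The labels used when all rows but no columns are required. Row 0 is no ascent here; hitting it
  is imposed by the initial segment \<open>p = 1\<close>. All inner row labels are smaller than all inner
  column labels, so that the corners are the vertices at which the path arrives by a step to the
  next row.
\<close>

definition split_u :: "nat \<Rightarrow> nat \<Rightarrow> nat \<Rightarrow> int" where
  "split_u n m i = (if i = 0 then int m + 1 else int i - int n - 1)"

definition split_v :: "nat \<Rightarrow> nat \<Rightarrow> int" where
  "split_v m j = int m + 1 - int j"

lemma split_labels: "shuffle_labels n m (split_u n m) (split_v m)"
  by unfold_locales (auto simp: split_u_def split_v_def)

lemma split_ascents: "ascents n (split_u n m) = {1..n}" "ascents m (split_v m) = {}"
  by (auto simp: ascents_def split_u_def split_v_def)

lemma split_corners:
  assumes w: "w \<in> words n m"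
  shows "shuffle_labels.corners n (split_u n m) (split_v m) w = Suc ` {t. t < length w \<and> w ! t}"
proof -
  interpret shuffle_labels n m "split_u n m" "split_v m" by (rule split_labels)
  have "t \<in> corners w \<longleftrightarrow> 0 < t \<and> w ! (t - 1)" if t: "t \<le> length w" for t
  proof -
    have b: "ups w t \<le> n" "rts w t \<le> m" using ups_le[OF w t] rts_le[OF w t] by auto
    note io = label_in_u[OF w t] label_in_v[OF w t] label_out_u[OF w t] label_out_v[OF w t]
    have out: "label w (Suc t) = split_u n m (Suc (ups w t)) \<or> label w (Suc t) = split_v m (Suc (rts w t)) \<and> rts w t < m
        \<or> label w (Suc t) = 0"
      using io rts_le[OF w, of "Suc t"] rts_Suc[of t w] t
      by (cases "t = length w") (auto simp: label_def split_u_def)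
    have "0 < t \<and> w ! (t - 1) \<Longrightarrow> 0 < ups w t"
      using ups_positive[of "t - 1" w] t by auto
    then show ?thesis
      using io out b t by (cases "0 < t \<and> w ! (t - 1)") (auto simp: corners_def split_u_def split_v_def)
  qed
  then have "corners w = {t. t \<le> length w \<and> 0 < t \<and> w ! (t - 1)}" by (auto simp: corners_def)
  also have "\<dots> = Suc ` {t. t < length w \<and> w ! t}"
  proof (intro equalityI subsetI)
    fix t assume "t \<in> {t. t \<le> length w \<and> 0 < t \<and> w ! (t - 1)}"
    then show "t \<in> Suc ` {t. t < length w \<and> w ! t}" by (intro image_eqI[of _ _ "t - 1"]) auto
  qed auto
  finally show ?thesis .
qed

text \<open>
  The order of the tile of a path for these labels: one for each step to the next row, and one
  more for the vertex \<open>(0,0)\<close> if a path of positive length has no other vertex in row 0.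
\<close>

definition split_order :: "nat \<Rightarrow> bool list \<Rightarrow> nat" where
  "split_order n w = n + (if w \<noteq> [] \<and> hd w then 1 else 0)"

lemma split_required:
  assumes w: "w \<in> words n m"
  shows "card (required (shuffle_labels.corners n (split_u n m) (split_v m) w) w 1 (Suc m)) = split_order n w"
proof -
  define C where "C = shuffle_labels.corners n (split_u n m) (split_v m) w"
  have C: "C = Suc ` {t. t < length w \<and> w ! t}" using split_corners[OF w] C_def by simp
  have cC: "card C = n"
    unfolding C using w by (subst card_image) (auto simp: words_def length_filter_conv_card)
  have fin: "finite C" unfolding C by simp
  have front: "front w 1 (Suc m) = {t. t \<le> length w \<and> ups w t = 0}"
    using rts_le[OF w] by (auto simp: front_def less_Suc_eq_le)
  have disj: "C \<inter> front w 1 (Suc m) = {}"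
    unfolding front C using ups_positive[of _ w] by fastforce
  have one: "card (front w 1 (Suc m)) = 1 \<longleftrightarrow> hd w" if "w \<noteq> []"
  proof -
    have u1: "ups w 1 = (if hd w then 1 else 0)" using that ups_Suc[of 0 w] by (simp add: hd_conv_nth)
    have "front w 1 (Suc m) = {0} \<longleftrightarrow> hd w"
    proof
      assume f: "front w 1 (Suc m) = {0}"
      have "1 \<notin> front w 1 (Suc m)" unfolding f by simp
      moreover have "1 \<le> length w" using that by (simp add: Suc_le_eq)
      ultimately have "ups w 1 \<noteq> 0" unfolding front by simp
      then show "hd w" using u1 by (simp split: if_splits)
    next
      assume "hd w"
      then have "t = 0" if "ups w t = 0" for t using u1 ups_mono[of 1 t w] that by (cases t) auto
      then show "front w 1 (Suc m) = {0}" unfolding front by auto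
    qed
    then show ?thesis using card_front_1[of 1 "Suc m" w] by simp
  qed
  have "0 \<notin> C" using C by auto
  then show ?thesis unfolding C_def[symmetric] required_def split_order_def
    using disj one fin cC by (cases "w = []") auto
qed

lemma front_swap: "front (map Not w) q p = front w p q"
  by (auto simp: front_def ups_map_Not rts_map_Not)

lemma required_swap: "required C (map Not w) q p = required C w p q"
  by (simp add: required_def front_swap)

section \<open>The orders of the tiles of a product\<close>

text \<open>
  The rows required by an ordered tile, and the first vertex \<open>p\<close> of its Morse face, with \<open>p = n+1\<close>
  if there is none; codimension at least two means \<open>p \<ge> 2\<close>.
\<close>

definition pattern :: "nat \<Rightarrow> nat set \<Rightarrow> nat \<Rightarrow> bool" where
  "pattern n I p \<longleftrightarrow> I \<subseteq> {..n} \<and> (p = Suc n \<or> (2 \<le> p \<and> p \<le> n \<and> I \<subseteq> {p..n} \<and> I \<noteq> {}))"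

definition meets :: "nat set \<Rightarrow> nat \<Rightarrow> nat set \<Rightarrow> bool" where
  "meets I p r \<longleftrightarrow> I \<subseteq> r \<and> (\<exists>i\<in>r. i < p)"

text \<open>
  The number of tiles of order \<open>j\<close> in a product of tiles of dimensions \<open>n\<close>, \<open>m\<close> and orders \<open>k\<close>,
  \<open>l\<close>. The two exceptional cases are those in which no labels exist. In the others any labels with
  \<open>k\<close> and \<open>l\<close> ascents give the same number, by \<open>corner_count_cong\<close>.
\<close>

definition order_count :: "nat \<Rightarrow> nat \<Rightarrow> nat \<Rightarrow> nat \<Rightarrow> nat \<Rightarrow> nat" where
  "order_count n m k l j =
     (if k = Suc n \<and> l = 0 then card {w \<in> words n m. split_order n w = j}
      else if k = 0 \<and> l = Suc m then card {w \<in> words n m. Suc (n + m) - split_order n w = j}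
      else (SOME c. \<exists>u v. shuffle_labels n m u v \<and> card (ascents n u) = k \<and> card (ascents m v) = l \<and>
              c = card {w \<in> words n m. card (shuffle_labels.corners n u v w) = j}))"

lemma order_count_labels:
  assumes "shuffle_labels n m u v" "\<not> (card (ascents n u) = Suc n \<and> card (ascents m v) = 0)"
    "\<not> (card (ascents n u) = 0 \<and> card (ascents m v) = Suc m)"
  shows "order_count n m (card (ascents n u)) (card (ascents m v)) j =
    card {w \<in> words n m. card (shuffle_labels.corners n u v w) = j}"
proof -
  have "(SOME c. \<exists>u' v'. shuffle_labels n m u' v' \<and> card (ascents n u') = card (ascents n u) \<and>
      card (ascents m v') = card (ascents m v) \<and>
      c = card {w \<in> words n m. card (shuffle_labels.corners n u' v' w) = j}) =
    card {w \<in> words n m. card (shuffle_labels.corners n u v w) = j}"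
  proof (rule some_equality)
    fix c assume "\<exists>u' v'. shuffle_labels n m u' v' \<and> card (ascents n u') = card (ascents n u) \<and>
      card (ascents m v') = card (ascents m v) \<and>
      c = card {w \<in> words n m. card (shuffle_labels.corners n u' v' w) = j}"
    then show "c = card {w \<in> words n m. card (shuffle_labels.corners n u v w) = j}"
      using corner_count_cong[OF _ assms(1)] by blast
  qed (use assms(1) in blast)
  then show ?thesis unfolding order_count_def using assms(2,3) by (simp only: if_False)
qed

lemma card_complement_eq:
  assumes "C \<subseteq> {..N}" "j \<le> Suc N"
  shows "card ({..N} - C) = Suc N - j \<longleftrightarrow> card C = (j::nat)"
proof -
  have "card ({..N} - C) = Suc N - card C" using assms(1) finite_subset[OF assms(1)] by (simp add: card_Diff_subset)
  moreover have "card C \<le> Suc N" using card_mono[OF _ assms(1)] by simp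
  ultimately show ?thesis using assms(2) by linarith
qed

text \<open>
  Negating the labels complements the ascents and the corners. The two cases without labels are
  exchanged, and there the symmetry is part of the definition.
\<close>

lemma order_count_symmetric:
  assumes k: "k \<le> Suc n" and l: "l \<le> Suc m" and j: "j \<le> Suc (n + m)"
  shows "order_count n m (Suc n - k) (Suc m - l) (Suc (n + m) - j) = order_count n m k l j"
proof -
  have so: "split_order n w \<le> Suc (n + m)" for w by (simp add: split_order_def)
  consider "k = Suc n" "l = 0" | "k = 0" "l = Suc m"
    | "\<not> (k = Suc n \<and> l = 0)" "\<not> (k = 0 \<and> l = Suc m)" by blast
  then show ?thesis
  proof cases
    case 1
    have "(Suc (n + m) - split_order n w = Suc (n + m) - j) = (split_order n w = j)" for w using so[of w] j by linarith
    then show ?thesis using 1 by (simp add: order_count_def)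
  next
    case 2
    have "(split_order n w = Suc (n + m) - j) = (Suc (n + m) - split_order n w = j)" for w using so[of w] j by linarith
    then show ?thesis using 2 by (simp add: order_count_def)
  next
    case 3
    have ne: "\<not> ({..<k} = {..n} \<and> {..<l} = {})" "\<not> ({..<k} = {} \<and> {..<l} = {..m})"
      using 3 by (metis card_atMost card_lessThan card.empty)+
    obtain u v where uv: "shuffle_labels n m u v" "ascents n u = {..<k}" "ascents m v = {..<l}"
      using labels_exist[OF _ _ ne] k l by fastforce
    then have kl: "card (ascents n u) = k" "card (ascents m v) = l" by simp_all
    have neg: "card (ascents n (\<lambda>i. - u i)) = Suc n - k" "card (ascents m (\<lambda>j. - v j)) = Suc m - l"
      unfolding negated_labels(2,3)[OF uv(1)] using uv(2,3) k l
      by (subst card_Diff_subset; force)+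
    have "order_count n m (Suc n - k) (Suc m - l) (Suc (n + m) - j) =
      card {w \<in> words n m. card (shuffle_labels.corners n (\<lambda>i. - u i) (\<lambda>j. - v j) w) = Suc (n + m) - j}"
    proof (rule order_count_labels[OF negated_labels(1)[OF uv(1)], unfolded neg])
      show "\<not> (Suc n - k = Suc n \<and> Suc m - l = 0)" "\<not> (Suc n - k = 0 \<and> Suc m - l = Suc m)"
        using 3 k l by linarith+
    qed
    also have "\<dots> = card {w \<in> words n m. card (shuffle_labels.corners n u v w) = j}"
    proof -
      have "card (shuffle_labels.corners n (\<lambda>i. - u i) (\<lambda>j. - v j) w) = Suc (n + m) - j \<longleftrightarrow>
          card (shuffle_labels.corners n u v w) = j" if w: "w \<in> words n m" for w
      proof -
        have "shuffle_labels.corners n u v w \<subseteq> {..n + m}"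
          using shuffle_labels.corners_bounded[OF uv(1), of w] words_length[OF w] by simp
        then show ?thesis unfolding negated_labels(4)[OF uv(1) w] using j by (rule card_complement_eq)
      qed
      then show ?thesis by (intro arg_cong[where f = card]) auto
    qed
    also have "\<dots> = order_count n m k l j"
      using order_count_labels[OF uv(1), unfolded kl] 3 by simp
    finally show ?thesis .
  qed
qed

text \<open>
  Unless \<open>p\<close> or \<open>q\<close> is 1 in positive dimension, the first step of the path, if any, stays in the
  initial segment, which therefore is not a single vertex.
\<close>

lemma required_eq_corners:
  assumes w: "w \<in> words n m" and p: "2 \<le> p \<or> p = Suc n" and q: "2 \<le> q \<or> q = Suc m"
  shows "required C w p q = C"
proof (cases "w = []")
  case False
  then have len: "1 \<le> length w" by (simp add: Suc_le_eq)
  have "ups w 1 + rts w 1 = 1" using ups_rts[OF len] .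
  moreover have "ups w 1 \<le> n" "rts w 1 \<le> m" using ups_le[OF w len] rts_le[OF w len] .
  ultimately have "1 \<in> front w p q" using p q len by (auto simp: front_def)
  then have "front w p q \<noteq> {0}" by auto
  moreover have "0 < p" "0 < q" using p q by auto
  ultimately show ?thesis using card_front_1 by (simp add: required_def)
qed (simp add: required_def)

text \<open>
  Case B concerns the product of two points, where the requirement to hit the only row or column
  is void for nonempty chains. Requiring both makes the order of the product of a point of order 0
  with a point of order 1 opposite to the one obtained in case A, as the symmetry demands.
\<close>

lemma product_pattern:
  assumes p: "pattern n I p" and q: "pattern m J q"
  shows "\<exists>u v p' q'. shuffle_labels n m u v \<and> clause_ok n (ascents n u) p' \<and> clause_ok m (ascents m v) q' \<and>
    (\<forall>r. r \<noteq> {} \<and> r \<subseteq> {..n} \<longrightarrow> meets (ascents n u) p' r = meets I p r) \<and>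
    (\<forall>r. r \<noteq> {} \<and> r \<subseteq> {..m} \<longrightarrow> meets (ascents m v) q' r = meets J q r) \<and>
    (\<forall>j. card {w \<in> words n m. card (required (shuffle_labels.corners n u v w) w p' q') = j} =
      order_count n m (card I) (card J) j)"
proof -
  have sub: "I \<subseteq> {..n}" "J \<subseteq> {..m}" using p q by (auto simp: pattern_def)
  have cI: "card I = Suc n \<longleftrightarrow> I = {..n}" "card J = Suc m \<longleftrightarrow> J = {..m}" "card I = 0 \<longleftrightarrow> I = {}" "card J = 0 \<longleftrightarrow> J = {}"
  proof -
    show "card I = Suc n \<longleftrightarrow> I = {..n}" using card_subset_eq[OF finite_atMost sub(1)] by (metis card_atMost)
    show "card J = Suc m \<longleftrightarrow> J = {..m}" using card_subset_eq[OF finite_atMost sub(2)] by (metis card_atMost)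
    show "card I = 0 \<longleftrightarrow> I = {}" using finite_subset[OF sub(1)] by simp
    show "card J = 0 \<longleftrightarrow> J = {}" using finite_subset[OF sub(2)] by simp
  qed
  have whole: "meets {1..a} 1 r = meets {..a} (Suc a) r" if "r \<noteq> {}" "r \<subseteq> {..a}" for a r
  proof
    assume r: "meets {1..a} 1 r"
    then have "0 \<in> r" "{1..a} \<subseteq> r" by (auto simp: meets_def)
    moreover have "{..a} = insert 0 {1..a}" by auto
    ultimately have "{..a} \<subseteq> r" by simp
    then show "meets {..a} (Suc a) r" using that by (auto simp: meets_def)
  qed (auto simp: meets_def)
  have none: "meets {} (Suc a) r" if "r \<noteq> {}" "r \<subseteq> {..a}" for a r
    using that by (auto simp: meets_def less_Suc_eq_le)
  have ok1: "clause_ok a {1..a} 1" and ok0: "clause_ok a K (Suc a)" for a K by (auto simp: clause_ok_def)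
  consider (A) "I = {..n}" "J = {}" | (B) "I = {}" "J = {..m}" "n + m = 0" | (C) "I = {}" "J = {..m}" "0 < n + m"
    | (D) "\<not> (I = {..n} \<and> J = {})" "\<not> (I = {} \<and> J = {..m})" by blast
  then show ?thesis
  proof cases
    case A
    then have "p = Suc n" "q = Suc m" using p q by (force simp: pattern_def)+
    moreover have "card {w \<in> words n m. card (required (shuffle_labels.corners n (split_u n m) (split_v m) w) w 1 (Suc m)) = j} =
        order_count n m (card I) (card J) j" for j
    proof -
      have "{w \<in> words n m. card (required (shuffle_labels.corners n (split_u n m) (split_v m) w) w 1 (Suc m)) = j} =
          {w \<in> words n m. split_order n w = j}"
        using split_required[of _ n m] by auto
      then show ?thesis using A by (simp add: order_count_def)
    qed
    ultimately show ?thesis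
      unfolding A using split_labels[of n m] ok1[of n] ok0[of m] whole none
      by (intro exI[of _ "split_u n m"] exI[of _ "split_v m"] exI[of _ 1] exI[of _ "Suc m"])
        (simp add: split_ascents A)
  next
    case B
    define u :: "nat \<Rightarrow> int" where "u i = int i" for i
    have nm: "n = 0" "m = 0" using B by auto
    have pq: "p = 1" "q = 1" using p q nm by (auto simp: pattern_def)
    have lab: "shuffle_labels n m u u" by unfold_locales (auto simp: u_def nm)
    have asc: "ascents n u = {0}" "ascents m u = {0}" by (auto simp: ascents_def u_def nm)
    have "w = []" if "w \<in> words n m" for w using words_length[OF that] nm by simp
    moreover have "[] \<in> words n m" by (simp add: words_def nm)
    ultimately have wd: "words n m = {[]}" by blast
    have "shuffle_labels.corners n u u [] = {0}"
      unfolding shuffle_labels.corners_def[OF lab] shuffle_labels.label_def[OF lab] by (auto simp: u_def nm)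
    then have "card (required (shuffle_labels.corners n u u []) [] 1 1) = 1" by (simp add: required_def)
    then have "card {w \<in> words n m. card (required (shuffle_labels.corners n u u w) w 1 1) = j} =
        order_count n m (card I) (card J) j" for j
    proof -
      have "{w \<in> words n m. card (required (shuffle_labels.corners n u u w) w 1 1) = j} =
          {w \<in> words n m. Suc (n + m) - split_order n w = j}"
        unfolding wd using \<open>card _ = 1\<close> by (auto simp: split_order_def nm)
      then show ?thesis using B nm by (simp add: order_count_def)
    qed
    moreover have "meets {0} 1 r = meets I 1 r" "meets {0} 1 r = meets J 1 r" if "r \<noteq> {}" "r \<subseteq> {..0}" for r
      using that sub nm by (auto simp: meets_def)
    ultimately show ?thesis using lab ok0[of 0] unfolding pq nm
      by (intro exI[of _ u] exI[of _ 1]) (simp add: asc[unfolded nm])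
  next
    case C
    then have pq: "p = Suc n" "q = Suc m" using p q by (force simp: pattern_def)+
    have lab: "shuffle_labels n m (split_v n) (split_u m n)"
      by (rule shuffle_labels.swapped[OF split_labels])
    have req: "card (required (shuffle_labels.corners n (split_v n) (split_u m n) w) w (Suc n) 1) =
        Suc (n + m) - split_order n w" if w: "w \<in> words n m" for w
    proof -
      have len: "w \<noteq> []" using words_length[OF w] C by auto
      have "shuffle_labels.corners n (split_v n) (split_u m n) w = shuffle_labels.corners m (split_u m n) (split_v n) (map Not w)"
        using shuffle_labels.corners_swap[OF lab w] by simp
      then have "card (required (shuffle_labels.corners n (split_v n) (split_u m n) w) w (Suc n) 1) = split_order m (map Not w)"
        using split_required[of "map Not w" m n] w by (simp add: words_map_Not required_swap)
      also have "\<dots> = Suc (n + m) - split_order n w" using len by (simp add: split_order_def hd_map)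
      finally show ?thesis .
    qed
    then have "{w \<in> words n m. card (required (shuffle_labels.corners n (split_v n) (split_u m n) w) w (Suc n) 1) = j} =
      {w \<in> words n m. Suc (n + m) - split_order n w = j}" for j by auto
    then have "card {w \<in> words n m. card (required (shuffle_labels.corners n (split_v n) (split_u m n) w) w (Suc n) 1) = j} =
        order_count n m (card I) (card J) j" for j
      using C by (simp add: order_count_def)
    then show ?thesis
      unfolding pq using lab whole none ok1[of m] ok0[of n]
      by (intro exI[of _ "split_v n"] exI[of _ "split_u m n"] exI[of _ "Suc n"] exI[of _ 1])
        (simp add: split_ascents C)
  next
    case D
    obtain u v where uv: "shuffle_labels n m u v" "ascents n u = I" "ascents m v = J"
      using labels_exist[OF sub D] by blast
    have p': "2 \<le> p \<or> p = Suc n" "2 \<le> q \<or> q = Suc m" using p q by (auto simp: pattern_def)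
    have "{w \<in> words n m. card (required (shuffle_labels.corners n u v w) w p q) = j} =
       {w \<in> words n m. card (shuffle_labels.corners n u v w) = j}" for j
      using required_eq_corners[OF _ p'] by auto
    moreover have "clause_ok n I p" "clause_ok m J q" using p q by (auto simp: pattern_def clause_ok_def)
    ultimately show ?thesis
      using uv order_count_labels[OF uv(1)] D cI by (intro exI[of _ u] exI[of _ v] exI[of _ p] exI[of _ q]) simp
  qed
qed

section \<open>Open simplices and carriers\<close>

text \<open>
  The relative interior of a simplex with vertices \<open>s\<close>, written with barycentric coordinates: this
  is the form in which projections and uniqueness of coordinates are used.
\<close>

definition open_simplex :: "'a::real_vector set \<Rightarrow> 'a set" where
  "open_simplex s = {y. \<exists>z. (\<forall>c\<in>s. 0 < z c) \<and> sum z s = 1 \<and> (\<Sum>c\<in>s. z c *\<^sub>R c) = y}"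

definition vertices :: "'a::euclidean_space set \<Rightarrow> 'a set" where
  "vertices S = {v. v extreme_point_of S}"

lemma open_simplex_empty [simp]: "open_simplex {} = {}"
  by (simp add: open_simplex_def)

lemma open_simplex_singleton: "v \<in> open_simplex {v}"
  by (auto simp: open_simplex_def intro!: exI[of _ "\<lambda>_. 1"])

lemma open_simplex_subset_hull: "finite s \<Longrightarrow> open_simplex s \<subseteq> convex hull s"
  unfolding open_simplex_def convex_hull_finite by (auto intro: less_imp_le)

lemma hull_carrier:
  assumes "finite V" "y \<in> convex hull V"
  shows "\<exists>s\<subseteq>V. s \<noteq> {} \<and> y \<in> open_simplex s"
proof -
  obtain u where u: "\<forall>x\<in>V. 0 \<le> u x" "sum u V = 1" "(\<Sum>x\<in>V. u x *\<^sub>R x) = y"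
    using assms by (auto simp: convex_hull_finite)
  define s where "s = {x\<in>V. u x \<noteq> 0}"
  have "sum u s = sum u V" "(\<Sum>x\<in>s. u x *\<^sub>R x) = (\<Sum>x\<in>V. u x *\<^sub>R x)"
    by (rule sum.mono_neutral_left; use assms(1) in \<open>auto simp: s_def\<close>)+
  then have "sum u s = 1" "(\<Sum>x\<in>s. u x *\<^sub>R x) = y" using u by simp_all
  moreover have "\<forall>x\<in>s. 0 < u x" using u(1) by (force simp: s_def order_le_less)
  ultimately have "y \<in> open_simplex s" by (auto simp: open_simplex_def)
  moreover have "s \<noteq> {}" using \<open>sum u s = 1\<close> by auto
  moreover have "s \<subseteq> V" by (simp add: s_def)
  ultimately show ?thesis by (intro exI[of _ s]) simp
qed

lemma weights_unique:
  fixes u w :: "'a::real_vector \<Rightarrow> real"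
  assumes "finite V" "\<not> affine_dependent V" "sum u V = sum w V"
    "(\<Sum>x\<in>V. u x *\<^sub>R x) = (\<Sum>x\<in>V. w x *\<^sub>R x)" "x \<in> V"
  shows "u x = w x"
proof (rule ccontr)
  assume "u x \<noteq> w x"
  moreover have "sum (\<lambda>x. u x - w x) V = 0" using assms(3) by (simp add: sum_subtractf)
  moreover have "(\<Sum>x\<in>V. (u x - w x) *\<^sub>R x) = 0" using assms(4) by (simp add: scaleR_left_diff_distrib sum_subtractf)
  ultimately have "affine_dependent V"
    unfolding affine_dependent_explicit_finite[OF assms(1)] using assms(5)
    by (intro exI[of _ "\<lambda>x. u x - w x"]) auto
  then show False using assms(2) by simp
qed

lemma open_simplex_weights:
  assumes "finite V" "s \<subseteq> V" "y \<in> open_simplex s"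
  shows "\<exists>z. (\<forall>c. 0 < z c \<longleftrightarrow> c \<in> s) \<and> (\<forall>c. 0 \<le> z c) \<and> sum z V = 1 \<and> (\<Sum>c\<in>V. z c *\<^sub>R c) = y"
proof -
  obtain z where z: "\<forall>c\<in>s. 0 < z c" "sum z s = 1" "(\<Sum>c\<in>s. z c *\<^sub>R c) = y"
    using assms by (auto simp: open_simplex_def)
  define z' where "z' c = (if c \<in> s then z c else 0)" for c
  have "sum z' V = sum z' s" "(\<Sum>c\<in>V. z' c *\<^sub>R c) = (\<Sum>c\<in>s. z' c *\<^sub>R c)"
    by (rule sum.mono_neutral_right; use assms in \<open>simp add: z'_def\<close>)+
  moreover have "sum z' s = 1" "(\<Sum>c\<in>s. z' c *\<^sub>R c) = y"
    using z(2,3) by (simp_all add: z'_def)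
  moreover have "0 < z' c \<longleftrightarrow> c \<in> s" "0 \<le> z' c" for c using z(1) by (auto simp: z'_def intro: less_imp_le)
  ultimately show ?thesis by (intro exI[of _ z']) simp
qed

lemma open_simplex_eq:
  assumes V: "finite V" "\<not> affine_dependent V" and "s \<subseteq> V" "s' \<subseteq> V" "y \<in> open_simplex s" "y \<in> open_simplex s'"
  shows "s = s'"
proof -
  obtain z where z: "\<forall>c. 0 < z c \<longleftrightarrow> c \<in> s" "sum z V = 1" "(\<Sum>c\<in>V. z c *\<^sub>R c) = y"
    using open_simplex_weights[OF V(1) assms(3,5)] by blast
  obtain z' where z': "\<forall>c. 0 < z' c \<longleftrightarrow> c \<in> s'" "sum z' V = 1" "(\<Sum>c\<in>V. z' c *\<^sub>R c) = y"
    using open_simplex_weights[OF V(1) assms(4,6)] by blast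
  have "c \<in> s \<longleftrightarrow> c \<in> s'" for c
  proof (cases "c \<in> V")
    case True
    then have "z c = z' c" using weights_unique[OF V _ _ True, of z z'] z(2,3) z'(2,3) by simp
    then show ?thesis using z(1)[rule_format, of c] z'(1)[rule_format, of c] by simp
  next
    case False
    then show ?thesis using assms(3,4) by auto
  qed
  then show ?thesis by (rule set_eqI)
qed

lemma open_simplex_in_hull_iff:
  assumes V: "finite V" "\<not> affine_dependent V" and "s \<subseteq> V" "C \<subseteq> V" "y \<in> open_simplex s"
  shows "y \<in> convex hull C \<longleftrightarrow> s \<subseteq> C"
proof
  assume "y \<in> convex hull C"
  then obtain s' where s': "s' \<subseteq> C" "y \<in> open_simplex s'"
    using hull_carrier[OF finite_subset[OF assms(4) V(1)]] by blast
  then have "s = s'" using open_simplex_eq[OF V assms(3) _ assms(5)] assms(4) by (meson order_trans)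
  then show "s \<subseteq> C" using s'(1) by simp
next
  assume "s \<subseteq> C"
  then have "convex hull s \<subseteq> convex hull C" by (rule hull_mono)
  then show "y \<in> convex hull C" using open_simplex_subset_hull[OF finite_subset[OF assms(3) V(1)]] assms(5) by auto
qed

lemma vertices_hull: "\<not> affine_dependent V \<Longrightarrow> vertices (convex hull V) = V"
  by (simp add: vertices_def extreme_point_of_convex_hull_affine_independent)

lemma complex_simplex:
  assumes "simplicial_complex K" "S \<in> K"
  shows "finite (vertices S)" "\<not> affine_dependent (vertices S)" "S = convex hull vertices S"
proof -
  obtain C where "finite C" "\<not> affine_dependent C" "S = convex hull C"
    using assms unfolding simplicial_complex_def simplex by blast
  then show "finite (vertices S)" "\<not> affine_dependent (vertices S)" "S = convex hull vertices S"
    using vertices_hull by metis+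
qed

lemma complex_subface:
  assumes "simplicial_complex K" "S \<in> K" "C \<subseteq> vertices S"
  shows "convex hull C \<in> K" "vertices (convex hull C) = C"
proof -
  note S = complex_simplex[OF assms(1,2)]
  have "convex hull C face_of S"
    using face_of_convex_hull_affine_independent[OF S(2)] S(3) assms(3) by metis
  then show "convex hull C \<in> K" using assms(1,2) unfolding simplicial_complex_def by blast
  show "vertices (convex hull C) = C" using vertices_hull affine_dependent_subset S(2) assms(3) by metis
qed

text \<open>
  The common face is spanned by vertices of either simplex, and a simplex determines its vertices.
\<close>

lemma complex_Int:
  assumes K: "simplicial_complex K" and "S \<in> K" "S' \<in> K"
  shows "S \<inter> S' = convex hull (vertices S \<inter> vertices S')"
proof -
  note S = complex_simplex[OF K assms(2)] and S' = complex_simplex[OF K assms(3)]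
  have f: "S \<inter> S' face_of S" "S \<inter> S' face_of S'"
    using K assms(2,3) unfolding simplicial_complex_def by (metis Int_commute)+
  obtain C where C: "C \<subseteq> vertices S" "S \<inter> S' = convex hull C"
    using f(1) face_of_convex_hull_affine_independent[OF S(2)] S(3) by metis
  obtain C' where C': "C' \<subseteq> vertices S'" "S \<inter> S' = convex hull C'"
    using f(2) face_of_convex_hull_affine_independent[OF S'(2)] S'(3) by metis
  have "C = C'" using vertices_hull[of C] vertices_hull[of C'] affine_dependent_subset S(2) S'(2) C C' by metis
  then have "C \<subseteq> vertices S \<inter> vertices S'" using C C' by blast
  then have 1: "S \<inter> S' \<subseteq> convex hull (vertices S \<inter> vertices S')" using C(2) hull_mono by metis
  have "convex hull (vertices S \<inter> vertices S') \<subseteq> S" "convex hull (vertices S \<inter> vertices S') \<subseteq> S'"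
    using S(3) S'(3) hull_mono[of "vertices S \<inter> vertices S'"] by (metis Int_lower1 Int_lower2)+
  then show ?thesis using 1 by blast
qed

lemma carrier_in_simplex:
  assumes K: "simplicial_complex K" and "S \<in> K" "S' \<in> K" "s \<subseteq> vertices S" "y \<in> open_simplex s" "y \<in> S'"
  shows "s \<subseteq> vertices S'"
proof -
  note S = complex_simplex[OF K assms(2)]
  have "finite s" using S(1) assms(4) finite_subset by blast
  then have "y \<in> S" using S(3) open_simplex_subset_hull[of s] assms(4,5) hull_mono[of s "vertices S" convex] by blast
  then have "y \<in> convex hull (vertices S \<inter> vertices S')" using complex_Int[OF K assms(2,3)] assms(6) by blast
  then show ?thesis using open_simplex_in_hull_iff[OF S(1,2) assms(4) _ assms(5)] by blast
qed

section \<open>Weights on chains\<close>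

text \<open>
  The north-west corner rule. Cut an interval of length the total weight into pieces of lengths
  \<open>x i\<close>, and also into pieces of lengths \<open>y j\<close>; the weight of \<open>(i, j)\<close> is the length of the
  overlap of the two pieces. The overlap is written as a mixed difference of the function
  \<open>min (X i) (Y j)\<close> of the tails, so that the row and column sums telescope.
\<close>

lemma chain_weights_exist:
  fixes x y :: "nat \<Rightarrow> real"
  assumes x: "\<And>i. i < n \<Longrightarrow> 0 \<le> x i" and y: "\<And>j. j < m \<Longrightarrow> 0 \<le> y j"
    and total: "sum x {..<n} = sum y {..<m}"
  shows "\<exists>z. (\<forall>c. 0 \<le> z c) \<and> is_chain {c. z c \<noteq> 0} \<and> {c. z c \<noteq> 0} \<subseteq> {..<n} \<times> {..<m} \<and>
    (\<forall>i<n. (\<Sum>j<m. z (i, j)) = x i) \<and> (\<forall>j<m. (\<Sum>i<n. z (i, j)) = y j)"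
proof -
  define X where "X i = sum x {i..<n}" for i
  define Y where "Y j = sum y {j..<m}" for j
  have X_Suc: "X i = x i + X (Suc i)" if "i < n" for i unfolding X_def by (rule sum.atLeast_Suc_lessThan[OF that])
  have Y_Suc: "Y j = y j + Y (Suc j)" if "j < m" for j unfolding Y_def by (rule sum.atLeast_Suc_lessThan[OF that])
  have X0: "0 \<le> X i" "X i \<le> X 0" "X n = 0" for i
    unfolding X_def using x by (auto intro: sum_nonneg sum_mono2)
  have Y0: "0 \<le> Y j" "Y j \<le> Y 0" "Y m = 0" for j
    unfolding Y_def using y by (auto intro: sum_nonneg sum_mono2)
  have XY: "X 0 = Y 0" using total by (simp add: X_def Y_def atLeast0LessThan)
  have X_mono: "X i' \<le> X i" if "i \<le> i'" for i i'
    unfolding X_def using x that by (intro sum_mono2) auto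
  have Y_mono: "Y j' \<le> Y j" if "j \<le> j'" for j j'
    unfolding Y_def using y that by (intro sum_mono2) auto
  define z where "z c = (case c of (i, j) \<Rightarrow> if i < n \<and> j < m then
      (min (X i) (Y j) - min (X (Suc i)) (Y j)) - (min (X i) (Y (Suc j)) - min (X (Suc i)) (Y (Suc j))) else 0)" for c
  have nonneg: "0 \<le> z (i, j)" for i j
    using X_mono[of i "Suc i"] Y_mono[of j "Suc j"] by (auto simp: z_def min_def)
  have overlap: "X (Suc i) < Y j \<and> Y (Suc j) < X i" if "z (i, j) \<noteq> 0" for i j
    using that X_mono[of i "Suc i"] Y_mono[of j "Suc j"] by (auto simp: z_def min_def split: if_splits)
  have no_cross: "\<not> (i < i' \<and> j' < j)" if "z (i, j) \<noteq> 0" "z (i', j') \<noteq> 0" for i j i' j'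
    using overlap[OF that(1)] overlap[OF that(2)] X_mono[of "Suc i" i'] Y_mono[of "Suc j'" j] by linarith
  have chain: "is_chain {c. z c \<noteq> 0}"
    unfolding is_chain_def
  proof (intro ballI)
    fix c c' assume "c \<in> {c. z c \<noteq> 0}" "c' \<in> {c. z c \<noteq> 0}"
    then show "c \<le> c' \<or> c' \<le> c"
      using no_cross[of "fst c" "snd c" "fst c'" "snd c'"] no_cross[of "fst c'" "snd c'" "fst c" "snd c"]
      by (auto simp: less_eq_prod_def not_less)
  qed
  have tele: "(\<Sum>k<l. f k - f (Suc k)) = f 0 - f l" for f :: "nat \<Rightarrow> real" and l
    by (induction l) auto
  have rows: "(\<Sum>j<m. z (i, j)) = x i" if "i < n" for i
  proof -
    have "(\<Sum>j<m. z (i, j)) = (\<Sum>j<m. (min (X i) (Y j) - min (X (Suc i)) (Y j)) -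
        (min (X i) (Y (Suc j)) - min (X (Suc i)) (Y (Suc j))))" using that by (simp add: z_def)
    also have "\<dots> = X i - X (Suc i)"
      unfolding tele[of "\<lambda>j. min (X i) (Y j) - min (X (Suc i)) (Y j)"]
      using X0(1,2)[of i] X0(1,2)[of "Suc i"] Y0(3) XY by simp
    finally show ?thesis using X_Suc[OF that] by simp
  qed
  have columns: "(\<Sum>i<n. z (i, j)) = y j" if "j < m" for j
  proof -
    have "(\<Sum>i<n. z (i, j)) = (\<Sum>i<n. (min (X i) (Y j) - min (X i) (Y (Suc j))) -
        (min (X (Suc i)) (Y j) - min (X (Suc i)) (Y (Suc j))))" using that by (simp add: z_def algebra_simps)
    also have "\<dots> = Y j - Y (Suc j)"
      unfolding tele[of "\<lambda>i. min (X i) (Y j) - min (X i) (Y (Suc j))"]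
      using Y0(1,2)[of j] Y0(1,2)[of "Suc j"] X0(3) XY by simp
    finally show ?thesis using Y_Suc[OF that] by simp
  qed
  have "{c. z c \<noteq> 0} \<subseteq> {..<n} \<times> {..<m}" by (auto simp: z_def split: if_splits)
  moreover have "\<forall>c. 0 \<le> z c" using nonneg by auto
  ultimately show ?thesis using chain rows columns by blast
qed

text \<open>
  In a chain, the elements beyond row \<open>i\<close> and those beyond column \<open>j\<close> form nested sets. So the
  weight beyond both is the smaller one of the two tails, which depend only on the row and column
  sums, and the single weights are recovered as mixed differences.
\<close>

lemma chain_weights_unique:
  fixes z z' :: "nat \<times> nat \<Rightarrow> real"
  assumes z: "\<And>c. 0 \<le> z c" "is_chain {c. z c \<noteq> 0}" "{c. z c \<noteq> 0} \<subseteq> {..<n} \<times> {..<m}"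
    and z': "\<And>c. 0 \<le> z' c" "is_chain {c. z' c \<noteq> 0}" "{c. z' c \<noteq> 0} \<subseteq> {..<n} \<times> {..<m}"
    and rows: "\<And>i. i < n \<Longrightarrow> (\<Sum>j<m. z (i, j)) = (\<Sum>j<m. z' (i, j))"
    and columns: "\<And>j. j < m \<Longrightarrow> (\<Sum>i<n. z (i, j)) = (\<Sum>i<n. z' (i, j))"
  shows "z = z'"
proof -
  define Z where "Z f i j = (\<Sum>c\<in>{i..<n} \<times> {j..<m}. f c)" for f :: "nat \<times> nat \<Rightarrow> real" and i j
  have Z_min: "Z f i j = min (Z f i 0) (Z f 0 j)"
    if f: "\<And>c. 0 \<le> f c" "is_chain {c. f c \<noteq> 0}" for f :: "nat \<times> nat \<Rightarrow> real" and i j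
  proof -
    have le: "Z f i j \<le> Z f i 0" "Z f i j \<le> Z f 0 j"
      unfolding Z_def using f(1) by (intro sum_mono2; auto)+
    have "(\<forall>c\<in>{i..<n} \<times> {0..<m} - {i..<n} \<times> {j..<m}. f c = 0) \<or>
        (\<forall>c\<in>{0..<n} \<times> {j..<m} - {i..<n} \<times> {j..<m}. f c = 0)"
    proof (rule ccontr)
      assume "\<not> ?thesis"
      then obtain c d where c: "c \<in> {i..<n} \<times> {0..<m} - {i..<n} \<times> {j..<m}" "f c \<noteq> 0"
        and d: "d \<in> {0..<n} \<times> {j..<m} - {i..<n} \<times> {j..<m}" "f d \<noteq> 0" by blast
      have "c \<le> d \<or> d \<le> c" using f(2) c(2) d(2) unfolding is_chain_def by blast
      then show False using c(1) d(1) by (auto simp: less_eq_prod_def)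
    qed
    then have "Z f i j = Z f i 0 \<or> Z f i j = Z f 0 j"
    proof
      assume "\<forall>c\<in>{i..<n} \<times> {0..<m} - {i..<n} \<times> {j..<m}. f c = 0"
      then have "Z f i j = Z f i 0" unfolding Z_def by (intro sum.mono_neutral_left) auto
      then show ?thesis ..
    next
      assume "\<forall>c\<in>{0..<n} \<times> {j..<m} - {i..<n} \<times> {j..<m}. f c = 0"
      then have "Z f i j = Z f 0 j" unfolding Z_def by (intro sum.mono_neutral_left) auto
      then show ?thesis ..
    qed
    then show ?thesis using le by linarith
  qed
  have row_sums: "Z z i 0 = Z z' i 0" for i
    unfolding Z_def sum.cartesian_product' atLeast0LessThan using rows by simp
  have column_sums: "Z z 0 j = Z z' 0 j" for j
  proof -
    have "Z f 0 j = (\<Sum>b\<in>{j..<m}. \<Sum>a<n. f (a, b))" for f :: "nat \<times> nat \<Rightarrow> real"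
      unfolding Z_def sum.cartesian_product' atLeast0LessThan by (rule sum.swap)
    then show ?thesis using columns by simp
  qed
  have Z_eq: "Z z i j = Z z' i j" for i j
    using Z_min[OF z(1,2), of i j] Z_min[OF z'(1,2), of i j] row_sums column_sums by simp
  have diff: "f (i, j) = Z f i j - Z f (Suc i) j - Z f i (Suc j) + Z f (Suc i) (Suc j)"
    if "i < n" "j < m" for f :: "nat \<times> nat \<Rightarrow> real" and i j
    using that by (simp add: Z_def sum.cartesian_product' sum.atLeast_Suc_lessThan[OF that(1)]
        sum.atLeast_Suc_lessThan[OF that(2)] sum.distrib)
  show ?thesis
  proof (rule ext)
    fix c
    show "z c = z' c"
    proof (cases "c \<in> {..<n} \<times> {..<m}")
      case True
      then obtain i j where "c = (i, j)" "i < n" "j < m" by auto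
      then show ?thesis using diff[of i j z] diff[of i j z'] Z_eq by simp
    next
      case False
      then have "z c = 0" "z' c = 0" using z(3) z'(3) by blast+
      then show ?thesis by simp
    qed
  qed
qed

section \<open>Complexes with ordered simplices and chains in products\<close>

text \<open>
  On a single simplex the relation is a strict linear order, while it may have cycles in the
  complex.
\<close>

locale ordered_complex =
  fixes K :: "'a::euclidean_space set set" and R :: "('a \<times> 'a) set"
  assumes complex: "simplicial_complex K"
    and asym: "(a, b) \<in> R \<Longrightarrow> (b, a) \<notin> R"
    and total: "S \<in> K \<Longrightarrow> a \<in> vertices S \<Longrightarrow> b \<in> vertices S \<Longrightarrow> a \<noteq> b \<Longrightarrow> (a, b) \<in> R \<or> (b, a) \<in> R"
    and trans: "S \<in> K \<Longrightarrow> a \<in> vertices S \<Longrightarrow> b \<in> vertices S \<Longrightarrow> c \<in> vertices S \<Longrightarrow>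
      (a, b) \<in> R \<Longrightarrow> (b, c) \<in> R \<Longrightarrow> (a, c) \<in> R"
begin

lemmas simplex_facts = complex_simplex[OF complex]

lemma order_enumeration:
  assumes S: "S \<in> K" and n: "card (vertices S) = Suc n"
  shows "\<exists>e. bij_betw e {..n} (vertices S) \<and> (\<forall>i\<le>n. \<forall>j\<le>n. (e i, e j) \<in> R \<longleftrightarrow> i < j)"
proof -
  define V where "V = vertices S"
  have fin: "finite V" and cV: "card V = Suc n" using simplex_facts(1)[OF S] n by (simp_all add: V_def)
  \<comment> \<open>the number of predecessors is the position of a vertex\<close>
  define f where "f v = card {w\<in>V. (w, v) \<in> R}" for v
  have less: "f w < f v" if "w \<in> V" "v \<in> V" "(w, v) \<in> R" for v w
  proof -
    have "{x\<in>V. (x, w) \<in> R} \<subseteq> {x\<in>V. (x, v) \<in> R}" using trans[OF S] that unfolding V_def by blast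
    moreover have "w \<in> {x\<in>V. (x, v) \<in> R}" "w \<notin> {x\<in>V. (x, w) \<in> R}" using that asym by auto
    ultimately have "{x\<in>V. (x, w) \<in> R} \<subset> {x\<in>V. (x, v) \<in> R}" by blast
    then show ?thesis unfolding f_def using fin by (intro psubset_card_mono) auto
  qed
  have inj: "inj_on f V"
  proof (rule inj_onI, rule ccontr)
    fix v w assume vw: "v \<in> V" "w \<in> V" "f v = f w" "v \<noteq> w"
    then have "(v, w) \<in> R \<or> (w, v) \<in> R" using total[OF S] V_def by blast
    then show False using less[of v w] less[of w v] vw by auto
  qed
  have "f ` V \<subseteq> {..n}"
  proof (rule image_subsetI)
    fix v assume v: "v \<in> V"
    have "v \<notin> {w\<in>V. (w, v) \<in> R}" using asym[of v v] by auto
    then have "{w\<in>V. (w, v) \<in> R} \<subset> V" using v by blast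
    then have "f v < card V" unfolding f_def using fin by (intro psubset_card_mono)
    then show "f v \<in> {..n}" using cV by simp
  qed
  moreover have "card (f ` V) = card {..n}" using card_image[OF inj] cV by simp
  ultimately have img: "f ` V = {..n}" using card_subset_eq[of "{..n}" "f ` V"] by simp
  then have bf: "bij_betw f V {..n}" using inj by (simp add: bij_betw_def)
  define e where "e = inv_into V f"
  have be: "bij_betw e {..n} V" unfolding e_def by (rule bij_betw_inv_into[OF bf])
  have fe: "f (e i) = i" "e i \<in> V" if "i \<le> n" for i
    using that img be unfolding e_def by (auto simp: f_inv_into_f inv_into_into)
  have "(e i, e j) \<in> R \<longleftrightarrow> i < j" if "i \<le> n" "j \<le> n" for i j
  proof
    assume "(e i, e j) \<in> R"
    then show "i < j" using less[of "e i" "e j"] fe that by simp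
  next
    assume ij: "i < j"
    then have "e i \<noteq> e j" using fe that by (metis less_irrefl)
    then have "(e i, e j) \<in> R \<or> (e j, e i) \<in> R" using total[OF S] fe that V_def by blast
    then show "(e i, e j) \<in> R" using less[of "e j" "e i"] fe that ij by auto
  qed
  then show ?thesis using be V_def by blast
qed

end

text \<open>
  The product order is meaningful on the vertices of a cell \<open>S1 \<times> S2\<close>.
\<close>

locale ordered_complexes =
  c1: ordered_complex K1 R1 + c2: ordered_complex K2 R2
  for K1 :: "'a::euclidean_space set set" and R1 and K2 :: "'b::euclidean_space set set" and R2
begin

definition below :: "'a \<times> 'b \<Rightarrow> 'a \<times> 'b \<Rightarrow> bool" where
  "below c c' \<longleftrightarrow> (fst c = fst c' \<or> (fst c, fst c') \<in> R1) \<and> (snd c = snd c' \<or> (snd c, snd c') \<in> R2)"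

definition chain :: "('a \<times> 'b) set \<Rightarrow> bool" where
  "chain s \<longleftrightarrow> (\<forall>c\<in>s. \<forall>c'\<in>s. below c c' \<or> below c' c)"

lemma chain_subset: "chain s \<Longrightarrow> s' \<subseteq> s \<Longrightarrow> chain s'"
  by (auto simp: chain_def)

end

text \<open>
  A cell with its vertices enumerated in increasing order, which identifies its vertices with a
  grid.
\<close>

locale enumerated_pair = ordered_complexes K1 R1 K2 R2
  for K1 :: "'a::euclidean_space set set" and R1 and K2 :: "'b::euclidean_space set set" and R2 +
  fixes S1 :: "'a set" and S2 :: "'b set" and n m :: nat and e1 :: "nat \<Rightarrow> 'a" and e2 :: "nat \<Rightarrow> 'b"
  assumes S1: "S1 \<in> K1" and S2: "S2 \<in> K2"
    and e1: "bij_betw e1 {..n} (vertices S1)" and e1R: "i \<le> n \<Longrightarrow> i' \<le> n \<Longrightarrow> (e1 i, e1 i') \<in> R1 \<longleftrightarrow> i < i'"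
    and e2: "bij_betw e2 {..m} (vertices S2)" and e2R: "j \<le> m \<Longrightarrow> j' \<le> m \<Longrightarrow> (e2 j, e2 j') \<in> R2 \<longleftrightarrow> j < j'"
begin

abbreviation "grid \<equiv> {..n} \<times> {..m}"
abbreviation "V1 \<equiv> vertices S1"
abbreviation "V2 \<equiv> vertices S2"

definition emb :: "nat \<times> nat \<Rightarrow> 'a \<times> 'b" where
  "emb = map_prod e1 e2"

lemma emb_bij: "bij_betw emb grid (V1 \<times> V2)"
  unfolding emb_def by (rule bij_betw_map_prod[OF e1 e2])

lemma emb_inj: "inj_on emb grid" using emb_bij by (simp add: bij_betw_def)

lemma e1_eq: "i \<le> n \<Longrightarrow> i' \<le> n \<Longrightarrow> e1 i = e1 i' \<longleftrightarrow> i = i'"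
  using e1 by (auto simp: bij_betw_def inj_on_def)

lemma e2_eq: "i \<le> m \<Longrightarrow> i' \<le> m \<Longrightarrow> e2 i = e2 i' \<longleftrightarrow> i = i'"
  using e2 by (auto simp: bij_betw_def inj_on_def)

lemma below_emb: "c \<in> grid \<Longrightarrow> c' \<in> grid \<Longrightarrow> below (emb c) (emb c') \<longleftrightarrow> c \<le> c'"
  by (auto simp: below_def emb_def e1_eq e2_eq e1R e2R less_eq_prod_def le_less)

lemma chain_emb:
  assumes "s \<subseteq> grid"
  shows "chain (emb ` s) \<longleftrightarrow> is_chain s"
proof -
  have "(below (emb c) (emb c') \<or> below (emb c') (emb c)) = (c \<le> c' \<or> c' \<le> c)" if "c \<in> s" "c' \<in> s" for c c'
    using below_emb[of c c'] below_emb[of c' c] that assms by blast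
  then show ?thesis unfolding chain_def is_chain_def by simp
qed

lemma fin: "finite V1" "finite V2" and aff: "\<not> affine_dependent V1" "\<not> affine_dependent V2"
  and hull: "S1 = convex hull V1" "S2 = convex hull V2"
  using c1.simplex_facts[OF S1] c2.simplex_facts[OF S2] by auto

lemma sum_V1: "sum f V1 = (\<Sum>i\<le>n. f (e1 i))" and sum_V2: "sum g V2 = (\<Sum>j\<le>m. g (e2 j))"
  using sum.reindex_bij_betw[OF e1] sum.reindex_bij_betw[OF e2] by (metis (no_types))+

lemma marginals_fst:
  fixes z :: "'a \<times> 'b \<Rightarrow> real"
  shows "(\<Sum>c\<in>V1 \<times> V2. z c) = (\<Sum>a\<in>V1. \<Sum>b\<in>V2. z (a, b))"
    "fst (\<Sum>c\<in>V1 \<times> V2. z c *\<^sub>R c) = (\<Sum>a\<in>V1. (\<Sum>b\<in>V2. z (a, b)) *\<^sub>R a)"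
proof -
  show "(\<Sum>c\<in>V1 \<times> V2. z c) = (\<Sum>a\<in>V1. \<Sum>b\<in>V2. z (a, b))" by (simp add: sum.cartesian_product)
  have "fst (\<Sum>c\<in>V1 \<times> V2. z c *\<^sub>R c) = (\<Sum>c\<in>V1 \<times> V2. z c *\<^sub>R fst c)" by (simp add: fst_sum)
  also have "\<dots> = (\<Sum>a\<in>V1. \<Sum>b\<in>V2. z (a, b) *\<^sub>R a)"
    by (subst sum.cartesian_product) (simp add: case_prod_beta)
  finally show "fst (\<Sum>c\<in>V1 \<times> V2. z c *\<^sub>R c) = (\<Sum>a\<in>V1. (\<Sum>b\<in>V2. z (a, b)) *\<^sub>R a)"
    by (simp add: scaleR_left.sum)
qed

lemma marginals_snd:
  fixes z :: "'a \<times> 'b \<Rightarrow> real"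
  shows "(\<Sum>c\<in>V1 \<times> V2. z c) = (\<Sum>b\<in>V2. \<Sum>a\<in>V1. z (a, b))"
    "snd (\<Sum>c\<in>V1 \<times> V2. z c *\<^sub>R c) = (\<Sum>b\<in>V2. (\<Sum>a\<in>V1. z (a, b)) *\<^sub>R b)"
proof -
  show "(\<Sum>c\<in>V1 \<times> V2. z c) = (\<Sum>b\<in>V2. \<Sum>a\<in>V1. z (a, b))"
    by (subst sum.swap) (simp add: sum.cartesian_product)
  have "snd (\<Sum>c\<in>V1 \<times> V2. z c *\<^sub>R c) = (\<Sum>c\<in>V1 \<times> V2. z c *\<^sub>R snd c)" by (simp add: snd_sum)
  also have "\<dots> = (\<Sum>a\<in>V1. \<Sum>b\<in>V2. z (a, b) *\<^sub>R b)"
    by (subst sum.cartesian_product) (simp add: case_prod_beta)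
  also have "\<dots> = (\<Sum>b\<in>V2. \<Sum>a\<in>V1. z (a, b) *\<^sub>R b)" by (rule sum.swap)
  finally show "snd (\<Sum>c\<in>V1 \<times> V2. z c *\<^sub>R c) = (\<Sum>b\<in>V2. (\<Sum>a\<in>V1. z (a, b)) *\<^sub>R b)"
    by (simp add: scaleR_left.sum)
qed

text \<open>
  A point determines the row and column sums of its weights, as these are the barycentric
  coordinates of its projections.
\<close>

lemma product_weights_unique:
  fixes z z' :: "'a \<times> 'b \<Rightarrow> real"
  assumes z: "\<And>c. 0 \<le> z c" "chain {c\<in>V1 \<times> V2. z c \<noteq> 0}"
    and z': "\<And>c. 0 \<le> z' c" "chain {c\<in>V1 \<times> V2. z' c \<noteq> 0}"
    and tot: "(\<Sum>c\<in>V1 \<times> V2. z c) = (\<Sum>c\<in>V1 \<times> V2. z' c)"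
    and pt: "(\<Sum>c\<in>V1 \<times> V2. z c *\<^sub>R c) = (\<Sum>c\<in>V1 \<times> V2. z' c *\<^sub>R c)"
    and c: "c \<in> V1 \<times> V2"
  shows "z c = z' c"
proof -
  define y where "y c = (if c \<in> grid then z (emb c) else 0)" for c
  define y' where "y' c = (if c \<in> grid then z' (emb c) else 0)" for c
  have rows: "(\<Sum>b\<in>V2. z (a, b)) = (\<Sum>b\<in>V2. z' (a, b))" if "a \<in> V1" for a
    by (rule weights_unique[OF fin(1) aff(1) _ _ that])
      (use tot pt marginals_fst[of z] marginals_fst[of z'] in simp_all)
  have cols: "(\<Sum>a\<in>V1. z (a, b)) = (\<Sum>a\<in>V1. z' (a, b))" if "b \<in> V2" for b
    by (rule weights_unique[OF fin(2) aff(2) _ _ that])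
      (use tot pt marginals_snd[of z] marginals_snd[of z'] in simp_all)
  have sup: "is_chain {c. f c \<noteq> 0}" if f: "f = (\<lambda>c. if c \<in> grid then x (emb c) else 0)" and x: "chain {c\<in>V1 \<times> V2. x c \<noteq> 0}"
    for f and x :: "'a \<times> 'b \<Rightarrow> real"
  proof -
    have sub: "{c. f c \<noteq> 0} \<subseteq> grid" using f by auto
    have "emb ` {c. f c \<noteq> 0} \<subseteq> {c\<in>V1 \<times> V2. x c \<noteq> 0}"
      using emb_bij f by (auto simp: bij_betw_def split: if_splits)
    then show ?thesis using chain_subset[OF x] chain_emb[OF sub] by blast
  qed
  have "y = y'"
  proof (rule chain_weights_unique[where n = "Suc n" and m = "Suc m"])
    show "0 \<le> y c" "0 \<le> y' c" for c using z(1) z'(1) by (simp_all add: y_def y'_def)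
    show "is_chain {c. y c \<noteq> 0}" "is_chain {c. y' c \<noteq> 0}"
      by (rule sup[OF _ z(2)], simp add: y_def fun_eq_iff, rule sup[OF _ z'(2)], simp add: y'_def fun_eq_iff)
    show "{c. y c \<noteq> 0} \<subseteq> {..<Suc n} \<times> {..<Suc m}" "{c. y' c \<noteq> 0} \<subseteq> {..<Suc n} \<times> {..<Suc m}"
      by (auto simp: y_def y'_def less_Suc_eq_le split: if_splits)
    show "(\<Sum>j<Suc m. y (i, j)) = (\<Sum>j<Suc m. y' (i, j))" if "i < Suc n" for i
    proof -
      have "e1 i \<in> V1" using e1 that by (auto simp: bij_betw_def)
      then show ?thesis using rows[of "e1 i"] that
        by (simp add: y_def y'_def emb_def sum_V2 lessThan_Suc_atMost)
    qed
    show "(\<Sum>i<Suc n. y (i, j)) = (\<Sum>i<Suc n. y' (i, j))" if "j < Suc m" for j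
    proof -
      have "e2 j \<in> V2" using e2 that by (auto simp: bij_betw_def)
      then show ?thesis using cols[of "e2 j"] that
        by (simp add: y_def y'_def emb_def sum_V1 lessThan_Suc_atMost)
    qed
  qed
  have "c \<in> emb ` grid" using emb_bij c by (simp add: bij_betw_def)
  then obtain d where d: "d \<in> grid" "c = emb d" by blast
  have "y d = y' d" using \<open>y = y'\<close> by simp
  then show ?thesis using d unfolding y_def y'_def by simp
qed

lemma fin_product: "finite (V1 \<times> V2)" using fin by simp

text \<open>
  A constant weight and its perturbation by an affine dependence would represent the same point.
\<close>

lemma chain_affine_independent:
  assumes "s \<subseteq> V1 \<times> V2" "chain s"
  shows "\<not> affine_dependent s"
proof
  have fs: "finite s" using assms(1) fin_product finite_subset by blast
  assume "affine_dependent s"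
  then obtain U where U: "sum U s = 0" "\<exists>v\<in>s. U v \<noteq> 0" "(\<Sum>v\<in>s. U v *\<^sub>R v) = 0"
    unfolding affine_dependent_explicit_finite[OF fs] by blast
  define k where "k = (\<Sum>c\<in>s. \<bar>U c\<bar>)"
  have k: "\<bar>U c\<bar> \<le> k" if "c \<in> s" for c unfolding k_def using fs that by (intro member_le_sum) auto
  have k0: "0 \<le> k" unfolding k_def by (simp add: sum_nonneg)
  define z where "z c = (if c \<in> s then k else 0)" for c
  define z' where "z' c = (if c \<in> s then k + U c else 0)" for c
  have ext: "(\<Sum>c\<in>V1 \<times> V2. (if c \<in> s then f c else 0)) = sum f s" for f :: "'a \<times> 'b \<Rightarrow> real"
    using assms(1) fin_product by (simp add: sum.If_cases Int_absorb1)
  have ext': "(\<Sum>c\<in>V1 \<times> V2. (if c \<in> s then f c else 0) *\<^sub>R c) = (\<Sum>c\<in>s. f c *\<^sub>R c)" for f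
  proof -
    have "(\<Sum>c\<in>s. f c *\<^sub>R c) = (\<Sum>c\<in>s. (if c \<in> s then f c else 0) *\<^sub>R c)" by simp
    also have "\<dots> = (\<Sum>c\<in>V1 \<times> V2. (if c \<in> s then f c else 0) *\<^sub>R c)"
      by (rule sum.mono_neutral_left[OF fin_product assms(1)]) simp
    finally show ?thesis by simp
  qed
  \<comment> \<open>the constant k dominates all coefficients of the dependence U, so both weights are nonnegative\<close>
  have "z c = z' c" if "c \<in> V1 \<times> V2" for c
  proof (rule product_weights_unique[OF _ _ _ _ _ _ that])
    show "0 \<le> z c" for c using k0 by (simp add: z_def)
    show "0 \<le> z' c" for c using k[of c] by (auto simp: z'_def)
    show "chain {c\<in>V1 \<times> V2. z c \<noteq> 0}" "chain {c\<in>V1 \<times> V2. z' c \<noteq> 0}"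
      by (rule chain_subset[OF assms(2)]; auto simp: z_def z'_def)+
    show "(\<Sum>c\<in>V1 \<times> V2. z c) = (\<Sum>c\<in>V1 \<times> V2. z' c)"
      unfolding z_def z'_def ext using U(1) by (simp add: sum.distrib)
    show "(\<Sum>c\<in>V1 \<times> V2. z c *\<^sub>R c) = (\<Sum>c\<in>V1 \<times> V2. z' c *\<^sub>R c)"
      unfolding z_def z'_def ext' using U(3) by (simp add: scaleR_left_distrib sum.distrib)
  qed
  moreover obtain v where v: "v \<in> s" "U v \<noteq> 0" using U(2) by blast
  ultimately have "z v = z' v" using assms(1) by blast
  then show False using v by (simp add: z_def z'_def)
qed

lemma chain_carrier_unique:
  assumes "s \<subseteq> V1 \<times> V2" "chain s" "y \<in> open_simplex s" "s' \<subseteq> V1 \<times> V2" "chain s'" "y \<in> open_simplex s'"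
  shows "s = s'"
proof -
  obtain z where z: "\<forall>c. 0 < z c \<longleftrightarrow> c \<in> s" "\<forall>c. 0 \<le> z c" "sum z (V1 \<times> V2) = 1" "(\<Sum>c\<in>V1 \<times> V2. z c *\<^sub>R c) = y"
    using open_simplex_weights[OF fin_product assms(1,3)] by blast
  obtain z' where z': "\<forall>c. 0 < z' c \<longleftrightarrow> c \<in> s'" "\<forall>c. 0 \<le> z' c" "sum z' (V1 \<times> V2) = 1" "(\<Sum>c\<in>V1 \<times> V2. z' c *\<^sub>R c) = y"
    using open_simplex_weights[OF fin_product assms(4,6)] by blast
  have sub: "{c\<in>V1 \<times> V2. z c \<noteq> 0} \<subseteq> s" "{c\<in>V1 \<times> V2. z' c \<noteq> 0} \<subseteq> s'"
    using z(1,2) z'(1,2) by (auto simp: order_le_less)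
  have eq: "z c = z' c" if "c \<in> V1 \<times> V2" for c
    by (rule product_weights_unique[OF z(2)[rule_format] chain_subset[OF assms(2) sub(1)]
          z'(2)[rule_format] chain_subset[OF assms(5) sub(2)] _ _ that])
      (simp_all only: z(3,4) z'(3,4))
  have "c \<in> s \<longleftrightarrow> c \<in> s'" for c
  proof (cases "c \<in> V1 \<times> V2")
    case True
    then show ?thesis using eq[OF True] z(1)[rule_format, of c] z'(1)[rule_format, of c] by simp
  next
    case False
    then show ?thesis using assms(1,4) by blast
  qed
  then show ?thesis by (rule set_eqI)
qed

lemma chain_carrier_exists:
  assumes "y \<in> S1 \<times> S2"
  shows "\<exists>s\<subseteq>V1 \<times> V2. chain s \<and> y \<in> open_simplex s"
proof -
  obtain p q where y: "y = (p, q)" by (cases y)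
  have pq: "p \<in> convex hull V1" "q \<in> convex hull V2" using assms y hull by auto
  obtain x1 where x1: "\<forall>a\<in>V1. 0 \<le> x1 a" "sum x1 V1 = 1" "(\<Sum>a\<in>V1. x1 a *\<^sub>R a) = p"
    using pq(1) fin by (auto simp: convex_hull_finite)
  obtain x2 where x2: "\<forall>a\<in>V2. 0 \<le> x2 a" "sum x2 V2 = 1" "(\<Sum>a\<in>V2. x2 a *\<^sub>R a) = q"
    using pq(2) fin by (auto simp: convex_hull_finite)
  have mem: "e1 i \<in> V1" if "i \<le> n" for i using e1 that by (auto simp: bij_betw_def)
  have mem2: "e2 j \<in> V2" if "j \<le> m" for j using e2 that by (auto simp: bij_betw_def)
  have "\<exists>z. (\<forall>c. 0 \<le> z c) \<and> is_chain {c. z c \<noteq> 0} \<and> {c. z c \<noteq> 0} \<subseteq> {..<Suc n} \<times> {..<Suc m} \<and>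
    (\<forall>i<Suc n. (\<Sum>j<Suc m. z (i, j)) = x1 (e1 i)) \<and> (\<forall>j<Suc m. (\<Sum>i<Suc n. z (i, j)) = x2 (e2 j))"
  proof (rule chain_weights_exist)
    show "0 \<le> x1 (e1 i)" if "i < Suc n" for i using x1(1) mem that by simp
    show "0 \<le> x2 (e2 i)" if "i < Suc m" for i using x2(1) mem2 that by simp
    show "(\<Sum>i<Suc n. x1 (e1 i)) = (\<Sum>j<Suc m. x2 (e2 j))"
      using x1(2) x2(2) by (simp only: sum_V1 sum_V2 lessThan_Suc_atMost)
  qed
  then obtain z where z: "\<forall>c. 0 \<le> z c" "is_chain {c. z c \<noteq> 0}" "{c. z c \<noteq> 0} \<subseteq> grid"
    and zr: "\<forall>i\<le>n. (\<Sum>j\<le>m. z (i, j)) = x1 (e1 i)" and zc: "\<forall>j\<le>m. (\<Sum>i\<le>n. z (i, j)) = x2 (e2 j)"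
    by (auto simp: lessThan_Suc_atMost less_Suc_eq_le)
  define s where "s = {c. z c \<noteq> 0}"
  have s: "s \<subseteq> grid" "is_chain s" using z by (auto simp: s_def)
  have inj: "inj_on emb s" using inj_on_subset[OF emb_inj s(1)] .
  define w where "w c = z (inv_into grid emb c)" for c
  have we: "w (emb c) = z c" if "c \<in> grid" for c
    unfolding w_def using inv_into_f_f[OF emb_inj that] by simp
  have fs: "finite s" using s(1) finite_subset by blast
  have "\<forall>c\<in>emb ` s. 0 < w c"
  proof
    fix c assume "c \<in> emb ` s"
    then obtain d where d: "d \<in> s" "c = emb d" by blast
    then have "w c = z d" using we s(1) by blast
    moreover have "0 < z d" using z(1)[rule_format, of d] d(1) by (simp add: s_def)
    ultimately show "0 < w c" by simp
  qed
  moreover have expand: "(\<Sum>c\<in>emb ` s. f c *\<^sub>R g c) = (\<Sum>i\<le>n. \<Sum>j\<le>m. f (emb (i, j)) *\<^sub>R g (emb (i, j)))"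
    if f: "\<And>c. c \<in> grid \<Longrightarrow> f (emb c) = z c" for f and g :: "'a \<times> 'b \<Rightarrow> 'c::real_vector"
  proof -
    have "(\<Sum>c\<in>emb ` s. f c *\<^sub>R g c) = (\<Sum>c\<in>s. f (emb c) *\<^sub>R g (emb c))"
      using sum.reindex[OF inj] by simp
    also have "\<dots> = (\<Sum>c\<in>grid. f (emb c) *\<^sub>R g (emb c))"
      by (rule sum.mono_neutral_left) (use s(1) f in \<open>auto simp: s_def\<close>)
    finally show ?thesis by (simp add: sum.cartesian_product case_prod_beta)
  qed
  have W: "w (emb (i, j)) = z (i, j)" if "i \<le> n" "j \<le> m" for i j using we that by simp
  have total: "sum w (emb ` s) = 1"
  proof -
    have "sum w (emb ` s) = (\<Sum>i\<le>n. \<Sum>j\<le>m. w (emb (i, j)))" using expand[OF we, of "\<lambda>_. 1::real"] by simp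
    also have "\<dots> = (\<Sum>i\<le>n. x1 (e1 i))" using zr W by simp
    also have "\<dots> = 1" using x1(2) by (simp add: sum_V1)
    finally show ?thesis .
  qed
  have first: "fst (\<Sum>c\<in>emb ` s. w c *\<^sub>R c) = p"
  proof -
    have "fst (\<Sum>c\<in>emb ` s. w c *\<^sub>R c) = (\<Sum>c\<in>emb ` s. w c *\<^sub>R fst c)" by (simp add: fst_sum)
    also have "\<dots> = (\<Sum>i\<le>n. \<Sum>j\<le>m. w (emb (i, j)) *\<^sub>R fst (emb (i, j)))" by (rule expand[OF we])
    also have "\<dots> = (\<Sum>i\<le>n. \<Sum>j\<le>m. z (i, j) *\<^sub>R e1 i)" using W by (simp add: emb_def)
    also have "\<dots> = (\<Sum>i\<le>n. x1 (e1 i) *\<^sub>R e1 i)" using zr by (simp flip: scaleR_left.sum)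
    also have "\<dots> = p" using x1(3) sum_V1[of "\<lambda>a. x1 a *\<^sub>R a"] by simp
    finally show ?thesis .
  qed
  have second: "snd (\<Sum>c\<in>emb ` s. w c *\<^sub>R c) = q"
  proof -
    have "snd (\<Sum>c\<in>emb ` s. w c *\<^sub>R c) = (\<Sum>c\<in>emb ` s. w c *\<^sub>R snd c)" by (simp add: snd_sum)
    also have "\<dots> = (\<Sum>i\<le>n. \<Sum>j\<le>m. w (emb (i, j)) *\<^sub>R snd (emb (i, j)))" by (rule expand[OF we])
    also have "\<dots> = (\<Sum>i\<le>n. \<Sum>j\<le>m. z (i, j) *\<^sub>R e2 j)" using W by (simp add: emb_def)
    also have "\<dots> = (\<Sum>j\<le>m. \<Sum>i\<le>n. z (i, j) *\<^sub>R e2 j)" by (rule sum.swap)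
    also have "\<dots> = (\<Sum>j\<le>m. x2 (e2 j) *\<^sub>R e2 j)" using zc by (simp flip: scaleR_left.sum)
    also have "\<dots> = q" using x2(3) sum_V2[of "\<lambda>a. x2 a *\<^sub>R a"] by simp
    finally show ?thesis .
  qed
  have "(\<Sum>c\<in>emb ` s. w c *\<^sub>R c) = y" using first second y by (simp add: prod_eq_iff)
  ultimately have "y \<in> open_simplex (emb ` s)" using total unfolding open_simplex_def by blast
  moreover have "chain (emb ` s)" using chain_emb[OF s(1)] s(2) by simp
  moreover have "emb ` s \<subseteq> V1 \<times> V2" using emb_bij s(1) by (auto simp: bij_betw_def)
  ultimately show ?thesis by blast
qed

lemma carrier_projections:
  assumes s: "s \<subseteq> V1 \<times> V2" and y: "y \<in> open_simplex s"
  shows "fst y \<in> open_simplex (fst ` s)" "snd y \<in> open_simplex (snd ` s)"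
proof -
  obtain z where z: "\<forall>c. 0 < z c \<longleftrightarrow> c \<in> s" "\<forall>c. 0 \<le> z c" "sum z (V1 \<times> V2) = 1" "(\<Sum>c\<in>V1 \<times> V2. z c *\<^sub>R c) = y"
    using open_simplex_weights[OF fin_product assms] by blast
  define x1 where "x1 a = (\<Sum>b\<in>V2. z (a, b))" for a
  define x2 where "x2 b = (\<Sum>a\<in>V1. z (a, b))" for b
  have zero: "z c = 0" if "c \<notin> s" for c using z(1,2) that by (metis order_le_less)
  have p1: "0 < x1 a" if "a \<in> fst ` s" for a
  proof -
    obtain b where b: "(a, b) \<in> s" using \<open>a \<in> fst ` s\<close> by force
    have "z (a, b) \<le> x1 a" unfolding x1_def using b s z(2) fin(2) by (intro member_le_sum) auto
    then show ?thesis using z(1) b by (meson less_le_trans)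
  qed
  have p2: "0 < x2 b" if "b \<in> snd ` s" for b
  proof -
    obtain a where a: "(a, b) \<in> s" using \<open>b \<in> snd ` s\<close> by force
    have "z (a, b) \<le> x2 b" unfolding x2_def using a s z(2) fin(1) 
      by (intro member_le_sum[where f = "\<lambda>a. z (a, b)"]) auto
    then show ?thesis using z(1) a by (meson less_le_trans)
  qed
  have n1: "x1 a = 0" if "a \<notin> fst ` s" for a unfolding x1_def using zero that by (force intro: sum.neutral)
  have n2: "x2 b = 0" if "b \<notin> snd ` s" for b unfolding x2_def using zero that by (force intro: sum.neutral)
  have sub: "fst ` s \<subseteq> V1" "snd ` s \<subseteq> V2" using s by auto
  have "sum x1 (fst ` s) = sum x1 V1" "(\<Sum>a\<in>fst ` s. x1 a *\<^sub>R a) = (\<Sum>a\<in>V1. x1 a *\<^sub>R a)"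
    by (rule sum.mono_neutral_left[OF fin(1) sub(1)]; use n1 in simp)+
  then show "fst y \<in> open_simplex (fst ` s)"
    unfolding open_simplex_def using p1 z(3,4) marginals_fst[of z, folded x1_def] by auto
  have "sum x2 (snd ` s) = sum x2 V2" "(\<Sum>a\<in>snd ` s. x2 a *\<^sub>R a) = (\<Sum>a\<in>V2. x2 a *\<^sub>R a)"
    by (rule sum.mono_neutral_left[OF fin(2) sub(2)]; use n2 in simp)+
  then show "snd y \<in> open_simplex (snd ` s)"
    unfolding open_simplex_def using p2 z(3,4) marginals_snd[of z, folded x2_def] by auto
qed

end

context shuffle_labels begin

definition inversions :: "bool list \<Rightarrow> (nat \<times> nat) set" where
  "inversions w = {(i, j). i \<in> {1..n} \<and> j \<in> {1..m} \<and> prec w i j \<noteq> (v j < u i)}"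

lemma finite_inversions: "finite (inversions w)"
  by (rule finite_subset[of _ "{1..n} \<times> {1..m}"]) (auto simp: inversions_def)

text \<open>
  Where the path of \<open>s\<close> deviates from the labels there is no tie, so every path through the
  vertices of \<open>s\<close> deviates there in the same way. Among these, the path of \<open>s\<close> has the fewest
  inversions, so that sorting the paths by the number of inversions gives a shelling.
\<close>

lemma inversions_mono:
  assumes w: "w \<in> words n m" and w': "w' \<in> words n m"
    and s: "s \<subseteq> lattice_path w" "s \<subseteq> lattice_path w'" "pos w' ` corners w' \<subseteq> s"
  shows "inversions w' \<subseteq> inversions w"
proof
  fix x assume "x \<in> inversions w'"
  then obtain i j where x: "x = (i, j)" and ij: "i \<in> {1..n}" "j \<in> {1..m}" and d: "prec w' i j \<noteq> (v j < u i)"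
    unfolding inversions_def by blast
  have b: "prec w' i j = before s i j" by (rule shuffle_of_chain_forward[OF w' s(2,3) ij])
  have nw: "prec w i j \<longleftrightarrow> \<not> (\<exists>c\<in>lattice_path w. fst c < i \<and> j \<le> snd c)"
    by (rule prec_negative_witness[OF w ij])
  have "(\<exists>c\<in>s. i \<le> fst c \<and> snd c < j) \<or> (\<exists>c\<in>s. fst c < i \<and> j \<le> snd c)"
    using d b unfolding before_def by blast
  then have "prec w i j = prec w' i j"
  proof
    assume "\<exists>c\<in>s. i \<le> fst c \<and> snd c < j"
    then show ?thesis using s unfolding prec_def by blast
  next
    assume "\<exists>c\<in>s. fst c < i \<and> j \<le> snd c"
    then show ?thesis using s nw prec_negative_witness[OF w' ij] by blast
  qed
  then show "x \<in> inversions w" using d ij x by (simp add: inversions_def)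
qed

lemma inversions_inj:
  assumes "w \<in> words n m" "w' \<in> words n m" "inversions w = inversions w'"
  shows "w = w'"
proof (rule word_unique[OF assms(1,2)])
  fix i j assume ij: "i \<in> {1..n}" "j \<in> {1..m}"
  have "(i, j) \<in> inversions w \<longleftrightarrow> (i, j) \<in> inversions w'" using assms(3) by simp
  then show "prec w i j = prec w' i j" using ij by (simp add: inversions_def) blast
qed

end

lemma open_simplex_nonempty:
  assumes "finite V" "V \<noteq> {}"
  shows "open_simplex V \<noteq> {}"
proof -
  have "(\<Sum>c\<in>V. (1 / real (card V)) *\<^sub>R c) \<in> open_simplex V"
    unfolding open_simplex_def using assms
    by (auto intro!: exI[of _ "\<lambda>_. 1 / real (card V)"] simp: card_gt_0_iff)
  then show ?thesis by blast
qed

section \<open>Morse tiles in terms of vertices\<close>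

text \<open>
  A tile given by the vertices of its simplex, the vertices opposite to its removed facets, and
  the vertices of its Morse face. For a single vertex, the hull of the empty set is the empty
  facet.
\<close>

definition simplex_tile :: "'a::euclidean_space set \<Rightarrow> 'a set \<Rightarrow> 'a set \<Rightarrow> 'a morse_tile" where
  "simplex_tile V A M = \<lparr>underlying = convex hull V, removed = (\<lambda>v. convex hull (V - {v})) ` A, morse_face = convex hull M\<rparr>"

definition tile_data :: "'a::euclidean_space set \<Rightarrow> 'a set \<Rightarrow> 'a set \<Rightarrow> bool" where
  "tile_data V A M \<longleftrightarrow> finite V \<and> \<not> affine_dependent V \<and> V \<noteq> {} \<and> A \<subseteq> V \<and> M \<subseteq> V \<and>
     (M \<noteq> {} \<longrightarrow> A \<noteq> {} \<and> A \<subseteq> M \<and> card M + 2 \<le> card V)"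

lemma aff_dim_hull: "\<not> affine_dependent V \<Longrightarrow> aff_dim (convex hull V) = int (card V) - 1"
  for V :: "'a::euclidean_space set"
  by (simp add: aff_dim_convex_hull aff_dim_affine_independent)

lemma hull_subset_iff:
  fixes V :: "'a::euclidean_space set"
  assumes "\<not> affine_dependent V" "C \<subseteq> V" "D \<subseteq> V"
  shows "convex hull C \<subseteq> convex hull D \<longleftrightarrow> C \<subseteq> D"
proof
  assume sub: "convex hull C \<subseteq> convex hull D"
  have fV: "finite V" using assms(1) by (rule aff_independent_finite)
  show "C \<subseteq> D"
  proof
    fix c assume c: "c \<in> C"
    have "c \<in> convex hull D" using sub hull_inc[OF c, of convex] by auto
    moreover have "{c} \<subseteq> V" using c assms(2) by auto
    ultimately have "{c} \<subseteq> D" using open_simplex_in_hull_iff[OF fV assms(1) _ assms(3) open_simplex_singleton] by blast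
    then show "c \<in> D" by simp
  qed
qed (rule hull_mono)

lemma tile_data_facts:
  assumes "tile_data V A M"
  shows "is_morse_tile (simplex_tile V A M)" "tile_order (simplex_tile V A M) = card A" "tile_dim (simplex_tile V A M) = card V - 1"
proof -
  have V: "finite V" "\<not> affine_dependent V" "V \<noteq> {}" "A \<subseteq> V" "M \<subseteq> V"
    and M: "M \<noteq> {} \<Longrightarrow> A \<noteq> {} \<and> A \<subseteq> M \<and> card M + 2 \<le> card V"
    using assms by (auto simp: tile_data_def)
  have indep: "\<not> affine_dependent C" if "C \<subseteq> V" for C using V(2) that affine_dependent_subset by blast
  have cV: "0 < card V" using V by (simp add: card_gt_0_iff)
  have dimV: "aff_dim (convex hull V) = int (card V) - 1" by (rule aff_dim_hull[OF V(2)])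
  have inj: "inj_on (\<lambda>v. convex hull (V - {v})) A"
  proof (rule inj_onI)
    fix v w assume vw: "v \<in> A" "w \<in> A" "convex hull (V - {v}) = convex hull (V - {w})"
    have "V - {v} \<subseteq> V - {w}" using hull_subset_iff[OF V(2), of "V - {v}" "V - {w}"] vw by auto
    then show "v = w" using vw V(4) by blast
  qed
  show "tile_order (simplex_tile V A M) = card A" by (simp add: tile_order_def simplex_tile_def card_image[OF inj])
  show "tile_dim (simplex_tile V A M) = card V - 1"
    using cV by (simp add: tile_dim_def simplex_tile_def dimV nat_diff_distrib')
  have s: "int (card V - 1) simplex convex hull V"
    unfolding simplex using V cV by (intro exI[of _ V]) (simp add: of_nat_diff)
  have facet: "simplex_facet (convex hull (V - {v})) (convex hull V)" if "v \<in> A" for v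
  proof -
    have "convex hull (V - {v}) face_of convex hull V"
      unfolding face_of_convex_hull_affine_independent[OF V(2)] by blast
    moreover have "aff_dim (convex hull (V - {v})) = int (card (V - {v})) - 1"
      by (rule aff_dim_hull[OF indep]) blast
    moreover have "int (card (V - {v})) = int (card V) - 1"
      using that V cV by (subst card_Diff_singleton) (auto simp: of_nat_diff)
    ultimately show ?thesis unfolding simplex_facet_def dimV by simp
  qed
  have mf: "removed (simplex_tile V A M) \<noteq> {} \<and> convex hull M face_of convex hull V \<and>
      aff_dim (convex hull M) \<le> aff_dim (convex hull V) - 2 \<and> (\<forall>F\<in>removed (simplex_tile V A M). \<not> convex hull M \<subseteq> F)"
    if "convex hull M \<noteq> {}"
  proof (intro conjI)
    have M': "A \<noteq> {}" "A \<subseteq> M" "card M + 2 \<le> card V" using M that by auto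
    show "removed (simplex_tile V A M) \<noteq> {}" using M'(1) by (simp add: simplex_tile_def)
    show "convex hull M face_of convex hull V"
      unfolding face_of_convex_hull_affine_independent[OF V(2)] using V(5) by blast
    show "aff_dim (convex hull M) \<le> aff_dim (convex hull V) - 2"
      unfolding dimV aff_dim_hull[OF indep[OF V(5)]] using M'(3) by linarith
    show "\<forall>F\<in>removed (simplex_tile V A M). \<not> convex hull M \<subseteq> F"
    proof
      fix F assume "F \<in> removed (simplex_tile V A M)"
      then obtain v where v: "v \<in> A" "F = convex hull (V - {v})" by (auto simp: simplex_tile_def)
      then have "\<not> M \<subseteq> V - {v}" using M'(2) by blast
      then show "\<not> convex hull M \<subseteq> F" unfolding v(2) using hull_subset_iff[OF V(2,5), of "V - {v}"] by blast
    qed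
  qed
  show "is_morse_tile (simplex_tile V A M)"
    unfolding is_morse_tile_def using s facet mf by (auto simp: simplex_tile_def)
qed

lemma morse_tile_data:
  assumes t: "is_morse_tile t"
  shows "\<exists>A. tile_data (vertices (underlying t)) A (vertices (morse_face t)) \<and>
    t = simplex_tile (vertices (underlying t)) A (vertices (morse_face t))"
proof -
  obtain N :: nat where "int N simplex underlying t" using t by (auto simp: is_morse_tile_def)
  then obtain V where V: "finite V" "\<not> affine_dependent V" "int (card V) = int N + 1" "underlying t = convex hull V"
    unfolding simplex by blast
  have VV: "vertices (underlying t) = V" using vertices_hull[OF V(2)] V(4) by simp
  have indep: "\<not> affine_dependent C" if "C \<subseteq> V" for C using V(2) that affine_dependent_subset by blast
  have V0: "V \<noteq> {}" using V(3) by auto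
  have dimV: "aff_dim (convex hull V) = int (card V) - 1" by (rule aff_dim_hull[OF V(2)])
  define A where "A = {v\<in>V. convex hull (V - {v}) \<in> removed t}"
  have rem: "\<exists>v\<in>A. F = convex hull (V - {v})" if F: "F \<in> removed t" for F
  proof -
    have f: "F face_of convex hull V" "aff_dim F = aff_dim (convex hull V) - 1"
      using t F V(4) by (auto simp: is_morse_tile_def simplex_facet_def)
    obtain C where C: "C \<subseteq> V" "F = convex hull C"
      using f(1) unfolding face_of_convex_hull_affine_independent[OF V(2)] by blast
    have "int (card C) = int (card V) - 1" using f(2) aff_dim_hull[OF indep[OF C(1)]] C(2) dimV by simp
    then have "card (V - C) = 1"
      using card_Diff_subset[OF finite_subset[OF C(1) V(1)] C(1)] card_mono[OF V(1) C(1)] by linarith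
    then obtain v where v: "V - C = {v}" by (auto simp: card_1_singleton_iff)
    then have "C = V - {v}" "v \<in> V" using C(1) by auto
    then show ?thesis using F C(2) by (auto simp: A_def)
  qed
  then have remA: "removed t = (\<lambda>v. convex hull (V - {v})) ` A" by (auto simp: A_def)
  define M where "M = vertices (morse_face t)"
  have M: "M \<subseteq> V \<and> morse_face t = convex hull M"
  proof (cases "morse_face t = {}")
    case True
    then show ?thesis by (simp add: M_def vertices_def)
  next
    case False
    then have "morse_face t face_of convex hull V" using t V(4) by (auto simp: is_morse_tile_def)
    then obtain C where C: "C \<subseteq> V" "morse_face t = convex hull C"
      unfolding face_of_convex_hull_affine_independent[OF V(2)] by blast
    then have "M = C" unfolding M_def using vertices_hull[OF indep[OF C(1)]] by simp
    then show ?thesis using C by simp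
  qed
  have "A \<noteq> {} \<and> A \<subseteq> M \<and> card M + 2 \<le> card V" if "M \<noteq> {}"
  proof -
    have "morse_face t \<noteq> {}" using that M by auto
    then have f: "removed t \<noteq> {}" "aff_dim (morse_face t) \<le> aff_dim (underlying t) - 2"
      "\<forall>F\<in>removed t. \<not> morse_face t \<subseteq> F"
      using t by (auto simp: is_morse_tile_def)
    have "A \<noteq> {}" using f(1) remA by simp
    moreover have "A \<subseteq> M"
    proof
      fix v assume v: "v \<in> A"
      then have "\<not> convex hull M \<subseteq> convex hull (V - {v})" using f(3) M by (auto simp: A_def)
      then have "\<not> M \<subseteq> V - {v}" using hull_mono by blast
      then show "v \<in> M" using M by blast
    qed
    moreover have "aff_dim (morse_face t) = int (card M) - 1" using M aff_dim_hull indep by metis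
    ultimately show ?thesis using f(2) V(4) dimV by simp
  qed
  then have "tile_data V A M" using V V0 M by (auto simp: tile_data_def A_def)
  moreover have "t = simplex_tile V A M" using V(4) remA M by (simp add: simplex_tile_def)
  ultimately show ?thesis unfolding VV M_def by blast
qed

text \<open>
  A point is in a face if and only if its carrier consists of vertices of this face.
\<close>

lemma mem_simplex_tile:
  assumes "tile_data V A M" "s \<subseteq> V" "s \<noteq> {}" "y \<in> open_simplex s"
  shows "y \<in> tile_set (simplex_tile V A M) \<longleftrightarrow> A \<subseteq> s \<and> \<not> s \<subseteq> M"
proof -
  have V: "finite V" "\<not> affine_dependent V" "A \<subseteq> V" "M \<subseteq> V" using assms(1) by (auto simp: tile_data_def)
  note iff = open_simplex_in_hull_iff[OF V(1,2) assms(2) _ assms(4)]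
  have "y \<in> convex hull V" using iff[of V] assms(2) by simp
  moreover have "y \<in> convex hull (V - {v}) \<longleftrightarrow> v \<notin> s" for v using iff[of "V - {v}"] assms(2) by blast
  moreover have "y \<in> convex hull M \<longleftrightarrow> s \<subseteq> M" using iff[OF V(4)] .
  ultimately show ?thesis unfolding tile_set_def simplex_tile_def by auto
qed

lemma tile_set_nonempty:
  assumes "is_morse_tile t"
  shows "tile_set t \<noteq> {}"
proof -
  obtain V A M where d: "tile_data V A M" "t = simplex_tile V A M" using morse_tile_data[OF assms] by blast
  then have V: "finite V" "V \<noteq> {}" "A \<subseteq> V" "M \<subseteq> V" and M: "M \<noteq> {} \<Longrightarrow> card M + 2 \<le> card V"
    by (auto simp: tile_data_def)
  obtain y where y: "y \<in> open_simplex V" using open_simplex_nonempty[OF V(1,2)] by blast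
  have "\<not> V \<subseteq> M"
  proof
    assume "V \<subseteq> M"
    then have "M = V" using V by blast
    then show False using M V by simp
  qed
  then have "y \<in> tile_set t" using mem_simplex_tile[OF d(1) subset_refl V(2) y] V(3) d(2) by blast
  then show ?thesis by blast
qed

section \<open>Oriented tiles as index patterns\<close>

text \<open>
  The second condition of tameness, for a single tile.
\<close>

definition oriented_tile :: "('a::euclidean_space \<times> 'a) set \<Rightarrow> 'a morse_tile \<Rightarrow> bool" where
  "oriented_tile R t \<longleftrightarrow> (morse_face t \<noteq> {} \<longrightarrow>
     (\<forall>v w. v extreme_point_of underlying t \<and> v \<notin> morse_face t \<and> w extreme_point_of morse_face t \<longrightarrow> (v, w) \<in> R))"

text \<open>
  All edges between the Morse face and the other vertices point to the Morse face, so its vertices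
  are the last ones.
\<close>

lemma tile_pattern:
  fixes t :: "'a::euclidean_space morse_tile"
  assumes t: "is_morse_tile t" "oriented_tile R t"
    and e: "bij_betw e {..n} (vertices (underlying t))" "\<forall>i\<le>n. \<forall>j\<le>n. (e i, e j) \<in> R \<longleftrightarrow> i < j"
  shows "\<exists>I p. pattern n I p \<and> card I = tile_order t \<and>
    (\<forall>r y. r \<noteq> {} \<and> r \<subseteq> {..n} \<and> y \<in> open_simplex (e ` r) \<longrightarrow> (y \<in> tile_set t \<longleftrightarrow> meets I p r))"
proof -
  define V where "V = vertices (underlying t)"
  define M where "M = vertices (morse_face t)"
  obtain A where d: "tile_data V A M" and tm: "t = simplex_tile V A M"
    using morse_tile_data[OF t(1)] unfolding V_def M_def by blast
  have VA: "finite V" "\<not> affine_dependent V" "A \<subseteq> V" "M \<subseteq> V"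
    and MA: "M \<noteq> {} \<Longrightarrow> A \<noteq> {} \<and> A \<subseteq> M \<and> card M + 2 \<le> card V"
    using d by (auto simp: tile_data_def)
  have eV: "e ` {..n} = V" "inj_on e {..n}" using e(1) by (auto simp: bij_betw_def V_def)
  have cV: "card V = Suc n" using card_image[OF eV(2)] eV(1) by simp
  define I where "I = {i. i \<le> n \<and> e i \<in> A}"
  define L where "L = {i. i \<le> n \<and> e i \<in> M}"
  have idx: "\<exists>i\<le>n. v = e i" if "v \<in> V" for v using that eV(1) by blast
  have eI: "e ` I = A" using idx VA(3) by (auto simp: I_def)
  have eL: "e ` L = M" using idx VA(4) by (auto simp: L_def)
  have inj: "inj_on e I" "inj_on e L" using eV(2) by (auto simp: I_def L_def inj_on_def)
  have cI: "card I = tile_order t" using card_image[OF inj(1)] eI tile_data_facts(2)[OF d] tm by simp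
  have cL: "card L = card M" using card_image[OF inj(2)] eL by simp
  define p where "p = (if M = {} then Suc n else Min L)"
  have finL: "finite L" unfolding L_def by simp
  have Lp: "L = {p..n}"
  proof (cases "M = {}")
    case True
    then show ?thesis by (simp add: L_def p_def)
  next
    case False
    then have L0: "L \<noteq> {}" using eL by auto
    have pL: "p \<in> L" unfolding p_def using False Min_in[OF finL L0] by simp
    have up: "i \<in> L" if "p \<le> i" "i \<le> n" for i
    proof (rule ccontr)
      assume "i \<notin> L"
      then have ne: "e i \<notin> M" using that by (simp add: L_def)
      have ei: "e i \<in> V" using eV(1) that(2) by blast
      have "e i \<notin> morse_face t"
      proof
        assume "e i \<in> morse_face t"
        then have "e i \<in> convex hull M" using tm by (simp add: simplex_tile_def)
        then have "{e i} \<subseteq> M" using open_simplex_in_hull_iff[OF VA(1,2) _ VA(4) open_simplex_singleton, of "e i"] ei by blast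
        then show False using ne by simp
      qed
      moreover have "morse_face t \<noteq> {}" using False by (auto simp: M_def vertices_def)
      moreover have "e i extreme_point_of underlying t" using ei by (simp add: V_def vertices_def)
      moreover have "e p extreme_point_of morse_face t" using pL by (simp add: L_def M_def vertices_def)
      ultimately have "(e i, e p) \<in> R" using t(2) by (auto simp: oriented_tile_def)
      then have "i < p" using e(2) that pL by (auto simp: L_def)
      then show False using that by simp
    qed
    have low: "p \<le> i \<and> i \<le> n" if "i \<in> L" for i
      using that Min_le[OF finL that] False by (simp add: p_def L_def)
    show ?thesis
    proof (rule set_eqI)
      fix i
      show "i \<in> L \<longleftrightarrow> i \<in> {p..n}" using up[of i] low[of i] by (meson atLeastAtMost_iff)
    qed
  qed
  have "pattern n I p"
  proof (cases "M = {}")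
    case True
    then show ?thesis by (auto simp: pattern_def p_def I_def)
  next
    case False
    have "card L + 2 \<le> Suc n" "L \<noteq> {}" "I \<noteq> {}" using MA[OF False] cL cV eL eI False by auto
    moreover have "I \<subseteq> L" using MA[OF False] by (auto simp: I_def L_def)
    ultimately show ?thesis unfolding Lp by (auto simp: pattern_def I_def)
  qed
  moreover have "y \<in> tile_set t \<longleftrightarrow> meets I p r" if r: "r \<noteq> {}" "r \<subseteq> {..n}" and y: "y \<in> open_simplex (e ` r)" for r y
  proof -
    have "e ` r \<subseteq> V" "e ` r \<noteq> {}" using r eV(1) by auto
    then have "y \<in> tile_set t \<longleftrightarrow> A \<subseteq> e ` r \<and> \<not> e ` r \<subseteq> M" using mem_simplex_tile[OF d _ _ y] tm by simp
    moreover have "A \<subseteq> e ` r \<longleftrightarrow> I \<subseteq> r"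
      unfolding eI[symmetric] by (rule inj_on_image_subset_iff[OF eV(2)]) (use r in \<open>auto simp: I_def\<close>)
    moreover have "e ` r \<subseteq> M \<longleftrightarrow> r \<subseteq> L"
      unfolding eL[symmetric] by (rule inj_on_image_subset_iff[OF eV(2)]) (use r in \<open>auto simp: L_def\<close>)
    moreover have "r \<subseteq> L \<longleftrightarrow> \<not> (\<exists>i\<in>r. i < p)" unfolding Lp using r(2) by (auto simp: not_less)
    ultimately show ?thesis by (simp add: meets_def)
  qed
  ultimately show ?thesis using cI by blast
qed

context ordered_complexes begin

section \<open>The staircase triangulation\<close>

text \<open>
  The empty chain is included, since a simplicial complex contains the empty face of its
  simplices.
\<close>

definition chains :: "('a \<times> 'b) set set" where
  "chains = {s. chain s \<and> (\<exists>S1\<in>K1. \<exists>S2\<in>K2. s \<subseteq> vertices S1 \<times> vertices S2)}"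

definition staircase :: "('a \<times> 'b) set set" where
  "staircase = (\<lambda>s. convex hull s) ` chains"

definition orientation :: "(('a \<times> 'b) \<times> ('a \<times> 'b)) set" where
  "orientation = {(c, c'). c \<noteq> c' \<and> below c c' \<and> {c, c'} \<in> chains}"

lemma enumerate_pair:
  assumes "S1 \<in> K1" "S2 \<in> K2" "vertices S1 \<noteq> {}" "vertices S2 \<noteq> {}"
  shows "\<exists>n m e1 e2. enumerated_pair K1 R1 K2 R2 S1 S2 n m e1 e2"
proof -
  have "card (vertices S1) \<noteq> 0" "card (vertices S2) \<noteq> 0"
    using c1.simplex_facts(1)[OF assms(1)] c2.simplex_facts(1)[OF assms(2)] assms(3,4) by simp_all
  then obtain n m where nm: "card (vertices S1) = Suc n" "card (vertices S2) = Suc m" by (meson not0_implies_Suc)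
  obtain e1 where e1: "bij_betw e1 {..n} (vertices S1)" "\<forall>i\<le>n. \<forall>j\<le>n. (e1 i, e1 j) \<in> R1 \<longleftrightarrow> i < j"
    using c1.order_enumeration[OF assms(1) nm(1)] by blast
  obtain e2 where e2: "bij_betw e2 {..m} (vertices S2)" "\<forall>i\<le>m. \<forall>j\<le>m. (e2 i, e2 j) \<in> R2 \<longleftrightarrow> i < j"
    using c2.order_enumeration[OF assms(2) nm(2)] by blast
  have "enumerated_pair K1 R1 K2 R2 S1 S2 n m e1 e2"
    by unfold_locales (use assms e1 e2 in auto)
  then show ?thesis by blast
qed

lemma chains_subset: "s \<in> chains \<Longrightarrow> s' \<subseteq> s \<Longrightarrow> s' \<in> chains"
  unfolding chains_def using chain_subset by blast

lemma chain_pair: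
  assumes "S1 \<in> K1" "S2 \<in> K2" "s \<subseteq> vertices S1 \<times> vertices S2" "s \<noteq> {}"
  shows "\<exists>n m e1 e2. enumerated_pair K1 R1 K2 R2 S1 S2 n m e1 e2"
  by (rule enumerate_pair[OF assms(1,2)]) (use assms(3,4) in auto)

lemma chains_finite: "s \<in> chains \<Longrightarrow> finite s"
  unfolding chains_def using c1.simplex_facts(1) c2.simplex_facts(1) finite_subset by blast

lemma chains_independent:
  assumes "s \<in> chains" shows "\<not> affine_dependent s"
proof (cases "s = {}")
  case False
  obtain S1 S2 where S: "S1 \<in> K1" "S2 \<in> K2" "s \<subseteq> vertices S1 \<times> vertices S2" "chain s"
    using assms by (auto simp: chains_def)
  obtain n m e1 e2 where "enumerated_pair K1 R1 K2 R2 S1 S2 n m e1 e2" using chain_pair[OF S(1-3) False] by blast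
  then show ?thesis by (rule enumerated_pair.chain_affine_independent[OF _ S(3,4)])
qed simp

lemma open_simplex_projections:
  assumes S: "S1 \<in> K1" "S2 \<in> K2" "s \<subseteq> vertices S1 \<times> vertices S2" and y: "y \<in> open_simplex s"
  shows "fst y \<in> open_simplex (fst ` s)" "snd y \<in> open_simplex (snd ` s)" "fst y \<in> S1" "snd y \<in> S2"
proof -
  have ne: "s \<noteq> {}" using y by auto
  obtain n m e1 e2 where "enumerated_pair K1 R1 K2 R2 S1 S2 n m e1 e2" using chain_pair[OF S ne] by blast
  then interpret enumerated_pair K1 R1 K2 R2 S1 S2 n m e1 e2 .
  show f: "fst y \<in> open_simplex (fst ` s)" and g: "snd y \<in> open_simplex (snd ` s)" using carrier_projections[OF S(3) y] .
  have "fst ` s \<subseteq> V1" "snd ` s \<subseteq> V2" using S(3) by auto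
  then have "open_simplex (fst ` s) \<subseteq> S1" "open_simplex (snd ` s) \<subseteq> S2"
    using open_simplex_subset_hull[OF finite_subset[OF _ fin(1)]] open_simplex_subset_hull[OF finite_subset[OF _ fin(2)]]
      hull_mono[of "fst ` s" V1 convex] hull_mono[of "snd ` s" V2 convex] hull by (metis subset_trans)+
  then show "fst y \<in> S1" "snd y \<in> S2" using f g by auto
qed

lemma carrier_in_cell:
  assumes s: "s \<in> chains" and y: "y \<in> open_simplex s" and S: "S1 \<in> K1" "S2 \<in> K2" "y \<in> S1 \<times> S2"
  shows "s \<subseteq> vertices S1 \<times> vertices S2"
proof -
  obtain U1 U2 where U: "U1 \<in> K1" "U2 \<in> K2" "s \<subseteq> vertices U1 \<times> vertices U2" using s by (auto simp: chains_def)
  note p = open_simplex_projections[OF U y]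
  have sub: "fst ` s \<subseteq> vertices U1" "snd ` s \<subseteq> vertices U2" using U(3) by auto
  have yS: "fst y \<in> S1" "snd y \<in> S2" using S(3) by auto
  have "fst ` s \<subseteq> vertices S1" by (rule carrier_in_simplex[OF c1.complex U(1) S(1) sub(1) p(1) yS(1)])
  moreover have "snd ` s \<subseteq> vertices S2" by (rule carrier_in_simplex[OF c2.complex U(2) S(2) sub(2) p(2) yS(2)])
  ultimately have proj: "\<And>c. c \<in> s \<Longrightarrow> fst c \<in> vertices S1 \<and> snd c \<in> vertices S2" by blast
  show ?thesis
  proof
    fix c assume "c \<in> s"
    then show "c \<in> vertices S1 \<times> vertices S2" using proj by (simp add: mem_Times_iff)
  qed
qed

text \<open>
  Both carriers lie in one cell, because the projections of the point have unique carriers in the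
  two complexes.
\<close>

lemma carrier_unique:
  assumes s: "s \<in> chains" "y \<in> open_simplex s" and s': "s' \<in> chains" "y \<in> open_simplex s'"
  shows "s = s'"
proof -
  obtain S1 S2 where S: "S1 \<in> K1" "S2 \<in> K2" "s' \<subseteq> vertices S1 \<times> vertices S2" "chain s'"
    using s' by (auto simp: chains_def)
  have ne: "s' \<noteq> {}" using s' by auto
  have "y \<in> S1 \<times> S2" using open_simplex_projections(3,4)[OF S(1-3) s'(2)] by (simp add: mem_Times_iff)
  then have "s \<subseteq> vertices S1 \<times> vertices S2" using carrier_in_cell[OF s S(1,2)] by simp
  moreover have "chain s" using s(1) by (simp add: chains_def)
  moreover obtain n m e1 e2 where "enumerated_pair K1 R1 K2 R2 S1 S2 n m e1 e2" using chain_pair[OF S(1-3) ne] by blast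
  ultimately show ?thesis using enumerated_pair.chain_carrier_unique s(2) S(3,4) s'(2) by metis
qed

lemma carrier_in_chain_iff:
  assumes "s \<in> chains" "y \<in> open_simplex s" "C \<in> chains"
  shows "y \<in> convex hull C \<longleftrightarrow> s \<subseteq> C"
proof
  assume "y \<in> convex hull C"
  then obtain s' where s': "s' \<subseteq> C" "y \<in> open_simplex s'" using hull_carrier[OF chains_finite[OF assms(3)]] by blast
  then have "s = s'" using carrier_unique[OF assms(1,2)] chains_subset[OF assms(3)] by blast
  then show "s \<subseteq> C" using s'(1) by simp
next
  assume "s \<subseteq> C"
  then have "convex hull s \<subseteq> convex hull C" by (rule hull_mono)
  then show "y \<in> convex hull C" using open_simplex_subset_hull[OF chains_finite[OF assms(1)]] assms(2) by auto
qed

lemma carrier_exists: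
  assumes "S1 \<in> K1" "S2 \<in> K2" "y \<in> S1 \<times> S2"
  shows "\<exists>s\<in>chains. s \<subseteq> vertices S1 \<times> vertices S2 \<and> y \<in> open_simplex s"
proof -
  have ne: "vertices S1 \<noteq> {}" "vertices S2 \<noteq> {}"
    using assms(3) c1.simplex_facts(3)[OF assms(1)] c2.simplex_facts(3)[OF assms(2)]
    by (metis convex_hull_empty mem_Times_iff empty_iff)+
  obtain n m e1 e2 where ep: "enumerated_pair K1 R1 K2 R2 S1 S2 n m e1 e2"
    using enumerate_pair[OF assms(1,2) ne] by blast
  obtain s where s: "s \<subseteq> vertices S1 \<times> vertices S2" "chain s" "y \<in> open_simplex s"
    using enumerated_pair.chain_carrier_exists[OF ep assms(3)] by blast
  have "s \<in> chains" unfolding chains_def using s(1,2) assms(1,2) by blast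
  then show ?thesis using s by blast
qed

lemma chain_hull_in_cell:
  assumes "S1 \<in> K1" "S2 \<in> K2" "s \<subseteq> vertices S1 \<times> vertices S2"
  shows "convex hull s \<subseteq> S1 \<times> S2"
proof -
  have "convex hull s \<subseteq> convex hull (vertices S1 \<times> vertices S2)" using assms(3) by (rule hull_mono)
  also have "\<dots> = S1 \<times> S2"
    unfolding convex_hull_Times using c1.simplex_facts(3)[OF assms(1)] c2.simplex_facts(3)[OF assms(2)] by simp
  finally show ?thesis .
qed

lemma finite_chains: "finite chains"
proof -
  have "finite K1" "finite K2" using c1.complex c2.complex by (auto simp: simplicial_complex_def)
  then have "finite ((\<Union>S\<in>K1. vertices S) \<times> (\<Union>S\<in>K2. vertices S))"
    using c1.simplex_facts(1) c2.simplex_facts(1) by blast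
  moreover have "chains \<subseteq> Pow ((\<Union>S\<in>K1. vertices S) \<times> (\<Union>S\<in>K2. vertices S))" by (auto simp: chains_def)
  ultimately show ?thesis using finite_subset by blast
qed

lemma staircase_complex: "simplicial_complex staircase"
  unfolding simplicial_complex_def
proof (intro conjI ballI allI impI)
  show "finite staircase" unfolding staircase_def using finite_chains by simp
next
  fix S assume "S \<in> staircase"
  then obtain s where s: "s \<in> chains" "S = convex hull s" by (auto simp: staircase_def)
  show "\<exists>n. n simplex S" unfolding simplex
    using chains_finite[OF s(1)] chains_independent[OF s(1)] s(2) by (intro exI[of _ "int (card s) - 1"] exI[of _ s]) simp
next
  fix F S assume "S \<in> staircase \<and> F face_of S"
  then obtain s where s: "s \<in> chains" "F face_of convex hull s" by (auto simp: staircase_def)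
  then obtain c where "c \<subseteq> s" "F = convex hull c"
    unfolding face_of_convex_hull_affine_independent[OF chains_independent[OF s(1)]] by blast
  then show "F \<in> staircase" using chains_subset[OF s(1)] by (auto simp: staircase_def)
next
  fix S S' assume "S \<in> staircase \<and> S' \<in> staircase"
  then obtain s s' where s: "s \<in> chains" "S = convex hull s" "s' \<in> chains" "S' = convex hull s'"
    by (auto simp: staircase_def)
  have "S \<inter> S' \<subseteq> convex hull (s \<inter> s')"
  proof
    fix y assume y: "y \<in> S \<inter> S'"
    then obtain r where r: "r \<subseteq> s" "y \<in> open_simplex r" using hull_carrier[OF chains_finite[OF s(1)]] s(2) by blast
    have rc: "r \<in> chains" using chains_subset[OF s(1) r(1)] .
    have "r \<subseteq> s'" using carrier_in_chain_iff[OF rc r(2) s(3)] y s(4) by blast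
    then have "r \<subseteq> s \<inter> s'" using r(1) by blast
    moreover have "s \<inter> s' \<in> chains" using chains_subset[OF s(1)] by blast
    ultimately show "y \<in> convex hull (s \<inter> s')" using carrier_in_chain_iff[OF rc r(2)] by blast
  qed
  moreover have "convex hull (s \<inter> s') \<subseteq> S \<inter> S'" unfolding s(2,4) by (simp add: hull_mono)
  ultimately have "S \<inter> S' = convex hull (s \<inter> s')" by blast
  then show "S \<inter> S' face_of S"
    unfolding s(2) face_of_convex_hull_affine_independent[OF chains_independent[OF s(1)]] by blast
qed

lemma cell_union:
  assumes "S1 \<in> K1" "S2 \<in> K2"
  shows "S1 \<times> S2 = \<Union> ((\<lambda>s. convex hull s) ` {s\<in>chains. s \<subseteq> vertices S1 \<times> vertices S2})"
proof
  show "S1 \<times> S2 \<subseteq> \<Union> ((\<lambda>s. convex hull s) ` {s\<in>chains. s \<subseteq> vertices S1 \<times> vertices S2})"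
  proof
    fix y assume "y \<in> S1 \<times> S2"
    then obtain s where s: "s \<in> chains" "s \<subseteq> vertices S1 \<times> vertices S2" "y \<in> open_simplex s"
      using carrier_exists[OF assms] by blast
    then have "y \<in> convex hull s" using open_simplex_subset_hull[OF chains_finite[OF s(1)]] by auto
    then show "y \<in> \<Union> ((\<lambda>s. convex hull s) ` {s\<in>chains. s \<subseteq> vertices S1 \<times> vertices S2})" using s by blast
  qed
  show "\<Union> ((\<lambda>s. convex hull s) ` {s\<in>chains. s \<subseteq> vertices S1 \<times> vertices S2}) \<subseteq> S1 \<times> S2"
    using chain_hull_in_cell[OF assms] by blast
qed

lemma union_staircase: "\<Union>staircase = \<Union>K1 \<times> \<Union>K2"
proof
  show "\<Union>staircase \<subseteq> \<Union>K1 \<times> \<Union>K2"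
  proof
    fix y assume "y \<in> \<Union>staircase"
    then obtain s S1 S2 where "y \<in> convex hull s" "S1 \<in> K1" "S2 \<in> K2" "s \<subseteq> vertices S1 \<times> vertices S2"
      by (auto simp: staircase_def chains_def)
    then show "y \<in> \<Union>K1 \<times> \<Union>K2" using chain_hull_in_cell by blast
  qed
  show "\<Union>K1 \<times> \<Union>K2 \<subseteq> \<Union>staircase"
  proof
    fix y assume "y \<in> \<Union>K1 \<times> \<Union>K2"
    then obtain S1 S2 where "S1 \<in> K1" "S2 \<in> K2" "y \<in> S1 \<times> S2" by auto
    then show "y \<in> \<Union>staircase" using cell_union[of S1 S2] unfolding staircase_def by blast
  qed
qed

lemma staircase_primitive: "primitive_triangulation (product_complex K1 K2) staircase"
  unfolding primitive_triangulation_def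
proof (intro conjI ballI)
  show "simplicial_complex staircase" by (rule staircase_complex)
  show "\<Union>staircase = \<Union>(product_complex K1 K2)"
    unfolding union_staircase product_complex_def by blast
  show "\<exists>U\<subseteq>staircase. C = \<Union>U" if C: "C \<in> product_complex K1 K2" for C
  proof -
    obtain S1 S2 where S: "S1 \<in> K1" "S2 \<in> K2" "C = S1 \<times> S2" using C by (auto simp: product_complex_def)
    show ?thesis unfolding S(3) cell_union[OF S(1,2)]
      by (intro exI[of _ "(\<lambda>s. convex hull s) ` {s\<in>chains. s \<subseteq> vertices S1 \<times> vertices S2}"]) (auto simp: staircase_def)
  qed
  show "complex_vertices staircase = complex_vertices (product_complex K1 K2)"
  proof (intro equalityI subsetI)
    fix v assume "v \<in> complex_vertices staircase"
    then obtain s S1 S2 where s: "{v} = convex hull s" "S1 \<in> K1" "S2 \<in> K2" "s \<subseteq> vertices S1 \<times> vertices S2"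
      by (auto simp: complex_vertices_def staircase_def chains_def)
    have "s \<subseteq> {v}" unfolding s(1) by (rule hull_subset)
    moreover have "s \<noteq> {}" using s(1) by auto
    ultimately have "v \<in> s" by blast
    then have "fst v \<in> vertices S1" "snd v \<in> vertices S2" using s(4) by auto
    then have "{fst v} \<in> K1" "{snd v} \<in> K2"
      using complex_subface(1)[OF c1.complex s(2), of "{fst v}"] complex_subface(1)[OF c2.complex s(3), of "{snd v}"]
      by simp_all
    moreover have "{v} = {fst v} \<times> {snd v}" by auto
    ultimately show "v \<in> complex_vertices (product_complex K1 K2)"
      unfolding complex_vertices_def product_complex_def by blast
  next
    fix v assume "v \<in> complex_vertices (product_complex K1 K2)"
    then obtain S1 S2 where S: "{v} = S1 \<times> S2" "S1 \<in> K1" "S2 \<in> K2"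
      by (auto simp: complex_vertices_def product_complex_def)
    have m: "fst v \<in> S1" "snd v \<in> S2" using S(1) by (metis insertI1 mem_Times_iff)+
    have "S1 = {fst v}" "S2 = {snd v}"
    proof -
      have "a = fst v" if "a \<in> S1" for a
      proof -
        have "(a, snd v) \<in> {v}" unfolding S(1) using that m by simp
        then show ?thesis by (metis fst_conv singletonD)
      qed
      then show "S1 = {fst v}" using m by blast
      have "a = snd v" if "a \<in> S2" for a
      proof -
        have "(fst v, a) \<in> {v}" unfolding S(1) using that m by simp
        then show ?thesis by (metis snd_conv singletonD)
      qed
      then show "S2 = {snd v}" using m by blast
    qed
    then have "{v} \<subseteq> vertices S1 \<times> vertices S2" by (simp add: vertices_def mem_Times_iff)
    moreover have "chain {v}" by (simp add: chain_def below_def)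
    ultimately have "{v} \<in> chains" unfolding chains_def using S(2,3) by blast
    then have "convex hull {v} \<in> staircase" unfolding staircase_def by (rule imageI)
    then show "v \<in> complex_vertices staircase" by (simp add: complex_vertices_def)
  qed
qed

end

section \<open>The product of two tiles\<close>

lemma sorted_prefix_downward:
  fixes f :: "'a \<Rightarrow> nat"
  assumes "sorted (map f ws)" "w \<in> set (take k ws)" "w' \<in> set ws" "f w' < f w"
  shows "w' \<in> set (take k ws)"
proof -
  obtain i where i: "i < k" "i < length ws" "w = ws ! i" using assms(2) by (auto simp: in_set_conv_nth)
  obtain j where j: "j < length ws" "w' = ws ! j" using assms(3) by (auto simp: in_set_conv_nth)
  have "j < k"
  proof (rule ccontr)
    assume "\<not> j < k"
    then have "f (ws ! i) \<le> f (ws ! j)" using sorted_nth_mono[OF assms(1), of i j] i j by simp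
    then show False using assms(4) i j by simp
  qed
  then show ?thesis using j by (auto simp: in_set_conv_nth)
qed

context ordered_complexes begin

text \<open>
  The closed sets in the fifth condition express that the initial parts of the list are relatively
  closed in the product of the tiles; together they give a shelling.
\<close>

definition product_tiling :: "'a morse_tile \<Rightarrow> 'b morse_tile \<Rightarrow> ('a \<times> 'b) morse_tile list \<Rightarrow> bool" where
  "product_tiling t1 t2 ts \<longleftrightarrow> distinct ts \<and>
     (\<forall>t\<in>set ts. is_morse_tile t \<and> underlying t \<in> staircase \<and> oriented_tile orientation t \<and>
        tile_dim t = tile_dim t1 + tile_dim t2) \<and>
     (\<forall>s\<in>set ts. \<forall>t\<in>set ts. s \<noteq> t \<longrightarrow> tile_set s \<inter> tile_set t = {}) \<and>
     (\<Union>t\<in>set ts. tile_set t) = tile_set t1 \<times> tile_set t2 \<and>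
     (\<forall>k. \<exists>C. closed C \<and> (\<Union>t\<in>set (take k ts). tile_set t) = C \<inter> (tile_set t1 \<times> tile_set t2)) \<and>
     (\<forall>j. card {t \<in> set ts. tile_order t = j} =
        order_count (tile_dim t1) (tile_dim t2) (tile_order t1) (tile_order t2) j)"

end

context enumerated_pair begin

text \<open>
  One tile for each word, for labels adapted to the two tiles. Whether a point lies in such a tile
  or in the product of the given tiles depends only on its carrier, which reduces everything to
  the chains of the grid.
\<close>

lemma tile_product:
  assumes t1: "is_morse_tile t1" "underlying t1 = S1" "oriented_tile R1 t1"
    and t2: "is_morse_tile t2" "underlying t2 = S2" "oriented_tile R2 t2"
  shows "\<exists>ts. product_tiling t1 t2 ts"
proof -
  have cV1: "card V1 = Suc n" and cV2: "card V2 = Suc m"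
    using bij_betw_same_card[OF e1] bij_betw_same_card[OF e2] by simp_all
  have dim: "tile_dim t1 = n" "tile_dim t2 = m"
    using morse_tile_data[OF t1(1)] morse_tile_data[OF t2(1)] tile_data_facts(3) t1(2) t2(2) cV1 cV2 by (metis diff_Suc_1)+
  have en1: "bij_betw e1 {..n} (vertices (underlying t1))" "\<forall>i\<le>n. \<forall>j\<le>n. (e1 i, e1 j) \<in> R1 \<longleftrightarrow> i < j"
    using e1 e1R t1(2) by simp_all
  have en2: "bij_betw e2 {..m} (vertices (underlying t2))" "\<forall>i\<le>m. \<forall>j\<le>m. (e2 i, e2 j) \<in> R2 \<longleftrightarrow> i < j"
    using e2 e2R t2(2) by simp_all
  obtain I p where I: "pattern n I p" "card I = tile_order t1"
    "\<forall>r y. r \<noteq> {} \<and> r \<subseteq> {..n} \<and> y \<in> open_simplex (e1 ` r) \<longrightarrow> (y \<in> tile_set t1 \<longleftrightarrow> meets I p r)"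
    using tile_pattern[OF t1(1,3) en1] by blast
  obtain J q where J: "pattern m J q" "card J = tile_order t2"
    "\<forall>r y. r \<noteq> {} \<and> r \<subseteq> {..m} \<and> y \<in> open_simplex (e2 ` r) \<longrightarrow> (y \<in> tile_set t2 \<longleftrightarrow> meets J q r)"
    using tile_pattern[OF t2(1,3) en2] by blast
  obtain u v a b where lab: "shuffle_labels n m u v"
    and ok: "clause_ok n (ascents n u) a" "clause_ok m (ascents m v) b"
    and mu: "\<forall>r. r \<noteq> {} \<and> r \<subseteq> {..n} \<longrightarrow> meets (ascents n u) a r = meets I p r"
    and mv: "\<forall>r. r \<noteq> {} \<and> r \<subseteq> {..m} \<longrightarrow> meets (ascents m v) b r = meets J q r"
    and cnt: "\<forall>j. card {w \<in> words n m. card (required (shuffle_labels.corners n u v w) w a b) = j} =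
      order_count n m (card I) (card J) j"
    using product_pattern[OF I(1) J(1)] by (elim exE conjE) (rule that; assumption)
  interpret L: shuffle_labels n m u v by (rule lab)
  have ab: "0 < a" "0 < b" using ok by (auto simp: clause_ok_def)
  define g where "g w t = emb (pos w t)" for w t
  define P where "P w = emb ` lattice_path w" for w
  define req where "req w = required (L.corners w) w a b" for w
  define crit where "crit w = critical (L.corners w) w a b" for w
  define F where "F w = simplex_tile (P w) (g w ` req w) (g w ` crit w)" for w
  have pathgrid: "lattice_path w \<subseteq> grid" if "w \<in> words n m" for w using path_grid[OF that] .
  have Pg: "P w = g w ` {..length w}" for w by (simp add: P_def g_def lattice_path_def image_image)
  have g_inj: "inj_on (g w) {..length w}" if w: "w \<in> words n m" for w
  proof -
    have "inj_on (emb \<circ> pos w) {..length w}"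
      using pos_inj[of w] inj_on_subset[OF emb_inj pathgrid[OF w]] by (intro comp_inj_on) (auto simp: lattice_path_def)
    moreover have "g w = emb \<circ> pos w" by (rule ext) (simp add: g_def)
    ultimately show ?thesis by simp
  qed
  have Pcell: "P w \<subseteq> V1 \<times> V2" if "w \<in> words n m" for w
    using emb_bij pathgrid[OF that] unfolding P_def bij_betw_def by blast
  have Pchain: "P w \<in> chains" if w: "w \<in> words n m" for w
    using Pcell[OF w] chain_emb[OF pathgrid[OF w]] path_chain[of w] S1 S2 unfolding chains_def P_def by blast
  have cP: "card (P w) = Suc (n + m)" if w: "w \<in> words n m" for w
    unfolding Pg using card_image[OF g_inj[OF w]] words_length[OF w] by simp
  have reqb: "req w \<subseteq> {..length w}" for w unfolding req_def using L.corners_bounded by (rule required_bounded)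
  have critb: "crit w \<subseteq> {..length w}" for w unfolding crit_def critical_def by auto
  have data: "tile_data (P w) (g w ` req w) (g w ` crit w)" if w: "w \<in> words n m" for w
    unfolding tile_data_def
  proof (intro conjI impI)
    show "finite (P w)" "\<not> affine_dependent (P w)" using chains_finite chains_independent Pchain[OF w] by blast+
    show "P w \<noteq> {}" using cP[OF w] by auto
    show "g w ` req w \<subseteq> P w" "g w ` crit w \<subseteq> P w" using reqb[of w] critb[of w] unfolding Pg by blast+
    assume "g w ` crit w \<noteq> {}"
    then have "crit w \<noteq> {}" by simp
    note cf = L.critical_face[OF w ok this[unfolded crit_def]]
    show "g w ` req w \<noteq> {}" using cf(1) by (simp add: req_def)
    show "g w ` req w \<subseteq> g w ` crit w" using cf(2) unfolding req_def crit_def by (rule image_mono)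
    have "card (g w ` crit w) = card (crit w)"
      using card_image[OF inj_on_subset[OF g_inj[OF w] critb]] .
    then show "card (g w ` crit w) + 2 \<le> card (P w)"
      using cf(4) cP[OF w] words_length[OF w] by (simp add: crit_def)
  qed
  note facts = tile_data_facts[OF data, folded F_def]
  have oriented: "oriented_tile orientation (F w)" if w: "w \<in> words n m" for w
    unfolding oriented_tile_def
  proof (intro impI allI, elim conjE)
    fix x y assume x: "x extreme_point_of underlying (F w)" and nx: "x \<notin> morse_face (F w)"
      and y: "y extreme_point_of morse_face (F w)"
    have "x \<in> P w" using x extreme_point_of_convex_hull[of x "P w"] by (simp add: F_def simplex_tile_def)
    then obtain t where t: "t \<le> length w" "x = g w t" unfolding Pg by auto
    have "y \<in> g w ` crit w" using y extreme_point_of_convex_hull[of y "g w ` crit w"] by (simp add: F_def simplex_tile_def)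
    then obtain t' where t': "t' \<in> crit w" "y = g w t'" by blast
    have tl': "t' \<le> length w" using critb t'(1) by blast
    have "t \<notin> crit w"
    proof
      assume "t \<in> crit w"
      then have "x \<in> g w ` crit w" using t(2) by blast
      then have "x \<in> convex hull (g w ` crit w)" by (rule hull_inc)
      then show False using nx by (simp add: F_def simplex_tile_def)
    qed
    then have "\<not> t' \<le> t" using critical_upward[of t' "L.corners w" w a b t] t'(1) t(1) unfolding crit_def by blast
    then have tt: "t < t'" by simp
    have "pos w t \<in> grid" "pos w t' \<in> grid" using pathgrid[OF w] t(1) tl' by (auto simp: lattice_path_def)
    moreover have "pos w t \<le> pos w t'" using tt by (simp add: pos_def ups_mono rts_mono)
    ultimately have "below x y" using below_emb t(2) t'(2) by (simp add: g_def)
    moreover have "x \<noteq> y" using inj_onD[OF g_inj[OF w], of t t'] t t' tl' tt by auto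
    moreover have "{x, y} \<subseteq> P w" unfolding Pg using t t' tl' by auto
    then have "{x, y} \<in> chains" using chains_subset[OF Pchain[OF w]] by blast
    ultimately show "(x, y) \<in> orientation" by (simp add: orientation_def)
  qed
  have carrier: "\<exists>s. s \<subseteq> grid \<and> is_chain s \<and> s \<noteq> {} \<and> y \<in> open_simplex (emb ` s)" if y: "y \<in> S1 \<times> S2" for y
  proof -
    obtain s0 where s0: "s0 \<subseteq> V1 \<times> V2" "chain s0" "y \<in> open_simplex s0" using chain_carrier_exists[OF y] by blast
    define s where "s = {c\<in>grid. emb c \<in> s0}"
    have sg: "s \<subseteq> grid" by (auto simp: s_def)
    have "s0 \<subseteq> emb ` grid" using s0(1) emb_bij by (simp add: bij_betw_def)
    then have es: "emb ` s = s0" unfolding s_def by blast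
    then have "is_chain s" using chain_emb[OF sg] s0(2) by simp
    moreover have "s \<noteq> {}" using es s0(3) by auto
    ultimately show ?thesis using sg es s0(3) by blast
  qed
  have memF: "y \<in> tile_set (F w) \<longleftrightarrow> s \<subseteq> lattice_path w \<and> pos w ` L.corners w \<subseteq> s \<and>
      (\<exists>c\<in>s. fst c < a) \<and> (\<exists>c\<in>s. snd c < b)"
    if w: "w \<in> words n m" and s: "s \<subseteq> grid" "is_chain s" "s \<noteq> {}" and y: "y \<in> open_simplex (emb ` s)" for w s y
  proof -
    have esub: "emb ` s \<subseteq> V1 \<times> V2" using emb_bij s(1) unfolding bij_betw_def by blast
    have ec: "emb ` s \<in> chains" using esub chain_emb[OF s(1)] s(2) S1 S2 unfolding chains_def by blast
    have "y \<in> convex hull P w \<longleftrightarrow> emb ` s \<subseteq> P w" by (rule carrier_in_chain_iff[OF ec y Pchain[OF w]])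
    also have "\<dots> \<longleftrightarrow> s \<subseteq> lattice_path w"
      unfolding P_def by (rule inj_on_image_subset_iff[OF emb_inj s(1) pathgrid[OF w]])
    finally have inP: "y \<in> convex hull P w \<longleftrightarrow> s \<subseteq> lattice_path w" .
    show ?thesis
    proof (cases "s \<subseteq> lattice_path w")
      case False
      then show ?thesis using inP by (auto simp: tile_set_def F_def simplex_tile_def)
    next
      case True
      define T where "T = {t\<in>{..length w}. pos w t \<in> s}"
      have Tb: "T \<subseteq> {..length w}" by (auto simp: T_def)
      have sT: "s = pos w ` T" using True unfolding T_def lattice_path_def by blast
      have eT: "emb ` s = g w ` T" unfolding sT by (simp add: g_def image_image)
      have T0: "T \<noteq> {}" using sT s(3) by auto
      have "y \<in> tile_set (F w) \<longleftrightarrow> g w ` req w \<subseteq> g w ` T \<and> \<not> g w ` T \<subseteq> g w ` crit w"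
        unfolding F_def eT[symmetric]
        by (rule mem_simplex_tile[OF data[OF w] _ _ y]) (use True s(3) in \<open>auto simp: P_def\<close>)
      also have "\<dots> \<longleftrightarrow> req w \<subseteq> T \<and> \<not> T \<subseteq> crit w"
        using inj_on_image_subset_iff[OF g_inj[OF w] reqb Tb] inj_on_image_subset_iff[OF g_inj[OF w] Tb critb] by simp
      also have "\<dots> \<longleftrightarrow> L.corners w \<subseteq> T \<and> (\<exists>t\<in>T. ups w t < a) \<and> (\<exists>t\<in>T. rts w t < b)"
        unfolding req_def crit_def using tile_condition[OF L.corners_bounded Tb T0 ab] by simp
      also have "L.corners w \<subseteq> T \<longleftrightarrow> pos w ` L.corners w \<subseteq> s"
        unfolding sT using inj_on_image_subset_iff[OF pos_inj L.corners_bounded Tb] by simp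
      also have "(\<exists>t\<in>T. ups w t < a) \<longleftrightarrow> (\<exists>c\<in>s. fst c < a)" unfolding sT by (simp add: pos_def)
      also have "(\<exists>t\<in>T. rts w t < b) \<longleftrightarrow> (\<exists>c\<in>s. snd c < b)" unfolding sT by (simp add: pos_def)
      finally show ?thesis using True by simp
    qed
  qed
  have memT: "y \<in> tile_set t1 \<times> tile_set t2 \<longleftrightarrow>
      (ascents n u \<subseteq> fst ` s \<and> ascents m v \<subseteq> snd ` s) \<and> (\<exists>c\<in>s. fst c < a) \<and> (\<exists>c\<in>s. snd c < b)"
    if s: "s \<subseteq> grid" "s \<noteq> {}" and y: "y \<in> open_simplex (emb ` s)" for s y
  proof -
    have esub: "emb ` s \<subseteq> V1 \<times> V2" using emb_bij s(1) unfolding bij_betw_def by blast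
    have im: "fst ` emb ` s = e1 ` fst ` s" "snd ` emb ` s = e2 ` snd ` s"
      by (auto simp: emb_def image_image)
    have yp: "fst y \<in> open_simplex (e1 ` fst ` s)" "snd y \<in> open_simplex (e2 ` snd ` s)"
      using carrier_projections[OF esub y] unfolding im .
    have rr: "fst ` s \<noteq> {} \<and> fst ` s \<subseteq> {..n}" "snd ` s \<noteq> {} \<and> snd ` s \<subseteq> {..m}" using s by auto
    have "fst y \<in> tile_set t1 \<longleftrightarrow> meets (ascents n u) a (fst ` s)"
      using I(3)[rule_format, of "fst ` s" "fst y"] mu[rule_format, of "fst ` s"] rr(1) yp(1) by blast
    moreover have "snd y \<in> tile_set t2 \<longleftrightarrow> meets (ascents m v) b (snd ` s)"
      using J(3)[rule_format, of "snd ` s" "snd y"] mv[rule_format, of "snd ` s"] rr(2) yp(2) by blast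
    ultimately show ?thesis unfolding mem_Times_iff meets_def by auto
  qed
  have subT: "tile_set t1 \<times> tile_set t2 \<subseteq> S1 \<times> S2" using t1(2) t2(2) by (auto simp: tile_set_def)
  have subF: "tile_set (F w) \<subseteq> S1 \<times> S2" if w: "w \<in> words n m" for w
    using chain_hull_in_cell[OF S1 S2 Pcell[OF w]] by (auto simp: tile_set_def F_def simplex_tile_def)
  have cover: "\<exists>w\<in>words n m. y \<in> tile_set (F w)" if y: "y \<in> tile_set t1 \<times> tile_set t2" for y
  proof -
    obtain s where s: "s \<subseteq> grid" "is_chain s" "s \<noteq> {}" "y \<in> open_simplex (emb ` s)" using carrier subT y by blast
    have h: "ascents n u \<subseteq> fst ` s" "ascents m v \<subseteq> snd ` s" "\<exists>c\<in>s. fst c < a" "\<exists>c\<in>s. snd c < b"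
      using memT[OF s(1,3,4)] y by auto
    obtain w where "w \<in> words n m" "s \<subseteq> lattice_path w" "pos w ` L.corners w \<subseteq> s"
      using L.chain_in_some_interval[OF s(2,1) h(1,2)] by blast
    then show ?thesis using memF[OF _ s] h(3,4) by blast
  qed
  have inside: "y \<in> tile_set t1 \<times> tile_set t2" if w: "w \<in> words n m" and y: "y \<in> tile_set (F w)" for w y
  proof -
    obtain s where s: "s \<subseteq> grid" "is_chain s" "s \<noteq> {}" "y \<in> open_simplex (emb ` s)" using carrier subF[OF w] y by blast
    have h: "pos w ` L.corners w \<subseteq> s" "\<exists>c\<in>s. fst c < a" "\<exists>c\<in>s. snd c < b" using memF[OF w s] y by auto
    show ?thesis using memT[OF s(1,3,4)] L.interval_hits[OF w h(1)] h(2,3) by blast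
  qed
  have unique: "w = w'" if w: "w \<in> words n m" "w' \<in> words n m" and y: "y \<in> tile_set (F w)" "y \<in> tile_set (F w')" for w w' y
  proof -
    obtain s where s: "s \<subseteq> grid" "is_chain s" "s \<noteq> {}" "y \<in> open_simplex (emb ` s)" using carrier subF[OF w(1)] y by blast
    have h: "s \<subseteq> lattice_path w" "pos w ` L.corners w \<subseteq> s" using memF[OF w(1) s] y(1) by auto
    have h': "s \<subseteq> lattice_path w'" "pos w' ` L.corners w' \<subseteq> s" using memF[OF w(2) s] y(2) by auto
    show ?thesis by (rule L.word_of_chain_unique[OF w(1) h w(2) h'])
  qed
  have F_inj: "inj_on F (words n m)"
  proof (rule inj_onI)
    fix w w' assume w: "w \<in> words n m" "w' \<in> words n m" "F w = F w'"
    obtain y where "y \<in> tile_set (F w)" using tile_set_nonempty[OF facts(1)[OF w(1)]] by blast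
    then show "w = w'" using unique[OF w(1,2)] w(3) by simp
  qed
  obtain l where l: "set l = words n m" "distinct l" using finite_distinct_list[OF finite_words] by blast
  \<comment> \<open>sorting by this number gives the shelling order\<close>
  define f where "f w = card (L.inversions w)" for w
  define ws where "ws = sort_key f l"
  have ws: "set ws = words n m" "distinct ws" "sorted (map f ws)" using l by (simp_all add: ws_def)
  define ts where "ts = map F ws"
  have set_ts: "set ts = F ` words n m" using ws by (simp add: ts_def)
  have closed_prefix: "\<exists>C. closed C \<and> (\<Union>t\<in>set (take k ts). tile_set t) = C \<inter> (tile_set t1 \<times> tile_set t2)" for k
  proof (intro exI conjI)
    have tk: "set (take k ws) \<subseteq> words n m" using set_take_subset[of k ws] ws(1) by simp
    show "closed (\<Union>w\<in>set (take k ws). convex hull (P w))"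
    proof (rule closed_UN)
      show "\<forall>w\<in>set (take k ws). closed (convex hull P w)"
        using tk Pchain chains_finite by (blast intro: compact_imp_closed finite_imp_compact_convex_hull)
    qed simp
    show "(\<Union>t\<in>set (take k ts). tile_set t) = (\<Union>w\<in>set (take k ws). convex hull (P w)) \<inter> (tile_set t1 \<times> tile_set t2)"
    proof (intro equalityI subsetI)
      fix y assume "y \<in> (\<Union>t\<in>set (take k ts). tile_set t)"
      then obtain w where w: "w \<in> set (take k ws)" "y \<in> tile_set (F w)" unfolding ts_def take_map by auto
      then have "y \<in> convex hull (P w)" by (auto simp: tile_set_def F_def simplex_tile_def)
      moreover have "y \<in> tile_set t1 \<times> tile_set t2" by (rule inside[OF _ w(2)]) (use w(1) tk in blast)
      ultimately show "y \<in> (\<Union>w\<in>set (take k ws). convex hull (P w)) \<inter> (tile_set t1 \<times> tile_set t2)" using w(1) by blast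
    next
      fix y assume "y \<in> (\<Union>w\<in>set (take k ws). convex hull (P w)) \<inter> (tile_set t1 \<times> tile_set t2)"
      then obtain w where w: "w \<in> set (take k ws)" "y \<in> convex hull (P w)" and y: "y \<in> tile_set t1 \<times> tile_set t2" by blast
      have ww: "w \<in> words n m" using w(1) tk by blast
      obtain s where s: "s \<subseteq> grid" "is_chain s" "s \<noteq> {}" "y \<in> open_simplex (emb ` s)" using carrier subT y by blast
      have "emb ` s \<in> chains" using emb_bij s(1,2) chain_emb[OF s(1)] S1 S2 unfolding chains_def bij_betw_def by blast
      then have "emb ` s \<subseteq> P w" using carrier_in_chain_iff[OF _ s(4) Pchain[OF ww]] w(2) by blast
      then have sw: "s \<subseteq> lattice_path w"
        unfolding P_def using inj_on_image_subset_iff[OF emb_inj s(1) pathgrid[OF ww]] by simp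
      obtain w' where w': "w' \<in> words n m" "y \<in> tile_set (F w')" using cover[OF y] by blast
      have h: "s \<subseteq> lattice_path w'" "pos w' ` L.corners w' \<subseteq> s" using memF[OF w'(1) s] w'(2) by auto
      have sub: "L.inversions w' \<subseteq> L.inversions w" by (rule L.inversions_mono[OF ww w'(1) sw h])
      have "w' \<in> set (take k ws)"
      proof (cases "w' = w")
        case True
        then show ?thesis using w(1) by simp
      next
        case False
        then have "L.inversions w' \<noteq> L.inversions w" using L.inversions_inj[OF w'(1) ww] by blast
        then have "f w' < f w" unfolding f_def using sub L.finite_inversions by (intro psubset_card_mono) auto
        then show ?thesis using sorted_prefix_downward[OF ws(3) w(1)] w'(1) ws(1) by simp
      qed
      then show "y \<in> (\<Union>t\<in>set (take k ts). tile_set t)" unfolding ts_def take_map using w'(2) by auto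
    qed
  qed
  have "product_tiling t1 t2 ts"
    unfolding product_tiling_def
  proof (intro conjI ballI allI impI)
    show "distinct ts" unfolding ts_def distinct_map using ws F_inj by simp
    show "is_morse_tile t" "underlying t \<in> staircase" "oriented_tile orientation t"
      "tile_dim t = tile_dim t1 + tile_dim t2" if "t \<in> set ts" for t
    proof -
      obtain w where w: "w \<in> words n m" "t = F w" using \<open>t \<in> set ts\<close> set_ts by blast
      show "is_morse_tile t" "oriented_tile orientation t" using facts(1)[OF w(1)] oriented[OF w(1)] w(2) by simp_all
      show "underlying t \<in> staircase" using Pchain[OF w(1)] w(2) by (simp add: staircase_def F_def simplex_tile_def)
      show "tile_dim t = tile_dim t1 + tile_dim t2" using facts(3)[OF w(1)] cP[OF w(1)] w(2) dim by simp
    qed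
    show "tile_set s \<inter> tile_set t = {}" if "s \<in> set ts" "t \<in> set ts" "s \<noteq> t" for s t
      using that unique unfolding set_ts by blast
    show "(\<Union>t\<in>set ts. tile_set t) = tile_set t1 \<times> tile_set t2"
      unfolding set_ts using cover inside by blast
    show "\<exists>C. closed C \<and> (\<Union>t\<in>set (take k ts). tile_set t) = C \<inter> (tile_set t1 \<times> tile_set t2)" for k
      by (rule closed_prefix)
    show "card {t \<in> set ts. tile_order t = j} =
        order_count (tile_dim t1) (tile_dim t2) (tile_order t1) (tile_order t2) j" for j
    proof -
      have ord: "tile_order (F w) = card (req w)" if w: "w \<in> words n m" for w
        using facts(2)[OF w] card_image[OF inj_on_subset[OF g_inj[OF w] reqb]] by simp
      have "{t \<in> set ts. tile_order t = j} = F ` {w \<in> words n m. card (req w) = j}"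
        unfolding set_ts using ord by auto
      then have "card {t \<in> set ts. tile_order t = j} = card {w \<in> words n m. card (req w) = j}"
        using card_image[OF inj_on_subset[OF F_inj], of "{w \<in> words n m. card (req w) = j}"] by auto
      then show ?thesis using cnt I(2) J(2) dim by (simp add: req_def)
    qed
  qed
  then show ?thesis by blast
qed

end

context ordered_complexes begin

lemma product_tiling_exists:
  assumes t1: "is_morse_tile t1" "underlying t1 \<in> K1" "oriented_tile R1 t1"
    and t2: "is_morse_tile t2" "underlying t2 \<in> K2" "oriented_tile R2 t2"
  shows "\<exists>ts. product_tiling t1 t2 ts"
proof -
  have "vertices (underlying t1) \<noteq> {}" "vertices (underlying t2) \<noteq> {}"
    using morse_tile_data[OF t1(1)] morse_tile_data[OF t2(1)] by (auto simp: tile_data_def)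
  then obtain n m e1 e2 where "enumerated_pair K1 R1 K2 R2 (underlying t1) (underlying t2) n m e1 e2"
    using enumerate_pair[OF t1(2) t2(2)] by blast
  then show ?thesis by (rule enumerated_pair.tile_product[OF _ t1(1) refl t1(3) t2(1) refl t2(3)])
qed

lemma below_antisym: "below c c' \<Longrightarrow> below c' c \<Longrightarrow> c = c'"
  using c1.asym c2.asym unfolding below_def by (metis prod.expand)

lemma below_trans:
  assumes "{c, c', c''} \<in> chains" "below c c'" "below c' c''" shows "below c c''"
proof -
  obtain S1 S2 where S: "S1 \<in> K1" "S2 \<in> K2" "{c, c', c''} \<subseteq> vertices S1 \<times> vertices S2"
    using assms(1) by (auto simp: chains_def)
  have v1: "fst c \<in> vertices S1" "fst c' \<in> vertices S1" "fst c'' \<in> vertices S1"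
    and v2: "snd c \<in> vertices S2" "snd c' \<in> vertices S2" "snd c'' \<in> vertices S2"
    using S(3) by auto
  have "fst c = fst c'' \<or> (fst c, fst c'') \<in> R1"
    using assms(2,3) c1.trans[OF S(1) v1] unfolding below_def by metis
  moreover have "snd c = snd c'' \<or> (snd c, snd c'') \<in> R2"
    using assms(2,3) c2.trans[OF S(2) v2] unfolding below_def by metis
  ultimately show ?thesis unfolding below_def by blast
qed

text \<open>
  This recovers the chain from an edge or a triangle of the triangulation given by its vertices.
\<close>

lemma small_simplex_chain:
  assumes "convex hull C \<in> staircase" "N simplex (convex hull C)" "finite C" "int (card C) \<le> N + 1"
  shows "C \<in> chains" "int (card C) = N + 1"
proof -
  obtain s where s: "s \<in> chains" "convex hull C = convex hull s" using assms(1) by (auto simp: staircase_def)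
  have "vertices (convex hull C) = s" unfolding s(2) by (rule vertices_hull[OF chains_independent[OF s(1)]])
  then have sub: "s \<subseteq> C" using extreme_point_of_convex_hull[of _ C] by (auto simp: vertices_def)
  have "int (card s) = N + 1"
    using aff_dim_simplex[OF assms(2)] aff_dim_hull[OF chains_independent[OF s(1)]] unfolding s(2) by simp
  moreover have "card s \<le> card C" using card_mono[OF assms(3) sub] .
  ultimately have "card s = card C" using assms(4) by linarith
  then show "C \<in> chains" "int (card C) = N + 1"
    using card_subset_eq[OF assms(3) sub] s(1) \<open>int (card s) = N + 1\<close> by auto
qed

lemma orientation_edges: "edge_orientation staircase orientation"
  unfolding edge_orientation_def
proof (intro conjI allI impI)
  fix x y
  show "((x, y) \<in> orientation \<or> (y, x) \<in> orientation) = (1 simplex (convex hull {x, y}) \<and> convex hull {x, y} \<in> staircase)"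
  proof
    assume "(x, y) \<in> orientation \<or> (y, x) \<in> orientation"
    then have xy: "x \<noteq> y" "{x, y} \<in> chains" by (auto simp: orientation_def insert_commute)
    have "1 simplex (convex hull {x, y})"
      unfolding simplex using xy(1) chains_independent[OF xy(2)] by (intro exI[of _ "{x, y}"]) simp
    then show "1 simplex (convex hull {x, y}) \<and> convex hull {x, y} \<in> staircase"
      using xy(2) by (simp add: staircase_def)
  next
    assume a: "1 simplex (convex hull {x, y}) \<and> convex hull {x, y} \<in> staircase"
    have "int (card {x, y}) \<le> 1 + 1" by (cases "x = y") auto
    then have c: "{x, y} \<in> chains" "int (card {x, y}) = 1 + 1" using small_simplex_chain[of "{x, y}" 1] a by auto
    then have "x \<noteq> y" by auto
    moreover have "below x y \<or> below y x" using c(1) by (auto simp: chains_def chain_def)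
    ultimately show "(x, y) \<in> orientation \<or> (y, x) \<in> orientation"
      using c(1) by (auto simp: orientation_def insert_commute)
  qed
next
  fix x y assume "(x, y) \<in> orientation"
  then show "(y, x) \<notin> orientation" using below_antisym[of x y] by (auto simp: orientation_def)
qed

lemma orientation_tame:
  assumes "\<forall>t\<in>\<tau>. oriented_tile orientation t"
  shows "tame staircase \<tau>"
  unfolding tame_def
proof (intro exI[of _ orientation] conjI orientation_edges allI impI ballI)
  fix a b c assume abc: "2 simplex (convex hull {a, b, c}) \<and> convex hull {a, b, c} \<in> staircase"
  have "card {a, b, c} \<le> 3" by (simp add: card_insert_if)
  then have ch: "{a, b, c} \<in> chains" using small_simplex_chain(1)[of "{a, b, c}" 2] abc by auto
  show "\<not> ((a, b) \<in> orientation \<and> (b, c) \<in> orientation \<and> (c, a) \<in> orientation)"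
  proof
    assume "(a, b) \<in> orientation \<and> (b, c) \<in> orientation \<and> (c, a) \<in> orientation"
    then have "below a b" "below b c" "below c a" "c \<noteq> a" by (auto simp: orientation_def)
    then show False using below_trans[OF ch] below_antisym[of a c] by blast
  qed
next
  fix t x y assume "t \<in> \<tau>" "morse_face t \<noteq> {}"
    "x extreme_point_of underlying t \<and> x \<notin> morse_face t \<and> y extreme_point_of morse_face t"
  then show "(x, y) \<in> orientation" using assms unfolding oriented_tile_def by blast
qed

end

section \<open>Tilings, shellings and h-vectors\<close>

text \<open>
  A tournament without oriented triangles is transitive.
\<close>

lemma tame_orders:
  assumes K: "simplicial_complex K" and "tame K \<tau>"
  shows "\<exists>R. ordered_complex K R \<and> (\<forall>t\<in>\<tau>. oriented_tile R t)"
proof -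
  obtain R where R: "edge_orientation K R"
    and tri: "\<forall>a b c. 2 simplex (convex hull {a, b, c}) \<and> convex hull {a, b, c} \<in> K \<longrightarrow>
        \<not> ((a, b) \<in> R \<and> (b, c) \<in> R \<and> (c, a) \<in> R)"
    and face: "\<forall>t\<in>\<tau>. oriented_tile R t"
    using assms(2) unfolding tame_def oriented_tile_def by blast
  have edge: "\<And>v w. (v, w) \<in> R \<or> (w, v) \<in> R \<longleftrightarrow> 1 simplex (convex hull {v, w}) \<and> convex hull {v, w} \<in> K"
    and asym: "\<And>v w. (v, w) \<in> R \<Longrightarrow> (w, v) \<notin> R"
    using R unfolding edge_orientation_def by blast+
  have total: "(a, b) \<in> R \<or> (b, a) \<in> R" if S: "S \<in> K" "a \<in> vertices S" "b \<in> vertices S" "a \<noteq> b" for S a b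
  proof -
    have sub: "{a, b} \<subseteq> vertices S" using S by simp
    have "\<not> affine_dependent {a, b}" using complex_simplex(2)[OF K S(1)] sub affine_dependent_subset by blast
    then have "1 simplex (convex hull {a, b})" unfolding simplex using S(4) by (intro exI[of _ "{a, b}"]) simp
    then show ?thesis using edge complex_subface(1)[OF K S(1) sub] by blast
  qed
  have trans: "(a, c) \<in> R"
    if S: "S \<in> K" "a \<in> vertices S" "b \<in> vertices S" "c \<in> vertices S" and r: "(a, b) \<in> R" "(b, c) \<in> R" for S a b c
  proof -
    have d: "a \<noteq> b" "b \<noteq> c" "a \<noteq> c" using r asym by blast+
    have sub: "{a, b, c} \<subseteq> vertices S" using S by simp
    have "\<not> affine_dependent {a, b, c}" using complex_simplex(2)[OF K S(1)] sub affine_dependent_subset by blast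
    then have "2 simplex (convex hull {a, b, c})" unfolding simplex using d by (intro exI[of _ "{a, b, c}"]) simp
    then have "(c, a) \<notin> R" using tri complex_subface(1)[OF K S(1) sub] r by blast
    then show ?thesis using total[OF S(1,2,4) d(3)] by blast
  qed
  have "ordered_complex K R" by unfold_locales (use K asym total trans in blast)+
  then show ?thesis using face by blast
qed

lemma finite_morse_tiling:
  assumes K: "simplicial_complex K" and \<tau>: "morse_tiling K S \<tau>"
  shows "finite \<tau>"
proof -
  have "\<tau> \<subseteq> (\<Union>S\<in>K. (\<lambda>(A, M). simplex_tile (vertices S) A M) ` (Pow (vertices S) \<times> Pow (vertices S)))"
  proof
    fix t assume "t \<in> \<tau>"
    then have t: "is_morse_tile t" "underlying t \<in> K" using \<tau> by (auto simp: morse_tiling_def)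
    obtain A where A: "tile_data (vertices (underlying t)) A (vertices (morse_face t))"
      "t = simplex_tile (vertices (underlying t)) A (vertices (morse_face t))"
      using morse_tile_data[OF t(1)] by blast
    then have "(A, vertices (morse_face t)) \<in> Pow (vertices (underlying t)) \<times> Pow (vertices (underlying t))"
      by (simp add: tile_data_def)
    then have "t \<in> (\<lambda>(A, M). simplex_tile (vertices (underlying t)) A M) ` (Pow (vertices (underlying t)) \<times> Pow (vertices (underlying t)))"
      using A(2) by (intro image_eqI[of _ _ "(A, vertices (morse_face t))"]) simp_all
    then show "t \<in> (\<Union>S\<in>K. (\<lambda>(A, M). simplex_tile (vertices S) A M) ` (Pow (vertices S) \<times> Pow (vertices S)))"
      using t(2) by blast
  qed
  moreover have "finite K" using K by (simp add: simplicial_complex_def)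
  ultimately show ?thesis using complex_simplex(1)[OF K] by (auto intro: finite_subset)
qed

lemma closed_complex: "simplicial_complex K \<Longrightarrow> closed (\<Union>K)"
proof -
  assume K: "simplicial_complex K"
  have "closed S" if "S \<in> K" for S
    using complex_simplex(1,3)[OF K that] finite_imp_compact_convex_hull compact_imp_closed by metis
  moreover have "finite K" using K by (simp add: simplicial_complex_def)
  ultimately show ?thesis by blast
qed

lemma tile_order_le: "is_morse_tile t \<Longrightarrow> tile_order t \<le> Suc (tile_dim t)"
proof -
  assume t: "is_morse_tile t"
  obtain V A M where d: "tile_data V A M" "t = simplex_tile V A M" using morse_tile_data[OF t] by blast
  then have "card A \<le> card V" "0 < card V" by (auto simp: tile_data_def card_mono card_gt_0_iff)
  then show ?thesis using tile_data_facts(2,3)[OF d(1)] d(2) by simp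
qed

lemma palindromic_h_vector:
  "palindromic (h_vector \<tau>) \<longleftrightarrow> (\<forall>k\<le>Suc (tiling_dim \<tau>).
     card {t \<in> \<tau>. tile_order t = k} = card {t \<in> \<tau>. tile_order t = Suc (tiling_dim \<tau>) - k})"
proof -
  have len: "length (h_vector \<tau>) = Suc (Suc (tiling_dim \<tau>))" by (simp add: h_vector_def)
  have nth: "h_vector \<tau> ! k = card {t \<in> \<tau>. tile_order t = k}" if "k \<le> Suc (tiling_dim \<tau>)" for k
    using that by (simp add: h_vector_def del: upt_Suc)
  show ?thesis unfolding palindromic_def len using nth by (simp add: less_Suc_eq_le)
qed

text \<open>
  Reverse the summation over the orders.
\<close>

lemma palindromic_sum:
  assumes fin: "finite \<tau>" and le: "\<And>t. t \<in> \<tau> \<Longrightarrow> tile_order t \<le> Suc n"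
    and dim: "tiling_dim \<tau> = n" and pal: "palindromic (h_vector \<tau>)"
  shows "(\<Sum>t\<in>\<tau>. f (tile_order t)) = (\<Sum>t\<in>\<tau>. f (Suc n - tile_order t) :: nat)"
proof -
  define h where "h k = card {t \<in> \<tau>. tile_order t = k}" for k
  have sym: "h k = h (Suc n - k)" if "k \<le> Suc n" for k
    using pal that unfolding palindromic_h_vector dim h_def by blast
  have group: "(\<Sum>t\<in>\<tau>. g (tile_order t)) = (\<Sum>k\<le>Suc n. h k * g k)" for g :: "nat \<Rightarrow> nat"
  proof -
    have "(\<Sum>t\<in>\<tau>. g (tile_order t)) = (\<Sum>k\<le>Suc n. \<Sum>t\<in>{t\<in>\<tau>. tile_order t = k}. g (tile_order t))"
      by (rule sum.group[symmetric]) (use fin le in auto)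
    also have "\<dots> = (\<Sum>k\<le>Suc n. h k * g k)" by (rule sum.cong) (auto simp: h_def)
    finally show ?thesis .
  qed
  have "(\<Sum>k\<le>Suc n. h k * f k) = (\<Sum>k\<le>Suc n. h (Suc n - k) * f (Suc n - k))"
    using sum.atLeastAtMost_rev[of "\<lambda>k. h k * f k" 0 "Suc n"] by (simp only: atMost_atLeast0 add_0_right)
  also have "\<dots> = (\<Sum>k\<le>Suc n. h k * f (Suc n - k))" by (rule sum.cong) (simp_all add: sym[symmetric])
  finally show ?thesis using group[of f] group[of "\<lambda>k. f (Suc n - k)"] by simp
qed

text \<open>
  A shelling is a list of tiles whose initial parts have closed unions. The additional set \<open>Z\<close>
  allows to build such a list block by block.
\<close>

definition prefix_closed :: "'a::topological_space set \<Rightarrow> 'a set list \<Rightarrow> bool" where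
  "prefix_closed Z Xs \<longleftrightarrow> (\<forall>k. closed (Z \<union> \<Union>(set (take k Xs))))"

lemma prefix_closed_append:
  assumes "prefix_closed Z Xs" "prefix_closed (Z \<union> \<Union>(set Xs)) Ys"
  shows "prefix_closed Z (Xs @ Ys)"
  unfolding prefix_closed_def
proof
  fix k
  show "closed (Z \<union> \<Union>(set (take k (Xs @ Ys))))"
  proof (cases "k \<le> length Xs")
    case True
    then show ?thesis using assms(1) by (simp add: prefix_closed_def)
  next
    case False
    then have "Z \<union> \<Union>(set (take k (Xs @ Ys))) = (Z \<union> \<Union>(set Xs)) \<union> \<Union>(set (take (k - length Xs) Ys))" by auto
    then show ?thesis using assms(2) unfolding prefix_closed_def by metis
  qed
qed

lemma prefix_closed_concat:
  assumes "closed Z"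
    and "\<And>i. i < length Xss \<Longrightarrow> prefix_closed (Z \<union> \<Union>(set (concat (take i Xss)))) (Xss ! i)"
  shows "prefix_closed Z (concat Xss)"
  using assms(2)
proof (induction Xss rule: rev_induct)
  case Nil
  then show ?case using assms(1) by (simp add: prefix_closed_def)
next
  case (snoc Xs Xss)
  have "prefix_closed Z (concat Xss)"
  proof (rule snoc.IH)
    fix i assume "i < length Xss"
    then show "prefix_closed (Z \<union> \<Union>(set (concat (take i Xss)))) (Xss ! i)"
      using snoc.prems[of i] by (simp add: nth_append)
  qed
  moreover have "prefix_closed (Z \<union> \<Union>(set (concat Xss))) Xs" using snoc.prems[of "length Xss"] by simp
  ultimately show ?case using prefix_closed_append by (simp del: set_concat)
qed

lemma shelling_list:
  assumes "morse_shelling K S \<tau> N \<Phi>" and S: "closed S"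
  shows "\<exists>ts. distinct ts \<and> set ts = \<tau> \<and> ts \<noteq> [] \<and> prefix_closed {} (map tile_set ts)"
proof -
  have til: "morse_tiling K S \<tau>" and N: "1 \<le> N" "\<Phi> 0 = {}" "\<Phi> N = S"
    and step: "\<And>i. i \<in> {1..N} \<Longrightarrow> \<Phi> (i - 1) \<subset> \<Phi> i \<and> morse_tiled_subset S \<tau> (\<Phi> i) \<and> (\<exists>t\<in>\<tau>. \<Phi> i - \<Phi> (i - 1) = tile_set t)"
    using assms(1) by (auto simp: morse_shelling_def)
  have "\<forall>i\<in>{1..N}. \<exists>t. t \<in> \<tau> \<and> \<Phi> i - \<Phi> (i - 1) = tile_set t" using step by blast
  then obtain f where f: "\<And>i. i \<in> {1..N} \<Longrightarrow> f i \<in> \<tau> \<and> \<Phi> i - \<Phi> (i - 1) = tile_set (f i)"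
    by (metis (no_types, lifting))
  define ts where "ts = map (\<lambda>i. f (Suc i)) [0..<N]"
  have un: "\<Union>(set (take k (map tile_set ts))) = \<Phi> k" if "k \<le> N" for k
    using that
  proof (induction k)
    case 0
    then show ?case using N by simp
  next
    case (Suc k)
    have "take (Suc k) (map tile_set ts) = take k (map tile_set ts) @ [tile_set (f (Suc k))]"
      using Suc.prems by (simp add: take_Suc_conv_app_nth ts_def)
    moreover have "\<Phi> (Suc k) - \<Phi> k = tile_set (f (Suc k))" "\<Phi> k \<subset> \<Phi> (Suc k)"
      using f[of "Suc k"] step[of "Suc k"] Suc.prems by auto
    ultimately show ?case using Suc by auto
  qed
  have cl: "closed (\<Phi> k)" if "k \<le> N" for k
  proof (cases "k = 0")
    case False
    then have "closedin (top_of_set S) (\<Phi> k)" using step[of k] that by (auto simp: morse_tiled_subset_def)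
    then show ?thesis using closedin_closed_eq[OF S] by blast
  qed (simp add: N)
  have pc: "prefix_closed {} (map tile_set ts)"
    unfolding prefix_closed_def
  proof
    fix k
    show "closed ({} \<union> \<Union>(set (take k (map tile_set ts))))"
    proof (cases "k \<le> N")
      case True
      then show ?thesis using un cl by simp
    next
      case False
      then have "take k (map tile_set ts) = take N (map tile_set ts)" by (simp add: ts_def)
      then show ?thesis using un[of N] cl[of N] by (simp del: take_map)
    qed
  qed
  have len: "length ts = N" by (simp add: ts_def)
  have ne: "tile_set t \<noteq> {}" if "t \<in> \<tau>" for t using tile_set_nonempty til that by (auto simp: morse_tiling_def)
  have inc: "\<Phi> k \<subseteq> \<Phi> (Suc k)" if "Suc k \<le> N" for k
    using step[of "Suc k"] that by auto
  have mono: "\<Phi> i \<subseteq> \<Phi> j" if "i \<le> j" "j \<le> N" for i j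
    using that
  proof (induction j rule: dec_induct)
    case (step k)
    then show ?case using inc[of k] by auto
  qed simp
  have "distinct ts"
    unfolding distinct_conv_nth
  proof (intro allI impI)
    have lt: "ts ! i \<noteq> ts ! j" if "i < j" "j < N" for i j
    proof
      assume "ts ! i = ts ! j"
      then have eq: "f (Suc i) = f (Suc j)" using that by (simp add: ts_def)
      have "tile_set (f (Suc i)) \<subseteq> \<Phi> (Suc i)" "tile_set (f (Suc j)) \<inter> \<Phi> j = {}"
        using f[of "Suc i"] f[of "Suc j"] that by auto
      moreover have "\<Phi> (Suc i) \<subseteq> \<Phi> j" using mono that by simp
      moreover have "tile_set (f (Suc j)) \<noteq> {}" using ne f[of "Suc j"] that by simp
      ultimately show False using eq by auto
    qed
    fix i j assume "i < length ts" "j < length ts" "i \<noteq> j"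
    then show "ts ! i \<noteq> ts ! j" using lt[of i j] lt[of j i] len by (cases "i < j") auto
  qed
  moreover have "set ts = \<tau>"
  proof
    show sub: "set ts \<subseteq> \<tau>" using f by (auto simp: ts_def)
    show "\<tau> \<subseteq> set ts"
    proof
      fix t assume t: "t \<in> \<tau>"
      obtain y where y: "y \<in> tile_set t" using ne[OF t] by blast
      then have "y \<in> \<Phi> N" using t til N(3) by (auto simp: morse_tiling_def)
      then have "y \<in> \<Union>(set (map tile_set ts))" using un[of N] len by simp
      then obtain t' where t': "t' \<in> set ts" "y \<in> tile_set t'" by auto
      then have "t = t'" using til t y sub unfolding morse_tiling_def by blast
      then show "t \<in> set ts" using t' by simp
    qed
  qed
  moreover have "ts \<noteq> []" using len N(1) by auto
  ultimately show ?thesis using pc by blast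
qed

lemma list_shelling:
  assumes til: "morse_tiling K S \<tau>" and S: "closed S"
    and ts: "distinct ts" "set ts = \<tau>" "ts \<noteq> []" "prefix_closed {} (map tile_set ts)"
  shows "\<exists>N \<Phi>. morse_shelling K S \<tau> N \<Phi>"
proof -
  define \<Phi> where "\<Phi> k = \<Union>(set (take k (map tile_set ts)))" for k
  have dis: "\<And>s t. s \<in> \<tau> \<Longrightarrow> t \<in> \<tau> \<Longrightarrow> s \<noteq> t \<Longrightarrow> tile_set s \<inter> tile_set t = {}"
    and un: "(\<Union>t\<in>\<tau>. tile_set t) = S" and mt: "\<And>t. t \<in> \<tau> \<Longrightarrow> is_morse_tile t"
    using til by (auto simp: morse_tiling_def)
  have tiled: "\<Phi> k = (\<Union>t\<in>set (take k ts). tile_set t)" for k by (simp add: \<Phi>_def take_map)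
  have sub: "set (take k ts) \<subseteq> \<tau>" for k using set_take_subset ts(2) by metis
  have step: "\<Phi> (Suc k) = \<Phi> k \<union> tile_set (ts ! k)" "\<Phi> k \<inter> tile_set (ts ! k) = {}" "ts ! k \<in> \<tau>"
    if k: "k < length ts" for k
  proof -
    show "\<Phi> (Suc k) = \<Phi> k \<union> tile_set (ts ! k)" using k by (auto simp: tiled take_Suc_conv_app_nth)
    show in_\<tau>: "ts ! k \<in> \<tau>" using k ts(2) by (metis nth_mem)
    have "ts ! k \<notin> set (take k ts)"
      using ts(1) k by (metis distinct_take id_take_nth_drop not_distinct_conv_prefix take_Suc_conv_app_nth)
    then have "tile_set t \<inter> tile_set (ts ! k) = {}" if "t \<in> set (take k ts)" for t
      using dis[of t "ts ! k"] that in_\<tau> sub by blast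
    then show "\<Phi> k \<inter> tile_set (ts ! k) = {}" unfolding tiled by blast
  qed
  have "morse_shelling K S \<tau> (length ts) \<Phi>"
    unfolding morse_shelling_def
  proof (intro conjI ballI)
    show "morse_tiling K S \<tau>" by (rule til)
    show "1 \<le> length ts" using ts(3) by (simp add: Suc_le_eq)
    show "\<Phi> 0 = {}" by (simp add: \<Phi>_def)
    show "\<Phi> (length ts) = S" using un ts(2) by (simp add: \<Phi>_def)
  next
    fix i assume i: "i \<in> {1..length ts}"
    then obtain k where k: "i = Suc k" "k < length ts" by (cases i) auto
    note st = step[OF k(2)]
    have ne: "tile_set (ts ! k) \<noteq> {}" using tile_set_nonempty[OF mt[OF st(3)]] .
    show "\<Phi> (i - 1) \<subset> \<Phi> i" using st ne k by auto
    show "\<exists>t\<in>\<tau>. \<Phi> i - \<Phi> (i - 1) = tile_set t"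
      using st k by (intro bexI[of _ "ts ! k"]) auto
    have "closed (\<Phi> i)" using ts(4) by (simp add: prefix_closed_def \<Phi>_def)
    moreover have "\<Phi> i \<subseteq> S" unfolding tiled using un sub[of i] by blast
    ultimately have "closedin (top_of_set S) (\<Phi> i)" using closedin_closed_eq[OF S] by blast
    then show "morse_tiled_subset S \<tau> (\<Phi> i)" unfolding morse_tiled_subset_def using sub[of i] tiled[of i] by blast
  qed
  then show ?thesis by blast
qed

context ordered_complexes begin

lemma product_tilingD:
  assumes "product_tiling t1 t2 ts"
  shows "distinct ts"
    "\<forall>t\<in>set ts. is_morse_tile t \<and> underlying t \<in> staircase \<and> oriented_tile orientation t \<and>
        tile_dim t = tile_dim t1 + tile_dim t2"
    "\<forall>s\<in>set ts. \<forall>t\<in>set ts. s \<noteq> t \<longrightarrow> tile_set s \<inter> tile_set t = {}"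
    "(\<Union>t\<in>set ts. tile_set t) = tile_set t1 \<times> tile_set t2"
    "\<forall>k. \<exists>C. closed C \<and> (\<Union>t\<in>set (take k ts). tile_set t) = C \<inter> (tile_set t1 \<times> tile_set t2)"
    "\<forall>j. card {t \<in> set ts. tile_order t = j} =
        order_count (tile_dim t1) (tile_dim t2) (tile_order t1) (tile_order t2) j"
  using assms unfolding product_tiling_def by - (elim conjE, assumption)+

context
  fixes \<tau>1 \<tau>2 TS
  assumes til1: "morse_tiling K1 (\<Union>K1) \<tau>1" and til2: "morse_tiling K2 (\<Union>K2) \<tau>2"
    and TS: "\<And>t1 t2. t1 \<in> \<tau>1 \<Longrightarrow> t2 \<in> \<tau>2 \<Longrightarrow> product_tiling t1 t2 (TS t1 t2)"
begin

definition product_tiles :: "('a \<times> 'b) morse_tile set" where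
  "product_tiles = (\<Union>t1\<in>\<tau>1. \<Union>t2\<in>\<tau>2. set (TS t1 t2))"

lemma closed_unions: "closed (\<Union>K1)" "closed (\<Union>K2)"
  using closed_complex c1.complex c2.complex by blast+

lemma finite_factors: "finite \<tau>1" "finite \<tau>2"
  using finite_morse_tiling[OF c1.complex til1] finite_morse_tiling[OF c2.complex til2] .

lemmas block = product_tilingD[OF TS]

lemma block_union: "t1 \<in> \<tau>1 \<Longrightarrow> t2 \<in> \<tau>2 \<Longrightarrow> (\<Union>t\<in>set (TS t1 t2). tile_set t) = tile_set t1 \<times> tile_set t2"
  by (rule block(4))

lemma factor_disjoint:
  "t1 \<in> \<tau>1 \<Longrightarrow> t1' \<in> \<tau>1 \<Longrightarrow> t1 \<noteq> t1' \<Longrightarrow> tile_set t1 \<inter> tile_set t1' = {}"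
  "t2 \<in> \<tau>2 \<Longrightarrow> t2' \<in> \<tau>2 \<Longrightarrow> t2 \<noteq> t2' \<Longrightarrow> tile_set t2 \<inter> tile_set t2' = {}"
  using til1 til2 by (simp_all add: morse_tiling_def)

lemma block_disjoint:
  assumes "t1 \<in> \<tau>1" "t2 \<in> \<tau>2" "t1' \<in> \<tau>1" "t2' \<in> \<tau>2" "(t1, t2) \<noteq> (t1', t2')"
    "t \<in> set (TS t1 t2)" "t' \<in> set (TS t1' t2')"
  shows "tile_set t \<inter> tile_set t' = {}"
proof -
  have "tile_set t \<subseteq> tile_set t1 \<times> tile_set t2" "tile_set t' \<subseteq> tile_set t1' \<times> tile_set t2'"
    using block_union[OF assms(1,2)] block_union[OF assms(3,4)] assms(6,7) by blast+
  moreover have "tile_set t1 \<inter> tile_set t1' = {} \<or> tile_set t2 \<inter> tile_set t2' = {}"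
    using assms(5) factor_disjoint(1)[OF assms(1,3)] factor_disjoint(2)[OF assms(2,4)] by blast
  ultimately show ?thesis by blast
qed

lemma block_tiles: "t1 \<in> \<tau>1 \<Longrightarrow> t2 \<in> \<tau>2 \<Longrightarrow> t \<in> set (TS t1 t2) \<Longrightarrow>
    is_morse_tile t \<and> underlying t \<in> staircase \<and> oriented_tile orientation t \<and> tile_dim t = tile_dim t1 + tile_dim t2"
  using block(2) by blast

lemma block_sets_disjoint:
  assumes "t1 \<in> \<tau>1" "t2 \<in> \<tau>2" "t1' \<in> \<tau>1" "t2' \<in> \<tau>2" "(t1, t2) \<noteq> (t1', t2')"
  shows "set (TS t1 t2) \<inter> set (TS t1' t2') = {}"
proof (rule ccontr)
  assume "set (TS t1 t2) \<inter> set (TS t1' t2') \<noteq> {}"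
  then obtain t where t: "t \<in> set (TS t1 t2)" "t \<in> set (TS t1' t2')" by blast
  then have "tile_set t = {}" using block_disjoint[OF assms t] by blast
  then show False using tile_set_nonempty block_tiles[OF assms(1,2) t(1)] by blast
qed

text \<open>
  A product of tiles has dimension at least \<open>j\<close> if and only if the factors have dimensions at
  least \<open>i\<close> and \<open>j - i\<close> for some \<open>i \<le> j\<close>, so the union of these products is a finite union of
  products of closed sets.
\<close>

lemma product_morse_tiling: "morse_tiling staircase (\<Union>staircase) product_tiles"
  unfolding morse_tiling_def
proof (intro conjI ballI allI impI)
  have un1: "(\<Union>t\<in>\<tau>1. tile_set t) = \<Union>K1" and un2: "(\<Union>t\<in>\<tau>2. tile_set t) = \<Union>K2"
    using til1 til2 by (auto simp: morse_tiling_def)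
  show "is_morse_tile t" "underlying t \<in> staircase" if "t \<in> product_tiles" for t
    using that block_tiles unfolding product_tiles_def by blast+
  have "(\<Union>t\<in>product_tiles. tile_set t) = (\<Union>t1\<in>\<tau>1. \<Union>t2\<in>\<tau>2. \<Union>t\<in>set (TS t1 t2). tile_set t)"
    unfolding product_tiles_def by blast
  also have "\<dots> = (\<Union>t1\<in>\<tau>1. \<Union>t2\<in>\<tau>2. tile_set t1 \<times> tile_set t2)" using block_union by simp
  also have "\<dots> = (\<Union>t\<in>\<tau>1. tile_set t) \<times> (\<Union>t\<in>\<tau>2. tile_set t)" by blast
  also have "\<dots> = \<Union>staircase" unfolding un1 un2 union_staircase ..
  finally show "(\<Union>t\<in>product_tiles. tile_set t) = \<Union>staircase" .
  show "tile_set s \<inter> tile_set t = {}" if st: "s \<in> product_tiles" "t \<in> product_tiles" "s \<noteq> t" for s t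
  proof -
    obtain t1 t2 where a: "t1 \<in> \<tau>1" "t2 \<in> \<tau>2" "s \<in> set (TS t1 t2)" using st(1) unfolding product_tiles_def by blast
    obtain t1' t2' where b: "t1' \<in> \<tau>1" "t2' \<in> \<tau>2" "t \<in> set (TS t1' t2')" using st(2) unfolding product_tiles_def by blast
    show ?thesis
    proof (cases "(t1, t2) = (t1', t2')")
      case True
      then show ?thesis using block(3)[OF a(1,2)] a(3) b(3) st(3) by blast
    next
      case False
      then show ?thesis by (rule block_disjoint[OF a(1,2) b(1,2) _ a(3) b(3)])
    qed
  qed
  show "closedin (top_of_set (\<Union>staircase)) (\<Union>t\<in>{t\<in>product_tiles. j \<le> tile_dim t}. tile_set t)" for j
  proof -
    define D1 where "D1 i = (\<Union>t\<in>{t\<in>\<tau>1. i \<le> tile_dim t}. tile_set t)" for i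
    define D2 where "D2 i = (\<Union>t\<in>{t\<in>\<tau>2. i \<le> tile_dim t}. tile_set t)" for i
    have cl: "closedin (top_of_set (\<Union>K1)) (D1 i)" "closedin (top_of_set (\<Union>K2)) (D2 i)" for i
      using til1 til2 by (simp_all add: morse_tiling_def D1_def D2_def)
    have "(\<Union>t\<in>{t\<in>product_tiles. j \<le> tile_dim t}. tile_set t) = (\<Union>i\<in>{..j}. D1 i \<times> D2 (j - i))"
    proof (intro equalityI subsetI)
      fix y assume "y \<in> (\<Union>t\<in>{t\<in>product_tiles. j \<le> tile_dim t}. tile_set t)"
      then obtain t where t: "t \<in> product_tiles" "j \<le> tile_dim t" "y \<in> tile_set t" by blast
      obtain t1 t2 where a: "t1 \<in> \<tau>1" "t2 \<in> \<tau>2" "t \<in> set (TS t1 t2)" using t(1) unfolding product_tiles_def by blast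
      have y: "y \<in> tile_set t1 \<times> tile_set t2" using block_union[OF a(1,2)] a(3) t(3) by blast
      have d: "j \<le> tile_dim t1 + tile_dim t2" using block_tiles[OF a] t(2) by simp
      \<comment> \<open>the largest admissible share of the first factor\<close>
      define i where "i = min j (tile_dim t1)"
      have "i \<le> tile_dim t1" "j - i \<le> tile_dim t2" "i \<le> j" using d by (auto simp: i_def)
      then have "y \<in> D1 i \<times> D2 (j - i)" "i \<in> {..j}" using y a(1,2) unfolding D1_def D2_def by auto
      then show "y \<in> (\<Union>i\<in>{..j}. D1 i \<times> D2 (j - i))" by blast
    next
      fix y assume "y \<in> (\<Union>i\<in>{..j}. D1 i \<times> D2 (j - i))"
      then obtain i where i: "i \<le> j" "y \<in> D1 i \<times> D2 (j - i)" by blast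
      then obtain t1 t2 where a: "t1 \<in> \<tau>1" "t2 \<in> \<tau>2" "i \<le> tile_dim t1" "j - i \<le> tile_dim t2"
        "y \<in> tile_set t1 \<times> tile_set t2" unfolding D1_def D2_def by auto
      then obtain t where t: "t \<in> set (TS t1 t2)" "y \<in> tile_set t" using block_union[OF a(1,2)] by blast
      have "j \<le> tile_dim t" using block_tiles[OF a(1,2) t(1)] a(3,4) by simp
      then show "y \<in> (\<Union>t\<in>{t\<in>product_tiles. j \<le> tile_dim t}. tile_set t)"
        using t a(1,2) unfolding product_tiles_def by blast
    qed
    moreover have "closedin (top_of_set (\<Union>staircase)) (\<Union>i\<in>{..j}. D1 i \<times> D2 (j - i))"
      unfolding union_staircase using cl by (intro closedin_Union) (auto intro: closedin_Times)
    ultimately show ?thesis by simp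
  qed
qed simp

lemma product_tame: "tame staircase product_tiles"
  by (rule orientation_tame) (use block_tiles in \<open>unfold product_tiles_def, blast\<close>)

lemma product_palindromic:
  assumes "pure_dimensional \<tau>1" "pure_dimensional \<tau>2"
    and pal: "palindromic (h_vector \<tau>1)" "palindromic (h_vector \<tau>2)"
  shows "palindromic (h_vector product_tiles)"
proof (cases "\<tau>1 = {} \<or> \<tau>2 = {}")
  case True
  then have "product_tiles = {}" by (auto simp: product_tiles_def)
  then show ?thesis by (simp add: palindromic_h_vector)
next
  case False
  obtain n m where n: "\<forall>t\<in>\<tau>1. tile_dim t = n" and m: "\<forall>t\<in>\<tau>2. tile_dim t = m"
    using assms(1,2) by (auto simp: pure_dimensional_def)
  have const: "tiling_dim \<tau> = k" if "\<tau> \<noteq> {}" "\<forall>t\<in>\<tau>. tile_dim t = k" for \<tau> :: "'c::euclidean_space morse_tile set" and k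
  proof -
    have "tile_dim ` \<tau> = {k}" using that by auto
    then show ?thesis by (simp add: tiling_dim_def)
  qed
  obtain s1 s2 where s: "s1 \<in> \<tau>1" "s2 \<in> \<tau>2" using False by blast
  have mt: "is_morse_tile s1" "is_morse_tile s2" using s til1 til2 by (auto simp: morse_tiling_def)
  have "TS s1 s2 \<noteq> []"
    using block_union[OF s] tile_set_nonempty[OF mt(1)] tile_set_nonempty[OF mt(2)] by auto
  then have ne: "product_tiles \<noteq> {}" using s unfolding product_tiles_def by (metis UN_I empty_iff last_in_set)
  have dims: "tiling_dim \<tau>1 = n" "tiling_dim \<tau>2 = m" "tiling_dim product_tiles = n + m"
    using const[OF _ n] const[OF _ m] const[OF ne, of "n + m"] False block_tiles n m by (auto simp: product_tiles_def)
  have le: "\<And>t. t \<in> \<tau>1 \<Longrightarrow> tile_order t \<le> Suc n" "\<And>t. t \<in> \<tau>2 \<Longrightarrow> tile_order t \<le> Suc m"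
    using til1 til2 tile_order_le n m unfolding morse_tiling_def by metis+
  define H where "H j = card {t \<in> product_tiles. tile_order t = j}" for j
  have H: "H j = (\<Sum>t1\<in>\<tau>1. \<Sum>t2\<in>\<tau>2. order_count n m (tile_order t1) (tile_order t2) j)" for j
  proof -
    define B where "B x = {t \<in> set (TS (fst x) (snd x)). tile_order t = j}" for x
    have "{t \<in> product_tiles. tile_order t = j} = (\<Union>x\<in>\<tau>1 \<times> \<tau>2. B x)"
      by (rule set_eqI) (force simp: product_tiles_def B_def)
    moreover have "card (\<Union>x\<in>\<tau>1 \<times> \<tau>2. B x) = (\<Sum>x\<in>\<tau>1 \<times> \<tau>2. card (B x))"
    proof (rule card_UN_disjoint)
      show "finite (\<tau>1 \<times> \<tau>2)" using finite_factors by simp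
      show "\<forall>x\<in>\<tau>1 \<times> \<tau>2. finite (B x)" by (simp add: B_def)
      show "\<forall>x\<in>\<tau>1 \<times> \<tau>2. \<forall>y\<in>\<tau>1 \<times> \<tau>2. x \<noteq> y \<longrightarrow> B x \<inter> B y = {}"
      proof (intro ballI impI)
        fix x y assume xy: "x \<in> \<tau>1 \<times> \<tau>2" "y \<in> \<tau>1 \<times> \<tau>2" "x \<noteq> y"
        then have "set (TS (fst x) (snd x)) \<inter> set (TS (fst y) (snd y)) = {}"
          by (intro block_sets_disjoint) auto
        then show "B x \<inter> B y = {}" unfolding B_def by blast
      qed
    qed
    moreover have "card (B x) = order_count n m (tile_order (fst x)) (tile_order (snd x)) j" if "x \<in> \<tau>1 \<times> \<tau>2" for x
    proof -
      have x: "fst x \<in> \<tau>1" "snd x \<in> \<tau>2" using that by auto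
      show ?thesis unfolding B_def using block(6)[OF x] n x m by simp
    qed
    ultimately have "H j = (\<Sum>x\<in>\<tau>1 \<times> \<tau>2. order_count n m (tile_order (fst x)) (tile_order (snd x)) j)"
      by (simp add: H_def)
    then show ?thesis by (simp add: sum.cartesian_product case_prod_beta)
  qed
  have sym: "H j = H (Suc (n + m) - j)" if j: "j \<le> Suc (n + m)" for j
  proof -
    have "H j = (\<Sum>t1\<in>\<tau>1. \<Sum>t2\<in>\<tau>2. order_count n m (Suc n - tile_order t1) (Suc m - tile_order t2) (Suc (n + m) - j))"
      unfolding H using order_count_symmetric[OF le(1) le(2) j] by (intro sum.cong) simp_all
    also have "\<dots> = (\<Sum>t1\<in>\<tau>1. \<Sum>t2\<in>\<tau>2. order_count n m (Suc n - tile_order t1) (tile_order t2) (Suc (n + m) - j))"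
      using palindromic_sum[OF finite_factors(2) le(2) dims(2) pal(2), of "\<lambda>l. order_count n m _ l _"] by simp
    also have "\<dots> = (\<Sum>t1\<in>\<tau>1. \<Sum>t2\<in>\<tau>2. order_count n m (tile_order t1) (tile_order t2) (Suc (n + m) - j))"
      using palindromic_sum[OF finite_factors(1) le(1) dims(1) pal(1),
          of "\<lambda>k. \<Sum>t2\<in>\<tau>2. order_count n m k (tile_order t2) _"] by simp
    finally show ?thesis unfolding H .
  qed
  then show ?thesis unfolding palindromic_h_vector dims H_def by blast
qed

text \<open>
  Pairs of tiles are taken in lexicographic order. The union of the blocks before that of the pair
  \<open>(i, j)\<close> is \<open>Z = A i \<times> |K2| \<union> A (i+1) \<times> B j\<close>, where \<open>A i\<close> and \<open>B j\<close> are the unions of the first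
  tiles of the factors. It is closed, and so is the next such set, whose difference to \<open>Z\<close> is the
  product of the two tiles; hence relatively closed subsets of this product remain closed after
  adding \<open>Z\<close>.
\<close>

lemma product_shelling:
  assumes l1: "distinct ts1" "set ts1 = \<tau>1" "ts1 \<noteq> []" "prefix_closed {} (map tile_set ts1)"
    and l2: "distinct ts2" "set ts2 = \<tau>2" "ts2 \<noteq> []" "prefix_closed {} (map tile_set ts2)"
  shows "\<exists>N \<Phi>. morse_shelling staircase (\<Union>staircase) product_tiles N \<Phi>"
proof -
  define row where "row t1 = concat (map (TS t1) ts2)" for t1
  define ts where "ts = concat (map row ts1)"
  have set_ts: "set ts = product_tiles" by (auto simp: ts_def row_def product_tiles_def l1 l2)
  have ne: "TS t1 t2 \<noteq> []" if "t1 \<in> \<tau>1" "t2 \<in> \<tau>2" for t1 t2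
  proof -
    have "is_morse_tile t1" "is_morse_tile t2" using that til1 til2 by (auto simp: morse_tiling_def)
    then show ?thesis using block_union[OF that] tile_set_nonempty[of t1] tile_set_nonempty[of t2] by auto
  qed
  have row_ne: "row t1 \<noteq> []" if "t1 \<in> \<tau>1" for t1
    using ne[OF that] l2(2,3) by (auto simp: row_def)
  have d_row: "distinct (row t1)" if t1: "t1 \<in> \<tau>1" for t1
    unfolding row_def
  proof (rule distinct_concat)
    have "inj_on (TS t1) \<tau>2"
    proof (rule inj_onI, rule ccontr)
      fix x y assume xy: "x \<in> \<tau>2" "y \<in> \<tau>2" "TS t1 x = TS t1 y" "x \<noteq> y"
      then have "set (TS t1 x) = {}" using block_sets_disjoint[OF t1 xy(1) t1 xy(2)] by auto
      then show False using ne[OF t1 xy(1)] by simp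
    qed
    then show "distinct (map (TS t1) ts2)" using l2 by (simp add: distinct_map)
    show "distinct ys" if "ys \<in> set (map (TS t1) ts2)" for ys
      using that block(1)[OF t1] l2(2) by auto
    show "set ys \<inter> set zs = {}" if yz: "ys \<in> set (map (TS t1) ts2)" "zs \<in> set (map (TS t1) ts2)" "ys \<noteq> zs" for ys zs
    proof -
      obtain x y where "x \<in> \<tau>2" "y \<in> \<tau>2" "ys = TS t1 x" "zs = TS t1 y" using yz l2(2) by auto
      then show ?thesis using block_sets_disjoint[OF t1 _ t1, of x y] yz(3) by auto
    qed
  qed
  have row_disj: "set (row x) \<inter> set (row y) = {}" if xy: "x \<in> \<tau>1" "y \<in> \<tau>1" "x \<noteq> y" for x y
  proof (rule equals0I)
    fix t assume "t \<in> set (row x) \<inter> set (row y)"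
    then obtain a b where "a \<in> \<tau>2" "b \<in> \<tau>2" "t \<in> set (TS x a)" "t \<in> set (TS y b)"
      unfolding row_def using l2(2) by auto
    then show False using block_sets_disjoint[OF xy(1) _ xy(2), of a b] xy(3) by auto
  qed
  have "distinct ts"
    unfolding ts_def
  proof (rule distinct_concat)
    have "inj_on row \<tau>1"
    proof (rule inj_onI, rule ccontr)
      fix x y assume xy: "x \<in> \<tau>1" "y \<in> \<tau>1" "row x = row y" "x \<noteq> y"
      then have "set (row x) = {}" using row_disj[OF xy(1,2,4)] by auto
      then show False using row_ne[OF xy(1)] by simp
    qed
    then show "distinct (map row ts1)" using l1 by (simp add: distinct_map)
    show "distinct ys" if "ys \<in> set (map row ts1)" for ys using that d_row l1(2) by auto
    show "set ys \<inter> set zs = {}" if yz: "ys \<in> set (map row ts1)" "zs \<in> set (map row ts1)" "ys \<noteq> zs" for ys zs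
    proof -
      obtain x y where "x \<in> \<tau>1" "y \<in> \<tau>1" "ys = row x" "zs = row y" using yz l1(2) by auto
      then show ?thesis using row_disj[of x y] yz(3) by auto
    qed
  qed
  moreover have "ts \<noteq> []" using row_ne l1(2,3) by (auto simp: ts_def)
  moreover have "prefix_closed {} (map tile_set ts)"
  proof -
    define A where "A i = (\<Union>t\<in>set (take i ts1). tile_set t)" for i
    define B where "B i = (\<Union>t\<in>set (take i ts2). tile_set t)" for i
    have A: "closed (A i)" for i using l1(4) by (simp add: prefix_closed_def A_def take_map)
    have B: "closed (B i)" for i using l2(4) by (simp add: prefix_closed_def B_def take_map)
    have un2: "B (length ts2) = \<Union>K2" using til2 l2(2) by (auto simp: B_def morse_tiling_def)
    have A_Suc: "A (Suc i) = A i \<union> tile_set (ts1 ! i)" if "i < length ts1" for i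
      using that by (auto simp: A_def take_Suc_conv_app_nth)
    have B_Suc: "B (Suc i) = B i \<union> tile_set (ts2 ! i)" if "i < length ts2" for i
      using that by (auto simp: B_def take_Suc_conv_app_nth)
    have B_sub: "B i \<subseteq> \<Union>K2" for i
    proof -
      have "(\<Union>t\<in>\<tau>2. tile_set t) = \<Union>K2" using til2 by (simp add: morse_tiling_def)
      moreover have "set (take i ts2) \<subseteq> \<tau>2" using set_take_subset[of i ts2] l2(2) by simp
      ultimately show ?thesis unfolding B_def by blast
    qed
    have row_un: "\<Union>(set (map tile_set (concat (map (TS t1) (take j ts2))))) = tile_set t1 \<times> B j" if "t1 \<in> \<tau>1" for t1 j
    proof -
      have "set (take j ts2) \<subseteq> \<tau>2" using set_take_subset l2(2) by metis
      have "\<Union>(set (map tile_set (concat (map (TS t1) (take j ts2))))) =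
          (\<Union>t2\<in>set (take j ts2). \<Union>t\<in>set (TS t1 t2). tile_set t)" by auto
      also have "\<dots> = (\<Union>t2\<in>set (take j ts2). tile_set t1 \<times> tile_set t2)"
        using block_union[OF that] \<open>set (take j ts2) \<subseteq> \<tau>2\<close> by (intro SUP_cong) auto
      finally show ?thesis by (auto simp: B_def)
    qed
    have row_closed: "prefix_closed (A i \<times> \<Union>K2) (map tile_set (row (ts1 ! i)))" if i: "i < length ts1" for i
    proof -
      have t1: "ts1 ! i \<in> \<tau>1" using i l1(2) by (metis nth_mem)
      have "prefix_closed (A i \<times> \<Union>K2) (concat (map (\<lambda>t2. map tile_set (TS (ts1 ! i) t2)) ts2))"
      proof (rule prefix_closed_concat)
        show "closed (A i \<times> \<Union>K2)" using A closed_unions(2) by (intro closed_Times)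
        fix j assume "j < length (map (\<lambda>t2. map tile_set (TS (ts1 ! i) t2)) ts2)"
        then have j: "j < length ts2" by simp
        have t2: "ts2 ! j \<in> \<tau>2" using j l2(2) by (metis nth_mem)
        have eq: "A i \<times> \<Union>K2 \<union> \<Union>(set (concat (take j (map (\<lambda>t2. map tile_set (TS (ts1 ! i) t2)) ts2)))) =
            A i \<times> \<Union>K2 \<union> tile_set (ts1 ! i) \<times> B j"
          using row_un[OF t1, of j] by (simp add: take_map map_concat comp_def)
        define Z where "Z j = A i \<times> \<Union>K2 \<union> tile_set (ts1 ! i) \<times> B j" for j
        have "Z j = A i \<times> \<Union>K2 \<union> A (Suc i) \<times> B j" for j
          unfolding Z_def A_Suc[OF i] using B_sub[of j] by blast
        then have Zc: "closed (Z j)" for j using A B closed_unions(2) by (simp add: closed_Un closed_Times)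
        have "prefix_closed (Z j) (map tile_set (TS (ts1 ! i) (ts2 ! j)))"
          unfolding prefix_closed_def
        proof
          fix k
          obtain C where C: "closed C" "(\<Union>t\<in>set (take k (TS (ts1 ! i) (ts2 ! j))). tile_set t) = C \<inter> (tile_set (ts1 ! i) \<times> tile_set (ts2 ! j))"
            using block(5)[OF t1 t2] by blast
          have "Z j \<union> \<Union>(set (take k (map tile_set (TS (ts1 ! i) (ts2 ! j))))) = Z j \<union> (C \<inter> (tile_set (ts1 ! i) \<times> tile_set (ts2 ! j)))"
            using C(2) by (simp add: take_map)
          also have "\<dots> = Z j \<union> (C \<inter> Z (Suc j))" unfolding Z_def B_Suc[OF j] by blast
          finally show "closed (Z j \<union> \<Union>(set (take k (map tile_set (TS (ts1 ! i) (ts2 ! j))))))"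
            using Zc C(1) by (simp add: closed_Un closed_Int)
        qed
        then show "prefix_closed (A i \<times> \<Union>K2 \<union> \<Union>(set (concat (take j (map (\<lambda>t2. map tile_set (TS (ts1 ! i) t2)) ts2)))))
            (map (\<lambda>t2. map tile_set (TS (ts1 ! i) t2)) ts2 ! j)"
          unfolding eq using j by (simp add: Z_def)
      qed
      then show ?thesis by (simp add: row_def map_concat comp_def)
    qed
    have "prefix_closed {} (concat (map (\<lambda>t1. map tile_set (row t1)) ts1))"
    proof (rule prefix_closed_concat)
      fix i assume "i < length (map (\<lambda>t1. map tile_set (row t1)) ts1)"
      then have i: "i < length ts1" by simp
      have sub: "set (take i ts1) \<subseteq> \<tau>1" using set_take_subset l1(2) by metis
      have "\<Union>(set (concat (take i (map (\<lambda>t1. map tile_set (row t1)) ts1)))) =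
          (\<Union>t1\<in>set (take i ts1). \<Union>(set (map tile_set (row t1))))" by (auto simp: take_map)
      also have "\<dots> = (\<Union>t1\<in>set (take i ts1). tile_set t1 \<times> \<Union>K2)"
      proof (rule SUP_cong[OF refl])
        fix t1 assume "t1 \<in> set (take i ts1)"
        then have "t1 \<in> \<tau>1" using sub by blast
        from row_un[OF this, of "length ts2"]
        show "\<Union>(set (map tile_set (row t1))) = tile_set t1 \<times> \<Union>K2" unfolding un2 row_def by simp
      qed
      also have "\<dots> = A i \<times> \<Union>K2" by (auto simp: A_def)
      finally show "prefix_closed ({} \<union> \<Union>(set (concat (take i (map (\<lambda>t1. map tile_set (row t1)) ts1)))))
          (map (\<lambda>t1. map tile_set (row t1)) ts1 ! i)"
        using row_closed[OF i] i by simp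
    qed simp
    then show ?thesis by (simp add: ts_def map_concat comp_def)
  qed
  moreover have "closed (\<Union>staircase)" unfolding union_staircase using closed_unions by (intro closed_Times)
  ultimately show ?thesis using list_shelling[OF product_morse_tiling] set_ts by blast
qed

end

end

lemma tame_product_data:
  assumes K: "simplicial_complex K1" "simplicial_complex K2"
    and \<tau>: "morse_tiling K1 (\<Union>K1) \<tau>1" "tame K1 \<tau>1" "morse_tiling K2 (\<Union>K2) \<tau>2" "tame K2 \<tau>2"
  shows "\<exists>R1 R2 TS. ordered_complexes K1 R1 K2 R2 \<and>
    (\<forall>t1\<in>\<tau>1. \<forall>t2\<in>\<tau>2. ordered_complexes.product_tiling K1 R1 K2 R2 t1 t2 (TS t1 t2))"
proof -
  obtain R1 where R1: "ordered_complex K1 R1" "\<forall>t\<in>\<tau>1. oriented_tile R1 t" using tame_orders[OF K(1) \<tau>(2)] by blast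
  obtain R2 where R2: "ordered_complex K2 R2" "\<forall>t\<in>\<tau>2. oriented_tile R2 t" using tame_orders[OF K(2) \<tau>(4)] by blast
  interpret ordered_complexes K1 R1 K2 R2 using R1(1) R2(1) by (rule ordered_complexes.intro)
  have "\<exists>ts. product_tiling t1 t2 ts" if "t1 \<in> \<tau>1" "t2 \<in> \<tau>2" for t1 t2
    by (rule product_tiling_exists) (use that \<tau>(1,3) R1(2) R2(2) in \<open>auto simp: morse_tiling_def\<close>)
  then have "\<forall>t1\<in>\<tau>1. \<forall>t2\<in>\<tau>2. product_tiling t1 t2 (SOME ts. product_tiling t1 t2 ts)" by (meson someI_ex)
  then show ?thesis using ordered_complexes_axioms
    by (intro exI[of _ R1] exI[of _ R2] exI[of _ "\<lambda>t1 t2. SOME ts. product_tiling t1 t2 ts"]) simp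
qed

theorem theorem1p5:
  fixes K1 :: "'a::euclidean_space set set" and K2 :: "'b::euclidean_space set set"
  assumes "simplicial_complex K1" and "simplicial_complex K2"
  shows
    "(\<forall>\<tau>1 \<tau>2. tame_morse_tiling K1 \<tau>1 \<and> tame_morse_tiling K2 \<tau>2 \<longrightarrow>
        (\<exists>T \<tau>. primitive_triangulation (product_complex K1 K2) T \<and>
           tame_morse_tiling T \<tau> \<and>
           (pure_dimensional \<tau>1 \<and> pure_dimensional \<tau>2 \<and>
            palindromic (h_vector \<tau>1) \<and> palindromic (h_vector \<tau>2) \<longrightarrow>
            palindromic (h_vector \<tau>)))) \<and>
     (\<forall>\<tau>1 N1 \<Phi>1 \<tau>2 N2 \<Phi>2. tame_morse_shelling K1 \<tau>1 N1 \<Phi>1 \<and> tame_morse_shelling K2 \<tau>2 N2 \<Phi>2 \<longrightarrow>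
        (\<exists>T \<tau> N \<Phi>. primitive_triangulation (product_complex K1 K2) T \<and>
           tame_morse_shelling T \<tau> N \<Phi> \<and>
           (pure_dimensional \<tau>1 \<and> pure_dimensional \<tau>2 \<and>
            palindromic (h_vector \<tau>1) \<and> palindromic (h_vector \<tau>2) \<longrightarrow>
            palindromic (h_vector \<tau>))))"
proof (intro conjI allI impI, goal_cases)
  case (1 \<tau>1 \<tau>2)
  then have \<tau>: "morse_tiling K1 (\<Union>K1) \<tau>1" "tame K1 \<tau>1" "morse_tiling K2 (\<Union>K2) \<tau>2" "tame K2 \<tau>2"
    by (auto simp: tame_morse_tiling_def)
  obtain R1 R2 TS where oc: "ordered_complexes K1 R1 K2 R2"
    and TS: "\<forall>t1\<in>\<tau>1. \<forall>t2\<in>\<tau>2. ordered_complexes.product_tiling K1 R1 K2 R2 t1 t2 (TS t1 t2)"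
    using tame_product_data[OF assms \<tau>] by blast
  interpret ordered_complexes K1 R1 K2 R2 by (rule oc)
  note TS' = TS[rule_format]
  show ?case
    using staircase_primitive product_morse_tiling[OF \<tau>(1,3) TS'] product_tame[OF \<tau>(1,3) TS']
      product_palindromic[OF \<tau>(1,3) TS'] unfolding tame_morse_tiling_def by blast
next
  case (2 \<tau>1 N1 \<Phi>1 \<tau>2 N2 \<Phi>2)
  then have sh: "morse_shelling K1 (\<Union>K1) \<tau>1 N1 \<Phi>1" "morse_shelling K2 (\<Union>K2) \<tau>2 N2 \<Phi>2"
    and tm: "tame K1 \<tau>1" "tame K2 \<tau>2"
    by (auto simp: tame_morse_shelling_def)
  have \<tau>: "morse_tiling K1 (\<Union>K1) \<tau>1" "tame K1 \<tau>1" "morse_tiling K2 (\<Union>K2) \<tau>2" "tame K2 \<tau>2"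
    using sh tm by (auto simp: morse_shelling_def)
  obtain R1 R2 TS where oc: "ordered_complexes K1 R1 K2 R2"
    and TS: "\<forall>t1\<in>\<tau>1. \<forall>t2\<in>\<tau>2. ordered_complexes.product_tiling K1 R1 K2 R2 t1 t2 (TS t1 t2)"
    using tame_product_data[OF assms \<tau>] by blast
  interpret ordered_complexes K1 R1 K2 R2 by (rule oc)
  note TS' = TS[rule_format]
  obtain ts1 where l1: "distinct ts1" "set ts1 = \<tau>1" "ts1 \<noteq> []" "prefix_closed {} (map tile_set ts1)"
    using shelling_list[OF sh(1) closed_complex[OF assms(1)]] by blast
  obtain ts2 where l2: "distinct ts2" "set ts2 = \<tau>2" "ts2 \<noteq> []" "prefix_closed {} (map tile_set ts2)"
    using shelling_list[OF sh(2) closed_complex[OF assms(2)]] by blast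
  obtain N \<Phi> where "morse_shelling staircase (\<Union>staircase) (product_tiles \<tau>1 \<tau>2 TS) N \<Phi>"
    using product_shelling[OF \<tau>(1,3) TS' l1 l2] by blast
  then show ?case
    using staircase_primitive product_tame[OF \<tau>(1,3) TS'] product_palindromic[OF \<tau>(1,3) TS']
    unfolding tame_morse_shelling_def by blast
qed

end
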